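(* Let $(\mathbb P^{s,x})_{(s,x)\in[0,T]\times E}$ be a Markov canonical class, associated to a transition function measurable in time, which solves a well-posed Martingale Problem associated to some $(\mathcal D(a),a)$. Let $f\in\mathcal B([0,T]\times E\times\mathbb R\times\mathbb R,\mathbb R)$ and $g\in\mathcal B(E,\mathbb R)$ be such that, for some constant $C>0$: $g(X_T)\in L^2(\mathbb P^{s,x})$ for all $(s,x)\in[0,T]\times E$; $f(\cdot,\cdot,0,0)\in\mathcal L^2_X$; and $|f(t,x,y,z)|\le |f(t,x,0,0)|+C(|y|+|z|)$ for all $(t,x,y,z)$. Then every decoupled mild solution of $Pseudo\text{-}PDE(f,g)$ is also a martingale solution of $Pseudo\text{-}PDE(f,g)$. Moreover, if $(u,v)$ solves $IP(f,g)$, then $v^2=\mathfrak G(u)$ up to zero potential sets.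
   Context: Let $T\in(0,\infty)$ and let $E$ be a Polish space. $\mathcal B(F,G)$ denotes the set of Borel functions $F\to G$. $\Omega=\mathbb D([0,T],E)$ is the space of functions $[0,T]\to E$ that are right-continuous with left limits and continuous at time $T$; $X_t(\omega)=\omega(t)$; $\mathcal F=\sigma(X_r:r\in[0,T])$; $\mathcal F_t=\bigcap_{s\in(t,T]}\sigma(X_r:r\le s)$ for $t<T$, and $\mathcal F_T=\mathcal F$. A transition function is a map $p:[0,T]\times E\times[0,T]\times\mathcal B(E)\to[0,1]$ such that $x\mapsto p(s,x,t,A)$ is Borel, $p(s,x,t,\cdot)$ is a probability measure, $p(s,x,t,A)=1_A(x)$ if $t\le s$, and $\int_E p(s,x,t,dy)p(t,y,u,A)=p(s,x,u,A)$ if $s<t<u$. It is measurable in time if $(s,x)\mapsto p(s,x,t,A)$ is Borel for all $t,A$. A Markov canonical class associated to $p$ is a family of probability measures $(\mathbb P^{s,x})_{(s,x)\in[0,T]\times E}$ on $(\Omega,\mathcal F)$ with $\mathbb P^{s,x}(X_t\in A)=p(s,x,t,A)$ and, for $s\le t\le u$, $\mathbb P^{s,x}(X_u\in A|\mathcal F_t)=p(t,X_t,u,A)$ $\mathbb P^{s,x}$-a.s. $\mathbb E^{s,x}$ is the expectation under $\mathbb P^{s,x}$. Under $\mathbb P^{s,x}$ one works on the stochastic basis obtained by completing $\mathcal F$ and all $\mathcal F_t$ with the $\mathbb P^{s,x}$-negligible sets. Martingale Problem: $\mathcal D(a)\subset\mathcal B([0,T]\times E,\mathbb R)$ is a linear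 algebra and $a:\mathcal D(a)\to\mathcal B([0,T]\times E,\mathbb R)$ is linear. $(\mathbb P^{s,x})$ solves the Martingale Problem associated to $(\mathcal D(a),a)$ if for every $(s,x)$: (a) $\mathbb P^{s,x}(\forall t\in[0,s],X_t=x)=1$; (b) for every $\phi\in\mathcal D(a)$, $\phi(\cdot,X_\cdot)-\int_s^\cdot a(\phi)(r,X_r)dr$ on $[s,T]$ is a càdlàg $(\mathbb P^{s,x},(\mathcal F_t)_{t\in[s,T]})$-local martingale. It is well-posed if for each $(s,x)$, $\mathbb P^{s,x}$ is the only probability satisfying (a) and (b). $\mathcal L^p_X$ ($p\geq 1$) is the set of $\phi\in\mathcal B([0,T]\times E,\mathbb R)$ with $\mathbb E^{s,x}[\int_s^T|\phi(r,X_r)|^pdr]<\infty$ for every $(s,x)\in[0,T]\times E$. A Borel set $A\subset[0,T]\times E$ is of zero potential if $\mathbb E^{s,x}[\int_s^T1_{\{(t,X_t)\in A\}}dt]=0$ for all $(s,x)$. $\mathcal H^2_0$ is the space of càdlàg martingales $M$ starting at $0$ with $\sup_t|M_t|\in L^2$; $\langle M\rangle$ is the predictable angular bracket. Extended operators: $\mathcal D(\mathfrak a)$ is the set of $\phi\in\mathcal B([0,T]\times E,\mathbb R)$ for which there is $\psi\in\mathcal B([0,T]\times E,\mathbb R)$ such that under every $\mathbb P^{s,x}$ the process $1_{[s,T]}\big(\phi(\cdot,X_\cdot)-\phi(s,x)-\int_s^\cdot\psi(r,X_r)dr\big)$ has a càdlàg modification in $\mathcal H^2_0$, denoted $M[\phi]^{s,x}$.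 Such $\psi$ is unique up to zero potential sets and one sets $\mathfrak a(\phi):=\psi$. For $\phi\in\mathcal D(\mathfrak a)$, $\mathfrak G(\phi)$ is the (unique up to zero potential sets, chosen nonnegative) Borel function such that under every $\mathbb P^{s,x}$, $\langle M[\phi]^{s,x}\rangle=\int_s^\cdot\mathfrak G(\phi)(r,X_r)dr$ on $[s,T]$. $Pseudo\text{-}PDE(f,g)$ is the equation $a(u)+f(\cdot,\cdot,u,\Gamma(u)^{1/2})=0$ on $[0,T]\times E$, $u(T,\cdot)=g$, where $\Gamma(u)=a(u^2)-2ua(u)$. A martingale solution is a function $u\in\mathcal D(\mathfrak a)$ such that $\mathfrak a(u)=-f(\cdot,\cdot,u,\mathfrak G(u)^{1/2})$ up to zero potential sets and $u(T,\cdot)=g$. $P_{s,t}[\phi](x):=\mathbb E^{s,x}[\phi(X_t)]$ for $s\le t$, when the expectation is finite. A pair $(u,v)$ of Borel functions on $[0,T]\times E$ with $v\ge0$ is a solution of $IP(f,g)$ (identification problem) if $u,v\in\mathcal L^2_X$ and for every $(s,x)\in[0,T]\times E$, $$u(s,x)=P_{s,T}[g](x)+\int_s^TP_{s,r}[f(r,\cdot,u(r,\cdot),v(r,\cdot))](x)dr,$$ $$u^2(s,x)=P_{s,T}[g^2](x)-\int_s^TP_{s,r}[v^2(r,\cdot)-2u(r,\cdot)f(r,\cdot,u(r,\cdot),v(r,\cdot))](x)dr.$$ $u$ is a decoupled mild solution of $Pseudo\text{-}PDE(f,g)$ if there is $v$ such that $(u,v)$ solves $IP(f,g)$. *)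

theory Defs
  imports "HOL-Probability.Probability"
begin

section \<open>The canonical space\<close>

text \<open>
  Functions on \<open>[0,T] \<times> E\<close> are represented by curried functions on \<open>real \<Rightarrow> 'e\<close>; only their values
  at times in \<open>{0..T}\<close> ever matter. Paths are functions on \<open>real\<close>, made unique representatives of
  functions on \<open>[0,T]\<close> by requiring them to be \<open>extensional\<close>.
\<close>

definition cadlag_on :: "real \<Rightarrow> real \<Rightarrow> (real \<Rightarrow> 'a::topological_space) \<Rightarrow> bool" where
  "cadlag_on a b f \<longleftrightarrow>
     (\<forall>t\<in>{a..<b}. (f \<longlongrightarrow> f t) (at_right t)) \<and>
     (\<forall>t\<in>{a<..b}. \<exists>l. (f \<longlongrightarrow> l) (at_left t))"

definition path_space :: "real \<Rightarrow> (real \<Rightarrow> 'e::polish_space) set" where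
  "path_space T = {\<omega> \<in> extensional {0..T}. cadlag_on 0 T \<omega> \<and> (\<omega> \<longlongrightarrow> \<omega> T) (at_left T)}"

definition path_sigma :: "real \<Rightarrow> real set \<Rightarrow> (real \<Rightarrow> 'e::polish_space) measure" where
  "path_sigma T I =
     sigma (path_space T) {{\<omega> \<in> path_space T. \<omega> r \<in> A} | r A. r \<in> I \<and> A \<in> sets borel}"

definition path_filtration :: "real \<Rightarrow> real \<Rightarrow> (real \<Rightarrow> 'e::polish_space) measure" where
  "path_filtration T t =
     (if t < T then sigma (path_space T) (\<Inter>s\<in>{t<..T}. sets (path_sigma T {0..s}))
      else path_sigma T {0..T})"

definition completed_filtration ::
    "(real \<Rightarrow> 'a measure) \<Rightarrow> 'a measure \<Rightarrow> real \<Rightarrow> 'a measure" where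
  "completed_filtration F M t = sigma (space M) (sets (F t) \<union> null_sets (completion M))"

definition borel_funs :: "real \<Rightarrow> (real \<Rightarrow> 'e::polish_space \<Rightarrow> real) set" where
  "borel_funs T =
     {\<phi>. (\<lambda>(t, x). \<phi> t x) \<in> borel_measurable (restrict_space borel ({0..T} \<times> UNIV))}"

section \<open>Markov canonical classes\<close>

definition transition_function ::
    "real \<Rightarrow> (real \<Rightarrow> 'e::polish_space \<Rightarrow> real \<Rightarrow> 'e measure) \<Rightarrow> bool" where
  "transition_function T p \<longleftrightarrow>
     (\<forall>s\<in>{0..T}. \<forall>x. \<forall>t\<in>{0..T}. prob_space (p s x t) \<and> sets (p s x t) = sets borel) \<and>
     (\<forall>s\<in>{0..T}. \<forall>t\<in>{0..T}. \<forall>A\<in>sets borel. (\<lambda>x. measure (p s x t) A) \<in> borel_measurable borel) \<and>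
     (\<forall>s\<in>{0..T}. \<forall>x. \<forall>t\<in>{0..T}. \<forall>A\<in>sets borel.
        t \<le> s \<longrightarrow> measure (p s x t) A = indicator A x) \<and>
     (\<forall>s\<in>{0..T}. \<forall>x. \<forall>t\<in>{0..T}. \<forall>u\<in>{0..T}. \<forall>A\<in>sets borel.
        s < t \<and> t < u \<longrightarrow> (\<integral>y. measure (p t y u) A \<partial>p s x t) = measure (p s x u) A)"

definition measurable_in_time ::
    "real \<Rightarrow> (real \<Rightarrow> 'e::polish_space \<Rightarrow> real \<Rightarrow> 'e measure) \<Rightarrow> bool" where
  "measurable_in_time T p \<longleftrightarrow>
     (\<forall>t\<in>{0..T}. \<forall>A\<in>sets borel. (\<lambda>s x. measure (p s x t) A) \<in> borel_funs T)"

definition markov_canonical_class ::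
    "real \<Rightarrow> (real \<Rightarrow> 'e::polish_space \<Rightarrow> real \<Rightarrow> 'e measure) \<Rightarrow>
     (real \<Rightarrow> 'e \<Rightarrow> (real \<Rightarrow> 'e) measure) \<Rightarrow> bool" where
  "markov_canonical_class T p P \<longleftrightarrow>
     (\<forall>s\<in>{0..T}. \<forall>x.
        prob_space (P s x) \<and> sets (P s x) = sets (path_sigma T {0..T}) \<and>
        (\<forall>t\<in>{0..T}. \<forall>A\<in>sets borel.
           measure (P s x) {\<omega> \<in> space (P s x). \<omega> t \<in> A} = measure (p s x t) A) \<and>
        (\<forall>t\<in>{s..T}. \<forall>u\<in>{t..T}. \<forall>A\<in>sets borel.
           AE \<omega> in P s x.
             real_cond_exp (P s x) (path_filtration T t) (\<lambda>\<omega>'. indicator A (\<omega>' u)) \<omega>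
               = measure (p t (\<omega> t) u) A))"

section \<open>Martingales\<close>

definition martingale ::
    "'a measure \<Rightarrow> (real \<Rightarrow> 'a measure) \<Rightarrow> real set \<Rightarrow> (real \<Rightarrow> 'a \<Rightarrow> real) \<Rightarrow> bool" where
  "martingale M F I X \<longleftrightarrow>
     (\<forall>t\<in>I. X t \<in> borel_measurable (F t) \<and> integrable M (X t)) \<and>
     (\<forall>s\<in>I. \<forall>t\<in>I. s \<le> t \<longrightarrow> (AE \<omega> in M. real_cond_exp M (F s) (X t) \<omega> = X s \<omega>))"

text \<open>
  On the compact time interval \<open>[s,T]\<close> a localizing sequence is an increasing sequence of
  \<open>[s,T]\<close>-valued stopping times which almost surely is eventually equal to \<open>T\<close>. Path properties
  are required for almost every path.
\<close>

definition cadlag_local_martingale ::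
    "'a measure \<Rightarrow> (real \<Rightarrow> 'a measure) \<Rightarrow> real \<Rightarrow> real \<Rightarrow> (real \<Rightarrow> 'a \<Rightarrow> real) \<Rightarrow> bool" where
  "cadlag_local_martingale M F s T X \<longleftrightarrow>
     (\<forall>t\<in>{s..T}. X t \<in> borel_measurable (F t)) \<and>
     (AE \<omega> in M. cadlag_on s T (\<lambda>t. X t \<omega>)) \<and>
     (\<exists>\<tau> :: nat \<Rightarrow> 'a \<Rightarrow> real.
        (\<forall>n. stopping_time F (\<tau> n)) \<and>
        (\<forall>n. \<forall>\<omega>\<in>space M. \<tau> n \<omega> \<in> {s..T} \<and> \<tau> n \<omega> \<le> \<tau> (Suc n) \<omega>) \<and>
        (AE \<omega> in M. \<exists>n. \<tau> n \<omega> = T) \<and>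
        (\<forall>n. martingale M F {s..T} (\<lambda>t \<omega>. X (min t (\<tau> n \<omega>)) \<omega>)))"

text \<open>The space \<open>\<H>\<^sup>2\<^sub>0\<close> on the time interval \<open>[0,T]\<close>.\<close>

definition H2_0 ::
    "'a measure \<Rightarrow> (real \<Rightarrow> 'a measure) \<Rightarrow> real \<Rightarrow> (real \<Rightarrow> 'a \<Rightarrow> real) set" where
  "H2_0 M F T =
     {N. martingale M F {0..T} N \<and>
         (AE \<omega> in M. cadlag_on 0 T (\<lambda>t. N t \<omega>)) \<and>
         (AE \<omega> in M. N 0 \<omega> = 0) \<and>
         (\<integral>\<^sup>+\<omega>. (SUP t\<in>{0..T}. ennreal ((N t \<omega>)\<^sup>2)) \<partial>M) < \<infinity>}"

definition predictable_sigma :: "'a set \<Rightarrow> (real \<Rightarrow> 'a measure) \<Rightarrow> real \<Rightarrow> (real \<times> 'a) measure" where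
  "predictable_sigma S F T =
     sigma ({0..T} \<times> S)
       ({{0} \<times> A | A. A \<in> sets (F 0)} \<union>
        {{s<..t} \<times> A | s t A. 0 \<le> s \<and> s < t \<and> t \<le> T \<and> A \<in> sets (F s)})"

text \<open>
  \<open>A\<close> is a version of the angular bracket of \<open>N \<in> H2_0 M F T\<close>: the predictable increasing process
  starting at 0 that compensates the square of \<open>N\<close>, unique up to indistinguishability.
\<close>

definition angular_bracket ::
    "'a measure \<Rightarrow> (real \<Rightarrow> 'a measure) \<Rightarrow> real \<Rightarrow>
     (real \<Rightarrow> 'a \<Rightarrow> real) \<Rightarrow> (real \<Rightarrow> 'a \<Rightarrow> real) \<Rightarrow> bool" where
  "angular_bracket M F T N A \<longleftrightarrow>
     (\<lambda>(t, \<omega>). A t \<omega>) \<in> borel_measurable (predictable_sigma (space M) F T) \<and>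
     (AE \<omega> in M. A 0 \<omega> = 0 \<and> mono_on {0..T} (\<lambda>t. A t \<omega>) \<and> cadlag_on 0 T (\<lambda>t. A t \<omega>)) \<and>
     martingale M F {0..T} (\<lambda>t \<omega>. (N t \<omega>)\<^sup>2 - A t \<omega>)"

section \<open>The martingale problem\<close>

text \<open>
  \<open>D\<close> is an algebra of Borel functions on \<open>[0,T] \<times> E\<close> and \<open>a\<close> is linear on it. The second condition
  says that \<open>a \<phi>\<close> on \<open>[0,T] \<times> E\<close> only depends on \<open>\<phi>\<close> on \<open>[0,T] \<times> E\<close>.
\<close>

definition linear_operator_on_algebra ::
    "real \<Rightarrow> (real \<Rightarrow> 'e::polish_space \<Rightarrow> real) set \<Rightarrow>
     ((real \<Rightarrow> 'e \<Rightarrow> real) \<Rightarrow> (real \<Rightarrow> 'e \<Rightarrow> real)) \<Rightarrow> bool" where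
  "linear_operator_on_algebra T D a \<longleftrightarrow>
     D \<subseteq> borel_funs T \<and> a ` D \<subseteq> borel_funs T \<and>
     (\<forall>\<phi>\<in>D. \<forall>\<psi>\<in>D. (\<forall>t\<in>{0..T}. \<forall>x. \<phi> t x = \<psi> t x) \<longrightarrow> (\<forall>t\<in>{0..T}. \<forall>x. a \<phi> t x = a \<psi> t x)) \<and>
     (\<lambda>t x. 0) \<in> D \<and>
     (\<forall>\<phi>\<in>D. \<forall>\<psi>\<in>D.
        (\<lambda>t x. \<phi> t x + \<psi> t x) \<in> D \<and> (\<lambda>t x. \<phi> t x * \<psi> t x) \<in> D \<and>
        (\<forall>t\<in>{0..T}. \<forall>x. a (\<lambda>t x. \<phi> t x + \<psi> t x) t x = a \<phi> t x + a \<psi> t x)) \<and>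
     (\<forall>\<phi>\<in>D. \<forall>c. (\<lambda>t x. c * \<phi> t x) \<in> D \<and>
        (\<forall>t\<in>{0..T}. \<forall>x. a (\<lambda>t x. c * \<phi> t x) t x = c * a \<phi> t x))"

text \<open>
  The integrability clause makes explicit that the time integral in the martingale problem is
  well defined almost surely; the integral of the library is 0 otherwise.
\<close>

definition solves_mp_from ::
    "real \<Rightarrow> (real \<Rightarrow> 'e::polish_space \<Rightarrow> real) set \<Rightarrow>
     ((real \<Rightarrow> 'e \<Rightarrow> real) \<Rightarrow> (real \<Rightarrow> 'e \<Rightarrow> real)) \<Rightarrow>
     real \<Rightarrow> 'e \<Rightarrow> (real \<Rightarrow> 'e) measure \<Rightarrow> bool" where
  "solves_mp_from T D a s x Q \<longleftrightarrow>
     prob_space Q \<and> sets Q = sets (path_sigma T {0..T}) \<and>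
     (AE \<omega> in Q. \<forall>t\<in>{0..s}. \<omega> t = x) \<and>
     (\<forall>\<phi>\<in>D.
        (AE \<omega> in Q. set_integrable lborel {s..T} (\<lambda>r. a \<phi> r (\<omega> r))) \<and>
        cadlag_local_martingale Q (path_filtration T) s T
          (\<lambda>t \<omega>. \<phi> t (\<omega> t) - (LBINT r:{s..t}. a \<phi> r (\<omega> r))))"

definition solves_martingale_problem ::
    "real \<Rightarrow> (real \<Rightarrow> 'e::polish_space \<Rightarrow> real) set \<Rightarrow>
     ((real \<Rightarrow> 'e \<Rightarrow> real) \<Rightarrow> (real \<Rightarrow> 'e \<Rightarrow> real)) \<Rightarrow>
     (real \<Rightarrow> 'e \<Rightarrow> (real \<Rightarrow> 'e) measure) \<Rightarrow> bool" where
  "solves_martingale_problem T D a P \<longleftrightarrow> (\<forall>s\<in>{0..T}. \<forall>x. solves_mp_from T D a s x (P s x))"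

definition solves_well_posed_martingale_problem ::
    "real \<Rightarrow> (real \<Rightarrow> 'e::polish_space \<Rightarrow> real) set \<Rightarrow>
     ((real \<Rightarrow> 'e \<Rightarrow> real) \<Rightarrow> (real \<Rightarrow> 'e \<Rightarrow> real)) \<Rightarrow>
     (real \<Rightarrow> 'e \<Rightarrow> (real \<Rightarrow> 'e) measure) \<Rightarrow> bool" where
  "solves_well_posed_martingale_problem T D a P \<longleftrightarrow>
     solves_martingale_problem T D a P \<and>
     (\<forall>s\<in>{0..T}. \<forall>x. \<forall>Q. solves_mp_from T D a s x Q \<longrightarrow> Q = P s x)"

section \<open>Integrability classes and zero potential sets\<close>

definition LX ::
    "real \<Rightarrow> (real \<Rightarrow> 'e::polish_space \<Rightarrow> (real \<Rightarrow> 'e) measure) \<Rightarrow> real \<Rightarrow>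
     (real \<Rightarrow> 'e \<Rightarrow> real) set" where
  "LX T P q =
     {\<phi> \<in> borel_funs T. \<forall>s\<in>{0..T}. \<forall>x.
        (\<integral>\<^sup>+\<omega>. (\<integral>\<^sup>+r\<in>{s..T}. ennreal (\<bar>\<phi> r (\<omega> r)\<bar> powr q) \<partial>lborel) \<partial>P s x) < \<infinity>}"

definition zero_potential ::
    "real \<Rightarrow> (real \<Rightarrow> 'e::polish_space \<Rightarrow> (real \<Rightarrow> 'e) measure) \<Rightarrow> (real \<times> 'e) set \<Rightarrow> bool" where
  "zero_potential T P A \<longleftrightarrow>
     A \<in> sets borel \<and> A \<subseteq> {0..T} \<times> UNIV \<and>
     (\<forall>s\<in>{0..T}. \<forall>x.
        (\<integral>\<^sup>+\<omega>. (\<integral>\<^sup>+t\<in>{s..T}. indicator A (t, \<omega> t) \<partial>lborel) \<partial>P s x) = 0)"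

definition eq_up_to_zero_potential ::
    "real \<Rightarrow> (real \<Rightarrow> 'e::polish_space \<Rightarrow> (real \<Rightarrow> 'e) measure) \<Rightarrow>
     (real \<Rightarrow> 'e \<Rightarrow> real) \<Rightarrow> (real \<Rightarrow> 'e \<Rightarrow> real) \<Rightarrow> bool" where
  "eq_up_to_zero_potential T P \<phi> \<psi> \<longleftrightarrow>
     zero_potential T P {(t, x). t \<in> {0..T} \<and> \<phi> t x \<noteq> \<psi> t x}"

section \<open>Extended operators\<close>

text \<open>
  \<open>M\<close> is a version of the martingale \<open>M[\<phi>]\<^sup>s\<^sup>,\<^sup>x\<close> built with the candidate \<open>\<psi>\<close>
  for the extended generator, on the completed stochastic basis of \<open>P s x\<close>.
\<close>

definition extended_martingale ::
    "real \<Rightarrow> (real \<Rightarrow> 'e::polish_space \<Rightarrow> (real \<Rightarrow> 'e) measure) \<Rightarrow>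
     (real \<Rightarrow> 'e \<Rightarrow> real) \<Rightarrow> (real \<Rightarrow> 'e \<Rightarrow> real) \<Rightarrow> real \<Rightarrow> 'e \<Rightarrow>
     (real \<Rightarrow> (real \<Rightarrow> 'e) \<Rightarrow> real) \<Rightarrow> bool" where
  "extended_martingale T P \<phi> \<psi> s x M \<longleftrightarrow>
     M \<in> H2_0 (completion (P s x)) (completed_filtration (path_filtration T) (P s x)) T \<and>
     (\<forall>t\<in>{0..T}. AE \<omega> in P s x.
        M t \<omega> = indicator {s..T} t *
          (\<phi> t (\<omega> t) - \<phi> s x - (LBINT r:{s..t}. \<psi> r (\<omega> r))))"

text \<open>
  The extended generator and the extended carre du champ are only defined up to zero potential
  sets, so they are rendered as relations: \<open>\<psi>\<close> is a version of the extended generator of \<open>\<phi>\<close>,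
  and \<open>G\<close> is a version of its extended carre du champ.
\<close>

definition extended_generator ::
    "real \<Rightarrow> (real \<Rightarrow> 'e::polish_space \<Rightarrow> (real \<Rightarrow> 'e) measure) \<Rightarrow>
     (real \<Rightarrow> 'e \<Rightarrow> real) \<Rightarrow> (real \<Rightarrow> 'e \<Rightarrow> real) \<Rightarrow> bool" where
  "extended_generator T P \<phi> \<psi> \<longleftrightarrow>
     \<phi> \<in> borel_funs T \<and> \<psi> \<in> borel_funs T \<and>
     (\<forall>s\<in>{0..T}. \<forall>x.
        (AE \<omega> in P s x. set_integrable lborel {s..T} (\<lambda>r. \<psi> r (\<omega> r))) \<and>
        (\<exists>M. extended_martingale T P \<phi> \<psi> s x M))"

definition extended_domain ::
    "real \<Rightarrow> (real \<Rightarrow> 'e::polish_space \<Rightarrow> (real \<Rightarrow> 'e) measure) \<Rightarrow>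
     (real \<Rightarrow> 'e \<Rightarrow> real) set" where
  "extended_domain T P = {\<phi>. \<exists>\<psi>. extended_generator T P \<phi> \<psi>}"

definition extended_carre_du_champ ::
    "real \<Rightarrow> (real \<Rightarrow> 'e::polish_space \<Rightarrow> (real \<Rightarrow> 'e) measure) \<Rightarrow>
     (real \<Rightarrow> 'e \<Rightarrow> real) \<Rightarrow> (real \<Rightarrow> 'e \<Rightarrow> real) \<Rightarrow> bool" where
  "extended_carre_du_champ T P \<phi> G \<longleftrightarrow>
     G \<in> borel_funs T \<and> (\<forall>t\<in>{0..T}. \<forall>x. 0 \<le> G t x) \<and>
     (\<exists>\<psi>. extended_generator T P \<phi> \<psi> \<and>
        (\<forall>s\<in>{0..T}. \<forall>x. \<forall>M. extended_martingale T P \<phi> \<psi> s x M \<longrightarrow>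
           (\<exists>A. angular_bracket (completion (P s x))
                  (completed_filtration (path_filtration T) (P s x)) T M A \<and>
                (AE \<omega> in P s x. set_integrable lborel {s..T} (\<lambda>r. G r (\<omega> r)) \<and>
                   (\<forall>t\<in>{s..T}. A t \<omega> = (LBINT r:{s..t}. G r (\<omega> r)))))))"

section \<open>Solutions of the pseudo-PDE\<close>

definition martingale_solution ::
    "real \<Rightarrow> (real \<Rightarrow> 'e::polish_space \<Rightarrow> (real \<Rightarrow> 'e) measure) \<Rightarrow>
     (real \<Rightarrow> 'e \<Rightarrow> real \<Rightarrow> real \<Rightarrow> real) \<Rightarrow> ('e \<Rightarrow> real) \<Rightarrow> (real \<Rightarrow> 'e \<Rightarrow> real) \<Rightarrow> bool" where
  "martingale_solution T P f g u \<longleftrightarrow>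
     u \<in> extended_domain T P \<and>
     (\<exists>\<psi> G. extended_generator T P u \<psi> \<and> extended_carre_du_champ T P u G \<and>
        eq_up_to_zero_potential T P \<psi> (\<lambda>t x. - f t x (u t x) (sqrt (G t x)))) \<and>
     (\<forall>x. u T x = g x)"

definition transition_op ::
    "(real \<Rightarrow> 'e::polish_space \<Rightarrow> (real \<Rightarrow> 'e) measure) \<Rightarrow> real \<Rightarrow> real \<Rightarrow>
     ('e \<Rightarrow> real) \<Rightarrow> 'e \<Rightarrow> real" where
  "transition_op P s t \<phi> x = (\<integral>\<omega>. \<phi> (\<omega> t) \<partial>P s x)"

definition solves_IP ::
    "real \<Rightarrow> (real \<Rightarrow> 'e::polish_space \<Rightarrow> (real \<Rightarrow> 'e) measure) \<Rightarrow>
     (real \<Rightarrow> 'e \<Rightarrow> real \<Rightarrow> real \<Rightarrow> real) \<Rightarrow> ('e \<Rightarrow> real) \<Rightarrow>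
     (real \<Rightarrow> 'e \<Rightarrow> real) \<Rightarrow> (real \<Rightarrow> 'e \<Rightarrow> real) \<Rightarrow> bool" where
  "solves_IP T P f g u v \<longleftrightarrow>
     u \<in> LX T P 2 \<and> v \<in> LX T P 2 \<and> (\<forall>t\<in>{0..T}. \<forall>x. 0 \<le> v t x) \<and>
     (\<forall>s\<in>{0..T}. \<forall>x.
        u s x = transition_op P s T g x
          + (LBINT r:{s..T}. transition_op P s r (\<lambda>y. f r y (u r y) (v r y)) x) \<and>
        (u s x)\<^sup>2 = transition_op P s T (\<lambda>y. (g y)\<^sup>2) x
          - (LBINT r:{s..T}. transition_op P s r
               (\<lambda>y. (v r y)\<^sup>2 - 2 * u r y * f r y (u r y) (v r y)) x))"

definition decoupled_mild_solution ::
    "real \<Rightarrow> (real \<Rightarrow> 'e::polish_space \<Rightarrow> (real \<Rightarrow> 'e) measure) \<Rightarrow>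
     (real \<Rightarrow> 'e \<Rightarrow> real \<Rightarrow> real \<Rightarrow> real) \<Rightarrow> ('e \<Rightarrow> real) \<Rightarrow> (real \<Rightarrow> 'e \<Rightarrow> real) \<Rightarrow> bool" where
  "decoupled_mild_solution T P f g u \<longleftrightarrow> (\<exists>v. solves_IP T P f g u v)"

end

theory Submission
  imports Defs
begin

text \<open>
  Under each \<open>P s x\<close> the Markov property turns the first equation of the identification problem into
  \<open>u t X\<^sub>t + \<integral>\<^sub>s\<^sup>t f = E[g X\<^sub>T + \<integral>\<^sub>s\<^sup>T f | F\<^sub>t]\<close>, an \<open>L\<^sup>2\<close>-martingale; on the completed right-continuous basis it
  has a cadlag modification in \<open>H2_0\<close>, so \<open>- f\<close> is a version of the extended generator of \<open>u\<close>. The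
  second equation says in the same way that \<open>u t X\<^sub>t\<^sup>2 - \<integral>\<^sub>s\<^sup>t (v\<^sup>2 - 2 u f)\<close> is a martingale, and
  integration by parts shows that \<open>\<integral>\<^sub>s\<^sup>t v\<^sup>2\<close> compensates the square of the first martingale. If another
  generator and another bracket density are given, the two martingales and then the two brackets
  differ by a martingale with absolutely continuous paths, which vanishes.
\<close>

section \<open>Oscillation bounds and one-sided limits\<close>

text \<open>\<open>u\<close> is merely Borel, so \<open>u t (\<omega> t)\<close> has no path
  regularity: the cadlag version must come out of the martingale property alone. It equals the
  original process only almost surely at each time and so lives on the completed filtration, whereas
  the Markov property is stated for the raw one. Martingale statements are therefore kept as
  equalities of integrals over raw sets and moved to the completion at the very end. The Markov
  property is given for one future time and one Borel set; extending it to time integrals rests on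
  joint measurability, in time and starting point, of the law of the path at that time. No
  stochastic integral is formed for the bracket: the square is expanded backwards from the terminal
  time, where this is ordinary calculus for each path, and conditioned only afterwards. A competing
  generator is integrable only path by path, so the difference of the two martingales may have
  non-integrable variation; an exponential weight takes the place of localisation.\<close>

text \<open>
  \<open>moves e r xs\<close> counts the greedy \<open>e\<close>-displacements of \<open>xs\<close> from a reference point that starts
  at \<open>r\<close> and is reset at each displacement. It plays the role of an upcrossing count: for an
  \<open>L\<^sup>2\<close>-martingale every displacement costs at least \<open>e\<^sup>2\<close> of the final second moment.
\<close>

fun moves :: "real \<Rightarrow> real \<Rightarrow> real list \<Rightarrow> nat" where
  "moves e r [] = 0"
| "moves e r (a # as) = (if e \<le> \<bar>a - r\<bar> then Suc (moves e a as) else moves e r as)"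

text \<open>The reference point left behind by a scan; carrying it over makes the count additive
  under concatenation.\<close>

fun anchor :: "real \<Rightarrow> real \<Rightarrow> real list \<Rightarrow> real" where
  "anchor e r [] = r"
| "anchor e r (a # as) = anchor e (if e \<le> \<bar>a - r\<bar> then a else r) as"

lemma moves_append: "moves e r (xs @ ys) = moves e r xs + moves e (anchor e r xs) ys"
  by (induction xs arbitrary: r) auto

lemma moves_eq_0D: "moves e r xs = 0 \<Longrightarrow> x \<in> set xs \<Longrightarrow> \<bar>x - r\<bar> < e"
  by (induction xs arbitrary: r) (auto split: if_splits)

text \<open>Without a displacement all entries stay strictly within \<open>e\<close> of one
  reference point. That point is arbitrary, so the bound can be used after an unknown
  prefix.\<close>

lemma moves_pos: "a \<in> set xs \<Longrightarrow> b \<in> set xs \<Longrightarrow> 2 * e \<le> \<bar>a - b\<bar> \<Longrightarrow> 1 \<le> moves e r xs"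
  using moves_eq_0D[of e r xs a] moves_eq_0D[of e r xs b] by fastforce

lemma sorted_list_of_set_split:
  fixes A B :: "'a::linorder set"
  assumes "finite A" "finite B" "\<And>a b. a \<in> A \<Longrightarrow> b \<in> B \<Longrightarrow> a < b"
  shows "sorted_list_of_set (A \<union> B) = sorted_list_of_set A @ sorted_list_of_set B"
proof (rule sorted_distinct_set_unique)
  show "sorted (sorted_list_of_set A @ sorted_list_of_set B)"
    using assms by (auto simp: sorted_append intro: less_imp_le)
  show "distinct (sorted_list_of_set A @ sorted_list_of_set B)"
    using assms by auto
qed (use assms in auto)

text \<open>Completeness of the reals in filter form. The trivial filter, along which everything
  converges, is split off because completeness speaks of proper filters.\<close>

lemma tendsto_exists_if_cauchy:
  fixes y :: "'a \<Rightarrow> real"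
  assumes "\<And>e. 0 < e \<Longrightarrow> \<exists>P. eventually P F \<and> (\<forall>a b. P a \<and> P b \<longrightarrow> \<bar>y a - y b\<bar> < e)"
  shows "\<exists>l. (y \<longlongrightarrow> l) F"
proof (cases "F = bot")
  case False
  have "cauchy_filter (filtermap y F)"
    using assms by (auto simp: cauchy_filter_metric_filtermap dist_real_def)
  then have "\<exists>c. filtermap y F \<le> nhds c"
    by (rule cauchy_filter_complete_converges[OF _ complete_UNIV])
       (auto simp: False filtermap_bot_iff)
  then show ?thesis by (auto simp: filterlim_def)
qed auto

text \<open>Scanning \<open>A1\<close> only shifts the reference point, and scanning
  \<open>A3\<close> can only add to the count. Hence \<open>r'\<close> is the anchor left by
  \<open>A1\<close>.\<close>

lemma moves_sub_interval:
  fixes y :: "real \<Rightarrow> real"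
  assumes "finite A" "A = A1 \<union> A2 \<union> A3"
    and "\<And>a b. a \<in> A1 \<Longrightarrow> b \<in> A2 \<Longrightarrow> a < b" "\<And>a b. a \<in> A1 \<Longrightarrow> b \<in> A3 \<Longrightarrow> a < b"
      "\<And>a b. a \<in> A2 \<Longrightarrow> b \<in> A3 \<Longrightarrow> a < b"
  shows "\<exists>r'. moves e r' (map y (sorted_list_of_set A2)) \<le> moves e r (map y (sorted_list_of_set A))"
proof -
  have fin: "finite A1" "finite A2" "finite A3" using assms(1,2) by auto
  have "sorted_list_of_set A = sorted_list_of_set (A1 \<union> A2) @ sorted_list_of_set A3"
    unfolding assms(2) by (rule sorted_list_of_set_split) (use fin assms in auto)
  also have "sorted_list_of_set (A1 \<union> A2) = sorted_list_of_set A1 @ sorted_list_of_set A2"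
    by (rule sorted_list_of_set_split) (use fin assms in auto)
  finally show ?thesis
    by (intro exI[of _ "anchor e r (map y (sorted_list_of_set A1))"]) (simp add: moves_append)
qed

text \<open>The form of \<open>bnd\<close> is what a bound in expectation delivers: Fatou's lemma
  controls the counts along infinitely many \<open>n\<close> only, and one threshold
  \<open>d\<close> below every \<open>e\<close> can be found in a countable family, which keeps a
  single null set.\<close>

locale bounded_moves =
  fixes y :: "real \<Rightarrow> real" and Fn :: "nat \<Rightarrow> real set"
  assumes fin: "\<And>n. finite (Fn n)" and inc: "incseq Fn"
    and bnd: "\<And>e. 0 < e \<Longrightarrow> \<exists>d\<in>{0<..e}. \<exists>K. \<exists>\<^sub>\<infinity>n. moves d 0 (map y (sorted_list_of_set (Fn n))) \<le> K"
begin

text \<open>A finite witness \<open>S\<close> lies in some \<open>Fn m\<close>, and among the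
  infinitely many good indices there is one beyond \<open>m\<close>. The witness must work for every
  \<open>r\<close>, because the points of \<open>Fn n\<close> to the left of the interval leave an
  unknown anchor.\<close>

lemma not_unbounded:
  assumes K: "\<exists>\<^sub>\<infinity>n. moves e 0 (map y (sorted_list_of_set (Fn n))) \<le> K"
    and "\<And>n. \<exists>S. finite S \<and> S \<subseteq> (\<Union>k. Fn k) \<and>
       (\<forall>F. finite F \<and> S \<subseteq> F \<longrightarrow> (\<forall>r. n \<le> moves e r (map y (sorted_list_of_set (F \<inter> {a<..<b})))))"
  shows False
proof -
  obtain S where S: "finite S" "S \<subseteq> (\<Union>k. Fn k)"
    "\<And>F r. finite F \<Longrightarrow> S \<subseteq> F \<Longrightarrow> Suc K \<le> moves e r (map y (sorted_list_of_set (F \<inter> {a<..<b})))"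
    using assms(2)[of "Suc K"] by auto
  have "\<exists>m. S \<subseteq> Fn m"
    using S(1,2)
  proof (induction S)
    case (insert x S)
    then obtain m k where "S \<subseteq> Fn m" "x \<in> Fn k" by auto
    then have "insert x S \<subseteq> Fn (max m k)"
      using incseqD[OF inc, of m "max m k"] incseqD[OF inc, of k "max m k"] by auto
    then show ?case by blast
  qed simp
  then obtain m where m: "S \<subseteq> Fn m" by blast
  obtain n where n: "n \<ge> m" "moves e 0 (map y (sorted_list_of_set (Fn n))) \<le> K"
    using K by (auto simp: INFM_nat_le)
  have "S \<subseteq> Fn n" using m incseqD[OF inc n(1)] by auto
  obtain r' where "moves e r' (map y (sorted_list_of_set (Fn n \<inter> {a<..<b}))) \<le> moves e 0 (map y (sorted_list_of_set (Fn n)))"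
  proof (cases "a < b")
    case True
    then show ?thesis using moves_sub_interval[OF fin, of n "Fn n \<inter> {..a}" "Fn n \<inter> {a<..<b}" "Fn n \<inter> {b..}"] that
      by fastforce
  qed (use that in auto)
  with n S(3)[OF fin \<open>S \<subseteq> Fn n\<close>, of r'] show False by simp
qed

text \<open>If the Cauchy criterion fails at level \<open>e0\<close>, every neighbourhood contains
  two points whose values are \<open>e0\<close> apart. Shrinking the neighbourhood past each pair
  stacks up arbitrarily many pairs, each forcing a displacement. The parameters let one argument
  serve both sides: \<open>J\<close> is the outer piece holding the pair, and what remains is again
  a neighbourhood.\<close>

lemma limit_exists:
  fixes lo hi :: "real \<Rightarrow> real"
  assumes ev: "\<And>d. 0 < d \<Longrightarrow> eventually (\<lambda>x. x \<in> (\<Union>n. Fn n) \<inter> {lo d<..<hi d}) Fi"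
    and split: "\<And>d a b. 0 < d \<Longrightarrow> a \<in> {lo d<..<hi d} \<Longrightarrow> b \<in> {lo d<..<hi d} \<Longrightarrow>
      \<exists>d' J. 0 < d' \<and> {lo d<..<hi d} = {lo d'<..<hi d'} \<union> J \<and> a \<in> J \<and> b \<in> J \<and>
        ((\<forall>x\<in>{lo d'<..<hi d'}. \<forall>y\<in>J. x < y) \<or> (\<forall>x\<in>{lo d'<..<hi d'}. \<forall>y\<in>J. y < x))"
  shows "\<exists>l. (y \<longlongrightarrow> l) Fi"
proof (rule ccontr)
  let ?Q = "\<Union>n. Fn n"
  assume "\<not> ?thesis"
  then obtain e0 where e0: "e0 > 0" "\<And>P. eventually P Fi \<Longrightarrow> \<exists>a b. P a \<and> P b \<and> e0 \<le> \<bar>y a - y b\<bar>"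
    using tendsto_exists_if_cauchy[of Fi y] by (metis not_less)
  \<comment> \<open>Half of \<open>e0\<close>, because a pair forces a displacement once its values
    are \<open>2 * e\<close> apart.\<close>
  obtain e K where e: "e > 0" "e \<le> e0 / 2" "\<exists>\<^sub>\<infinity>n. moves e 0 (map y (sorted_list_of_set (Fn n))) \<le> K"
    using bnd[of "e0 / 2"] e0(1) by auto
  have *: "\<exists>S. finite S \<and> S \<subseteq> ?Q \<and> (\<forall>F. finite F \<and> S \<subseteq> F \<longrightarrow>
      (\<forall>r. n \<le> moves e r (map y (sorted_list_of_set (F \<inter> {lo d<..<hi d})))))" if "d > 0" for n d
    using that
  proof (induction n arbitrary: d)
    case 0
    show ?case by (rule exI[of _ "{}"]) auto
  next
    case (Suc n)
    obtain a b where ab: "a \<in> ?Q" "b \<in> ?Q" "a \<in> {lo d<..<hi d}" "b \<in> {lo d<..<hi d}" "e0 \<le> \<bar>y a - y b\<bar>"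
      using e0(2)[OF ev[OF Suc.prems]] by blast
    obtain d' J where J: "0 < d'" "{lo d<..<hi d} = {lo d'<..<hi d'} \<union> J" "a \<in> J" "b \<in> J"
        "(\<forall>x\<in>{lo d'<..<hi d'}. \<forall>y\<in>J. x < y) \<or> (\<forall>x\<in>{lo d'<..<hi d'}. \<forall>y\<in>J. y < x)"
      using split[OF Suc.prems ab(3,4)] by (elim exE conjE) (rule that)
    obtain S where S: "finite S" "S \<subseteq> ?Q"
      "\<forall>F. finite F \<and> S \<subseteq> F \<longrightarrow> (\<forall>r. n \<le> moves e r (map y (sorted_list_of_set (F \<inter> {lo d'<..<hi d'}))))"
      using Suc.IH[OF J(1)] by (elim exE conjE) (rule that)
    show ?case
    proof (intro exI[of _ "insert a (insert b S)"] conjI allI impI)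
      fix F r assume F: "finite F \<and> insert a (insert b S) \<subseteq> F"
      have IH: "n \<le> moves e r' (map y (sorted_list_of_set (F \<inter> {lo d'<..<hi d'})))" for r'
        using S(3)[rule_format, of F r'] F by simp
      have one: "1 \<le> moves e r' (map y (sorted_list_of_set (F \<inter> J)))" for r'
        by (rule moves_pos[of "y a" _ "y b"]) (use F ab J e in auto)
      have eq: "F \<inter> {lo d<..<hi d} = F \<inter> {lo d'<..<hi d'} \<union> F \<inter> J" using J(2) by auto
      from J(5) show "Suc n \<le> moves e r (map y (sorted_list_of_set (F \<inter> {lo d<..<hi d})))"
      proof
        assume "\<forall>x\<in>{lo d'<..<hi d'}. \<forall>y\<in>J. x < y"
        then have "sorted_list_of_set (F \<inter> {lo d<..<hi d}) = sorted_list_of_set (F \<inter> {lo d'<..<hi d'}) @ sorted_list_of_set (F \<inter> J)"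
          unfolding eq by (intro sorted_list_of_set_split) (use F in auto)
        then show ?thesis using add_mono[OF IH one] by (simp add: moves_append)
      next
        assume "\<forall>x\<in>{lo d'<..<hi d'}. \<forall>y\<in>J. y < x"
        then have "sorted_list_of_set (F \<inter> {lo d<..<hi d}) = sorted_list_of_set (F \<inter> J) @ sorted_list_of_set (F \<inter> {lo d'<..<hi d'})"
          unfolding eq by (subst Un_commute, intro sorted_list_of_set_split) (use F in auto)
        then show ?thesis using add_mono[OF one IH] by (simp add: moves_append)
      qed
    qed (use S ab in auto)
  qed
  show False by (rule not_unbounded[OF e(3)]) (use *[of 1] in auto)
qed

lemma right_limit: "\<exists>l. (y \<longlongrightarrow> l) (at t within (\<Union>n. Fn n) \<inter> {t<..})"
proof (rule limit_exists[where lo="\<lambda>d. t" and hi="\<lambda>d. t + d"])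
  fix d :: real assume "0 < d"
  then show "eventually (\<lambda>x. x \<in> (\<Union>n. Fn n) \<inter> {t<..<t + d}) (at t within (\<Union>n. Fn n) \<inter> {t<..})"
    unfolding eventually_at by (intro exI[of _ d]) (auto simp: dist_real_def)
next
  fix d a b assume "a \<in> {t<..<t + d}" "b \<in> {t<..<t + d}"
  then show "\<exists>d' J. 0 < d' \<and> {t<..<t + d} = {t<..<t + d'} \<union> J \<and> a \<in> J \<and> b \<in> J \<and>
        ((\<forall>x\<in>{t<..<t + d'}. \<forall>y\<in>J. x < y) \<or> (\<forall>x\<in>{t<..<t + d'}. \<forall>y\<in>J. y < x))"
    by (intro exI[of _ "min a b - t"] exI[of _ "{min a b..<t + d}"]) auto
qed

lemma left_limit: "\<exists>l. (y \<longlongrightarrow> l) (at t within (\<Union>n. Fn n) \<inter> {..<t})"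
proof (rule limit_exists[where lo="\<lambda>d. t - d" and hi="\<lambda>d. t"])
  fix d :: real assume "0 < d"
  then show "eventually (\<lambda>x. x \<in> (\<Union>n. Fn n) \<inter> {t - d<..<t}) (at t within (\<Union>n. Fn n) \<inter> {..<t})"
    unfolding eventually_at by (intro exI[of _ d]) (auto simp: dist_real_def)
next
  fix d a b assume "a \<in> {t - d<..<t}" "b \<in> {t - d<..<t}"
  then show "\<exists>d' J. 0 < d' \<and> {t - d<..<t} = {t - d'<..<t} \<union> J \<and> a \<in> J \<and> b \<in> J \<and>
        ((\<forall>x\<in>{t - d'<..<t}. \<forall>y\<in>J. x < y) \<or> (\<forall>x\<in>{t - d'<..<t}. \<forall>y\<in>J. y < x))"
    by (intro exI[of _ "t - max a b"] exI[of _ "{t - d<..max a b}"]) auto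
qed

end

text \<open>Every \<open>m t'\<close> is a limit of values of \<open>y\<close> at nearby points of
  \<open>Q\<close>, so a bound on \<open>y\<close> over \<open>Q\<close> inside an open interval is
  inherited by \<open>m\<close> there. Right continuity and left limits both follow from
  this.\<close>

lemma cadlag_on_right_limits:
  fixes y m :: "real \<Rightarrow> real"
  assumes right: "\<And>t. t \<in> {0..<T} \<Longrightarrow> (y \<longlongrightarrow> m t) (at t within Q \<inter> {t<..})"
    and left: "\<And>t. t \<in> {0<..T} \<Longrightarrow> \<exists>l. (y \<longlongrightarrow> l) (at t within Q \<inter> {..<t})"
    and dense: "\<And>t. t \<in> {0..<T} \<Longrightarrow> at t within Q \<inter> {t<..} \<noteq> bot"
  shows "cadlag_on 0 T m"
proof -
  \<comment> \<open>A strict bound becomes non-strict in the limit; the uses below start from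
    \<open>e/2\<close> for this reason.\<close>
  have near: "\<bar>m t' - l\<bar> \<le> e"
    if I: "open I" "t' \<in> I" and close: "\<And>q. q \<in> Q \<inter> I \<Longrightarrow> \<bar>y q - l\<bar> < e" and t': "t' \<in> {0..<T}" for I l e t'
  proof -
    have "eventually (\<lambda>q. q \<in> I) (at t' within Q \<inter> {t'<..})"
      using I by (meson eventually_at_topological)
    moreover have "eventually (\<lambda>q. q \<in> Q \<inter> {t'<..}) (at t' within Q \<inter> {t'<..})"
      by (auto simp: eventually_at_filter)
    ultimately have "eventually (\<lambda>q. \<bar>y q - l\<bar> \<le> e) (at t' within Q \<inter> {t'<..})"
      by eventually_elim (use close in \<open>fastforce intro: less_imp_le\<close>)
    moreover have "((\<lambda>q. \<bar>y q - l\<bar>) \<longlongrightarrow> \<bar>m t' - l\<bar>) (at t' within Q \<inter> {t'<..})"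
      by (intro tendsto_intros right t')
    ultimately show ?thesis
      using dense[OF t'] tendsto_upperbound by blast
  qed
  {
    fix t assume t: "t \<in> {0..<T}"
    have "(m \<longlongrightarrow> m t) (at_right t)"
    proof (rule tendstoI)
      fix e :: real assume "e > 0"
      then have "eventually (\<lambda>q. dist (y q) (m t) < e/2) (at t within Q \<inter> {t<..})"
        using tendstoD[OF right[OF t], of "e/2"] by simp
      then obtain d where d: "d > 0" "\<And>q. q \<in> Q \<Longrightarrow> q > t \<Longrightarrow> dist q t < d \<Longrightarrow> dist (y q) (m t) < e/2"
        unfolding eventually_at by (metis (no_types, lifting) IntI greaterThan_iff less_irrefl)
      have "\<bar>m t' - m t\<bar> \<le> e/2" if "t' \<in> {t<..<min T (t+d)}" for t'
        by (rule near[of "{t<..<t+d}"]) (use that d t in \<open>auto simp: dist_real_def\<close>)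
      moreover have "eventually (\<lambda>t'. t' \<in> {t<..<min T (t+d)}) (at_right t)"
        using d t by (intro eventually_at_right_real) auto
      ultimately show "eventually (\<lambda>t'. dist (m t') (m t) < e) (at_right t)"
        using \<open>e > 0\<close> by (auto elim!: eventually_mono simp: dist_real_def) (smt (verit) field_sum_of_halves)
    qed
  }
  moreover {
    fix t assume t: "t \<in> {0<..T}"
    obtain l where l: "(y \<longlongrightarrow> l) (at t within Q \<inter> {..<t})" using left[OF t] by blast
    have "\<exists>l. (m \<longlongrightarrow> l) (at_left t)"
    proof (intro exI[of _ l] tendstoI)
      fix e :: real assume "e > 0"
      then have "eventually (\<lambda>q. dist (y q) l < e/2) (at t within Q \<inter> {..<t})"
        using tendstoD[OF l, of "e/2"] by simp
      then obtain d where d: "d > 0" "\<And>q. q \<in> Q \<Longrightarrow> q < t \<Longrightarrow> dist q t < d \<Longrightarrow> dist (y q) l < e/2"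
        unfolding eventually_at by (metis (no_types, lifting) IntI lessThan_iff less_irrefl)
      have "\<bar>m t' - l\<bar> \<le> e/2" if "t' \<in> {max 0 (t-d)<..<t}" for t'
        by (rule near[of "{t-d<..<t}"]) (use that d t in \<open>auto simp: dist_real_def\<close>)
      moreover have "eventually (\<lambda>t'. t' \<in> {max 0 (t-d)<..<t}) (at_left t)"
        using d t by (intro eventually_at_left_real) auto
      ultimately show "eventually (\<lambda>t'. dist (m t') l < e) (at_left t)"
        using \<open>e > 0\<close> by (auto elim!: eventually_mono simp: dist_real_def) (smt (verit) field_sum_of_halves)
    qed
  }
  ultimately show ?thesis by (auto simp: cadlag_on_def)
qed

section \<open>Square integrable martingales\<close>

definition square_integrable :: "'a measure \<Rightarrow> ('a \<Rightarrow> real) \<Rightarrow> bool" where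
  "square_integrable M f \<longleftrightarrow> f \<in> borel_measurable M \<and> integrable M (\<lambda>x. (f x)\<^sup>2)"

lemma square_integrable_bound:
  assumes "square_integrable M f" "square_integrable M g" "h \<in> borel_measurable M"
    and "\<And>x. x \<in> space M \<Longrightarrow> \<bar>h x\<bar> \<le> \<bar>f x\<bar> + \<bar>g x\<bar>"
  shows "square_integrable M h"
proof -
  have "integrable M (\<lambda>x. (h x)\<^sup>2)"
  proof (rule Bochner_Integration.integrable_bound)
    show "integrable M (\<lambda>x. 2 * (f x)\<^sup>2 + 2 * (g x)\<^sup>2)"
      using assms(1,2) by (auto simp: square_integrable_def)
    show "AE x in M. norm ((h x)\<^sup>2) \<le> norm (2 * (f x)\<^sup>2 + 2 * (g x)\<^sup>2)"
    proof (rule AE_I2)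
      fix x assume "x \<in> space M"
      then have "\<bar>h x\<bar>\<^sup>2 \<le> (\<bar>f x\<bar> + \<bar>g x\<bar>)\<^sup>2"
        by (intro power_mono assms) auto
      also have "\<dots> \<le> 2 * \<bar>f x\<bar>\<^sup>2 + 2 * \<bar>g x\<bar>\<^sup>2"
        using sum_squares_bound[of "\<bar>f x\<bar>" "\<bar>g x\<bar>"] by (simp add: power2_sum)
      finally show "norm ((h x)\<^sup>2) \<le> norm (2 * (f x)\<^sup>2 + 2 * (g x)\<^sup>2)" by simp
    qed
  qed (use assms(3) in measurable)
  with assms(3) show ?thesis by (simp add: square_integrable_def)
qed

lemma square_integrable_add:
  "square_integrable M f \<Longrightarrow> square_integrable M g \<Longrightarrow> square_integrable M (\<lambda>x. f x + g x)"
  by (rule square_integrable_bound[of M f g]) (auto simp: square_integrable_def)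

lemma square_integrable_diff:
  "square_integrable M f \<Longrightarrow> square_integrable M g \<Longrightarrow> square_integrable M (\<lambda>x. f x - g x)"
  by (rule square_integrable_bound[of M f g]) (auto simp: square_integrable_def)

lemma square_integrable_mult_integrable:
  assumes "square_integrable M f" "square_integrable M g"
  shows "integrable M (\<lambda>x. f x * g x)"
proof (rule Bochner_Integration.integrable_bound)
  show "integrable M (\<lambda>x. (f x)\<^sup>2 + (g x)\<^sup>2)"
    using assms by (auto simp: square_integrable_def)
  have "\<bar>f x * g x\<bar> \<le> (f x)\<^sup>2 + (g x)\<^sup>2" for x
  proof -
    have "2 * (\<bar>f x\<bar> * \<bar>g x\<bar>) \<le> \<bar>f x\<bar>\<^sup>2 + \<bar>g x\<bar>\<^sup>2"
      using sum_squares_bound[of "\<bar>f x\<bar>" "\<bar>g x\<bar>"] by (simp add: algebra_simps)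
    moreover have "0 \<le> \<bar>f x\<bar> * \<bar>g x\<bar>" by simp
    ultimately show ?thesis unfolding abs_mult power2_abs by linarith
  qed
  then show "AE x in M. norm (f x * g x) \<le> norm ((f x)\<^sup>2 + (g x)\<^sup>2)" by simp
qed (use assms in \<open>auto simp: square_integrable_def\<close>)

lemma (in finite_measure) square_integrable_const: "square_integrable M (\<lambda>x. c)"
  by (simp add: square_integrable_def)

lemma (in finite_measure) square_integrable_integrable:
  "square_integrable M f \<Longrightarrow> integrable M f"
  using square_integrable_mult_integrable[OF _ square_integrable_const, of f 1] by simp

text \<open>General enough to be interpreted twice under each law: for the canonical filtration and
  for its completion.\<close>

locale filtered_prob_space = prob_space M for M :: "'a measure" +
  fixes F :: "real \<Rightarrow> 'a measure" and T :: real
  assumes T_pos: "0 < T"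
    and subalg: "t \<in> {0..T} \<Longrightarrow> subalgebra M (F t)"
    and filtration_mono: "0 \<le> r \<Longrightarrow> r \<le> t \<Longrightarrow> t \<le> T \<Longrightarrow> sets (F r) \<subseteq> sets (F t)"
begin

lemma measurable_F_M: "t \<in> {0..T} \<Longrightarrow> f \<in> measurable (F t) N \<Longrightarrow> f \<in> measurable M N"
  using measurable_from_subalg[OF subalg] .

lemma space_F: "t \<in> {0..T} \<Longrightarrow> space (F t) = space M"
  using subalg unfolding subalgebra_def by auto

lemma sets_F_M: "t \<in> {0..T} \<Longrightarrow> A \<in> sets (F t) \<Longrightarrow> A \<in> sets M"
  using subalg unfolding subalgebra_def by auto

lemma measurable_F_mono:
  "0 \<le> r \<Longrightarrow> r \<le> t \<Longrightarrow> t \<le> T \<Longrightarrow> f \<in> measurable (F r) N \<Longrightarrow> f \<in> measurable (F t) N"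
  using filtration_mono[of r t] space_F[of r] space_F[of t] unfolding measurable_def by auto

lemma fin_subalg: "t \<in> {0..T} \<Longrightarrow> finite_measure_subalgebra M (F t)"
  by unfold_locales (rule subalg)

text \<open>Testing against all sets of \<open>F t\<close> identifies \<open>X'\<close> as the
  conditional expectation of \<open>X\<close>, and an \<open>F t\<close>-measurable factor can be
  pulled out. Integrability is asked for the product with \<open>X\<close> and obtained for the
  product with \<open>X'\<close>.\<close>

lemma integral_mult_closed:
  fixes X X' Z :: "'a \<Rightarrow> real"
  assumes t: "t \<in> {0..T}" and X: "integrable M X" "integrable M X'" "X' \<in> borel_measurable (F t)"
    and closed: "\<And>A. A \<in> sets (F t) \<Longrightarrow> (\<integral>\<omega>\<in>A. X \<omega> \<partial>M) = (\<integral>\<omega>\<in>A. X' \<omega> \<partial>M)"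
    and Z: "Z \<in> borel_measurable (F t)" "integrable M (\<lambda>\<omega>. Z \<omega> * X \<omega>)"
  shows "integrable M (\<lambda>\<omega>. Z \<omega> * X' \<omega>)" "(\<integral>\<omega>. Z \<omega> * X \<omega> \<partial>M) = (\<integral>\<omega>. Z \<omega> * X' \<omega> \<partial>M)"
proof -
  interpret S: finite_measure_subalgebra M "F t" by (rule fin_subalg[OF t])
  have ae: "AE \<omega> in M. real_cond_exp M (F t) X \<omega> = X' \<omega>"
    by (rule S.real_cond_exp_charact[OF closed X])
  have [measurable]: "Z \<in> borel_measurable M" "X' \<in> borel_measurable M"
    using measurable_F_M[OF t] Z X by auto
  have [measurable]: "real_cond_exp M (F t) X \<in> borel_measurable M"
    using borel_measurable_cond_exp2 by blast
  have int: "integrable M (\<lambda>\<omega>. Z \<omega> * real_cond_exp M (F t) X \<omega>)"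
    "(\<integral>\<omega>. Z \<omega> * real_cond_exp M (F t) X \<omega> \<partial>M) = (\<integral>\<omega>. Z \<omega> * X \<omega> \<partial>M)"
    by (rule S.real_cond_exp_intg; use Z X in auto)+
  have ae': "AE \<omega> in M. Z \<omega> * real_cond_exp M (F t) X \<omega> = Z \<omega> * X' \<omega>"
    using ae by eventually_elim simp
  show "integrable M (\<lambda>\<omega>. Z \<omega> * X' \<omega>)"
    using int(1) by (rule integrable_cong_AE_imp) (use ae' in \<open>auto elim: eventually_mono\<close>)
  have "(\<integral>\<omega>. Z \<omega> * real_cond_exp M (F t) X \<omega> \<partial>M) = (\<integral>\<omega>. Z \<omega> * X' \<omega> \<partial>M)"
    by (rule integral_cong_AE) (use ae' in auto)
  with int(2) show "(\<integral>\<omega>. Z \<omega> * X \<omega> \<partial>M) = (\<integral>\<omega>. Z \<omega> * X' \<omega> \<partial>M)" by simp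
qed

end

section \<open>Displacement and maximal inequalities for martingales closed by their terminal
  value\<close>

fun maxabs :: "real \<Rightarrow> real list \<Rightarrow> real" where
  "maxabs m [] = m"
| "maxabs m (a # as) = maxabs (max m \<bar>a\<bar>) as"

lemma maxabs_ge: "m \<le> maxabs m xs" "a \<in> set xs \<Longrightarrow> \<bar>a\<bar> \<le> maxabs m xs"
proof (induction xs arbitrary: m)
  case (Cons b xs)
  { case 1 show ?case using Cons.IH(1)[of "max m \<bar>b\<bar>"] by simp }
  { case 2 then show ?case using Cons.IH(1)[of "max m \<bar>b\<bar>"] Cons.IH(2)[of "max m \<bar>b\<bar>"] by auto }
qed auto

lemma measurable_moves:
  assumes "r \<in> borel_measurable M" "\<And>t. t \<in> set ts \<Longrightarrow> Y t \<in> borel_measurable M"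
  shows "(\<lambda>\<omega>. moves e (r \<omega>) (map (\<lambda>t. Y t \<omega>) ts)) \<in> measurable M (count_space UNIV)"
  using assms
proof (induction ts arbitrary: r)
  case (Cons a ts)
  have [measurable]: "r \<in> borel_measurable M" "Y a \<in> borel_measurable M" using Cons.prems by auto
  have [measurable]: "(\<lambda>\<omega>. moves e (r \<omega>) (map (\<lambda>t. Y t \<omega>) ts)) \<in> measurable M (count_space UNIV)"
    "(\<lambda>\<omega>. moves e (Y a \<omega>) (map (\<lambda>t. Y t \<omega>) ts)) \<in> measurable M (count_space UNIV)"
    by (intro Cons.IH; use Cons.prems in auto)+
  show ?case by simp
qed auto

lemma moves_le_length: "moves e r xs \<le> length xs"
  by (induction xs arbitrary: r) (auto intro: le_SucI)

text \<open>Closedness is phrased through integrals over sets of \<open>F t\<close> instead of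
  \<open>real_cond_exp\<close>: this form adds up, survives changes on null sets, and is the one the
  Markov property supplies.\<close>

locale closed_L2_martingale = filtered_prob_space +
  fixes Y :: "real \<Rightarrow> 'a \<Rightarrow> real"
  assumes Y_meas: "t \<in> {0..T} \<Longrightarrow> Y t \<in> borel_measurable (F t)"
    and Y_sq: "t \<in> {0..T} \<Longrightarrow> integrable M (\<lambda>\<omega>. (Y t \<omega>)\<^sup>2)"
    and Y_closed: "t \<in> {0..T} \<Longrightarrow> A \<in> sets (F t) \<Longrightarrow> (\<integral>\<omega>\<in>A. Y T \<omega> \<partial>M) = (\<integral>\<omega>\<in>A. Y t \<omega> \<partial>M)"
begin

lemma Y_measM: "t \<in> {0..T} \<Longrightarrow> Y t \<in> borel_measurable M"
  using Y_meas measurable_F_M by blast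

lemma Y_L2: "t \<in> {0..T} \<Longrightarrow> square_integrable M (Y t)"
  using Y_measM Y_sq by (simp add: square_integrable_def)

lemma T_in: "T \<in> {0..T}" using T_pos by simp

lemma Y_mult:
  assumes "t \<in> {0..T}" "Z \<in> borel_measurable (F t)" "square_integrable M Z"
  shows "(\<integral>\<omega>. Z \<omega> * Y T \<omega> \<partial>M) = (\<integral>\<omega>. Z \<omega> * Y t \<omega> \<partial>M)"
  by (rule integral_mult_closed(2)[OF assms(1) _ _ Y_meas Y_closed])
     (use assms T_in square_integrable_integrable[OF Y_L2] square_integrable_mult_integrable[OF _ Y_L2] in auto)

text \<open>One step of the scan replaces \<open>r\<close> by \<open>r'\<close>. Conditioning at
  time \<open>a\<close> makes \<open>Y T - r'\<close> orthogonal to \<open>r' - r\<close>, so by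
  Pythagoras the mean square distance to \<open>Y T\<close> drops by the mean of
  \<open>(r' - r)\<^sup>2\<close>, which is at least \<open>e\<^sup>2\<close> on a displacement. The
  starting point is random and adapted so that the step can be iterated.\<close>

lemma moves_bound:
  assumes e: "e > 0"
  shows "sorted ts \<Longrightarrow> set ts \<subseteq> {t0..T} \<Longrightarrow> t0 \<in> {0..T} \<Longrightarrow> r \<in> borel_measurable (F t0) \<Longrightarrow>
    square_integrable M r \<Longrightarrow>
    (\<integral>\<omega>. e\<^sup>2 * real (moves e (r \<omega>) (map (\<lambda>t. Y t \<omega>) ts)) \<partial>M) \<le> (\<integral>\<omega>. (Y T \<omega> - r \<omega>)\<^sup>2 \<partial>M)"
proof (induction ts arbitrary: r t0)
  case (Cons a ts)
  have a: "a \<in> {0..T}" "t0 \<le> a" using Cons.prems by auto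
  define r' where "r' = (\<lambda>\<omega>. if e \<le> \<bar>Y a \<omega> - r \<omega>\<bar> then Y a \<omega> else r \<omega>)"
  have [measurable]: "r \<in> borel_measurable (F a)" "Y a \<in> borel_measurable (F a)"
    using a Cons.prems(3) by (auto intro: measurable_F_mono[OF _ _ _ Cons.prems(4)] Y_meas)
  have r'_m: "r' \<in> borel_measurable (F a)" unfolding r'_def by measurable
  have r'_L2: "square_integrable M r'"
    by (rule square_integrable_bound[of M "Y a" r])
       (use Y_L2 Cons.prems a measurable_F_M[OF _ r'_m] in \<open>auto simp: r'_def\<close>)
  have [measurable]: "r \<in> borel_measurable M" "r' \<in> borel_measurable M" "Y a \<in> borel_measurable M"
    using Cons.prems r'_L2 Y_measM a by (auto simp: square_integrable_def)
  have mm[measurable]: "(\<lambda>\<omega>. moves e (r' \<omega>) (map (\<lambda>t. Y t \<omega>) ts)) \<in> measurable M (count_space UNIV)"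
    by (rule measurable_moves) (use Cons.prems Y_measM in auto)
  have IH: "(\<integral>\<omega>. e\<^sup>2 * real (moves e (r' \<omega>) (map (\<lambda>t. Y t \<omega>) ts)) \<partial>M) \<le> (\<integral>\<omega>. (Y T \<omega> - r' \<omega>)\<^sup>2 \<partial>M)"
    by (rule Cons.IH[OF _ _ a(1) r'_m r'_L2]) (use Cons.prems in auto)
  have int1: "integrable M (\<lambda>\<omega>. e\<^sup>2 * real (moves e (r' \<omega>) (map (\<lambda>t. Y t \<omega>) ts)))"
    by (rule integrable_const_bound[where B="e\<^sup>2 * real (length ts)"])
       (use moves_le_length[of e _ "map _ ts"] in \<open>auto intro!: mult_left_mono\<close>)
  have L2: "square_integrable M (\<lambda>\<omega>. Y T \<omega> - r' \<omega>)" "square_integrable M (\<lambda>\<omega>. r' \<omega> - r \<omega>)"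
    "square_integrable M (\<lambda>\<omega>. Y T \<omega> - r \<omega>)"
    using r'_L2 Cons.prems Y_L2[OF T_in] by (auto intro: square_integrable_diff)
  have ints: "integrable M (\<lambda>\<omega>. (Y T \<omega> - r' \<omega>)\<^sup>2)" "integrable M (\<lambda>\<omega>. (r' \<omega> - r \<omega>)\<^sup>2)"
    "integrable M (\<lambda>\<omega>. (r' \<omega> - r \<omega>) * (Y T \<omega> - r' \<omega>))"
    "integrable M (\<lambda>\<omega>. (r' \<omega> - r \<omega>) * Y T \<omega>)" "integrable M (\<lambda>\<omega>. (r' \<omega> - r \<omega>) * Y a \<omega>)"
    "integrable M (\<lambda>\<omega>. (r' \<omega> - r \<omega>) * r' \<omega>)"
    using L2 r'_L2 Y_L2 T_in a by (auto intro!: square_integrable_mult_integrable simp: square_integrable_def)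
  have "(\<integral>\<omega>. (r' \<omega> - r \<omega>) * (Y T \<omega> - r' \<omega>) \<partial>M)
      = (\<integral>\<omega>. (r' \<omega> - r \<omega>) * Y T \<omega> \<partial>M) - (\<integral>\<omega>. (r' \<omega> - r \<omega>) * r' \<omega> \<partial>M)"
    unfolding right_diff_distrib[of _ "Y T _"] using ints by (intro Bochner_Integration.integral_diff)
  also have "(\<integral>\<omega>. (r' \<omega> - r \<omega>) * Y T \<omega> \<partial>M) = (\<integral>\<omega>. (r' \<omega> - r \<omega>) * Y a \<omega> \<partial>M)"
    by (rule Y_mult[OF a(1)]) (use r'_m L2 in auto)
  \<comment> \<open>Where \<open>r' - r\<close> does not vanish, \<open>r'\<close> is
    \<open>Y a\<close>.\<close>
  also have "\<dots> = (\<integral>\<omega>. (r' \<omega> - r \<omega>) * r' \<omega> \<partial>M)"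
    by (intro Bochner_Integration.integral_cong) (auto simp: r'_def)
  finally have cross: "(\<integral>\<omega>. (r' \<omega> - r \<omega>) * (Y T \<omega> - r' \<omega>) \<partial>M) = 0" by simp
  have "(\<integral>\<omega>. e\<^sup>2 * real (moves e (r \<omega>) (map (\<lambda>t. Y t \<omega>) (a # ts))) \<partial>M)
    \<le> (\<integral>\<omega>. e\<^sup>2 * real (moves e (r' \<omega>) (map (\<lambda>t. Y t \<omega>) ts)) + (r' \<omega> - r \<omega>)\<^sup>2 \<partial>M)"
  proof (rule integral_mono')
    fix \<omega>
    have "e\<^sup>2 \<le> (Y a \<omega> - r \<omega>)\<^sup>2" if "e \<le> \<bar>Y a \<omega> - r \<omega>\<bar>"
      using power_mono[OF that, of 2] e by simp
    then show "e\<^sup>2 * real (moves e (r \<omega>) (map (\<lambda>t. Y t \<omega>) (a # ts)))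
        \<le> e\<^sup>2 * real (moves e (r' \<omega>) (map (\<lambda>t. Y t \<omega>) ts)) + (r' \<omega> - r \<omega>)\<^sup>2"
      by (auto simp: r'_def algebra_simps)
  qed (use int1 ints in \<open>auto intro!: add_nonneg_nonneg\<close>)
  also have "\<dots> \<le> (\<integral>\<omega>. (Y T \<omega> - r' \<omega>)\<^sup>2 \<partial>M) + (\<integral>\<omega>. (r' \<omega> - r \<omega>)\<^sup>2 \<partial>M)"
    using int1 ints IH by simp
  also have "\<dots> = (\<integral>\<omega>. (Y T \<omega> - r' \<omega>)\<^sup>2 + (r' \<omega> - r \<omega>)\<^sup>2 + 2 * ((r' \<omega> - r \<omega>) * (Y T \<omega> - r' \<omega>)) \<partial>M)"
    using ints cross by simp
  also have "\<dots> = (\<integral>\<omega>. (Y T \<omega> - r \<omega>)\<^sup>2 \<partial>M)"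
    by (intro Bochner_Integration.integral_cong) (auto simp: power2_eq_square algebra_simps)
  finally show ?case .
qed auto

text \<open>
  The potential \<open>2 m\<^sup>2 - 4 m \<bar>y\<bar>\<close> of the running maximum \<open>m\<close> and the current value \<open>y\<close> decreases in
  mean along the list; started at \<open>m = \<bar>y\<bar>\<close> it is nonpositive.
\<close>

lemma doob_bound:
  shows "sorted ts \<Longrightarrow> set ts \<subseteq> {t0..T} \<Longrightarrow> t0 \<in> {0..T} \<Longrightarrow> m \<in> borel_measurable (F t0) \<Longrightarrow>
    square_integrable M m \<Longrightarrow> (\<And>\<omega>. 0 \<le> m \<omega>) \<Longrightarrow>
    square_integrable M (\<lambda>\<omega>. maxabs (m \<omega>) (map (\<lambda>t. Y t \<omega>) ts)) \<and>
    (\<integral>\<omega>. (maxabs (m \<omega>) (map (\<lambda>t. Y t \<omega>) ts))\<^sup>2 \<partial>M)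
      \<le> 4 * (\<integral>\<omega>. (Y T \<omega>)\<^sup>2 \<partial>M) + (\<integral>\<omega>. 2 * (m \<omega>)\<^sup>2 - 4 * (m \<omega> * \<bar>Y t0 \<omega>\<bar>) \<partial>M)"
proof (induction ts arbitrary: m t0)
  case Nil
  have Yt: "square_integrable M (Y t0)" "square_integrable M (\<lambda>\<omega>. \<bar>Y t0 \<omega>\<bar>)" "Y t0 \<in> borel_measurable (F t0)"
    using Y_L2[of t0] Y_meas Nil by (auto simp: square_integrable_def)
  have ints: "integrable M (\<lambda>\<omega>. (m \<omega>)\<^sup>2)" "integrable M (\<lambda>\<omega>. m \<omega> * \<bar>Y t0 \<omega>\<bar>)"
     "integrable M (\<lambda>\<omega>. (Y T \<omega>)\<^sup>2)" "integrable M (\<lambda>\<omega>. (Y t0 \<omega>)\<^sup>2)" "integrable M (\<lambda>\<omega>. Y t0 \<omega> * Y T \<omega>)"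
    using Nil Yt Y_sq Y_L2 T_in by (auto intro!: square_integrable_mult_integrable simp: square_integrable_def)
  have "0 \<le> (\<integral>\<omega>. (Y T \<omega> - Y t0 \<omega>)\<^sup>2 \<partial>M)" by simp
  also have "\<dots> = (\<integral>\<omega>. (Y T \<omega>)\<^sup>2 + (Y t0 \<omega>)\<^sup>2 - 2 * (Y t0 \<omega> * Y T \<omega>) \<partial>M)"
    by (intro Bochner_Integration.integral_cong) (auto simp: power2_eq_square algebra_simps)
  also have "\<dots> = (\<integral>\<omega>. (Y T \<omega>)\<^sup>2 \<partial>M) + (\<integral>\<omega>. (Y t0 \<omega>)\<^sup>2 \<partial>M) - 2 * (\<integral>\<omega>. Y t0 \<omega> * Y t0 \<omega> \<partial>M)"
    using ints Y_mult[of t0 "Y t0"] Nil Yt by simp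
  finally have mono: "(\<integral>\<omega>. (Y t0 \<omega>)\<^sup>2 \<partial>M) \<le> (\<integral>\<omega>. (Y T \<omega>)\<^sup>2 \<partial>M)"
    by (simp add: power2_eq_square)
  \<comment> \<open>Rearranged, this square reads \<open>m\<^sup>2 \<le> 4 * y\<^sup>2 + 2 *
    m\<^sup>2 - 4 * m * \<bar>y\<bar>\<close>: the source of the factor 4 and of the
    potential.\<close>
  have "0 \<le> (\<integral>\<omega>. (2 * \<bar>Y t0 \<omega>\<bar> - m \<omega>)\<^sup>2 \<partial>M)" by simp
  also have "\<dots> = (\<integral>\<omega>. 4 * (Y t0 \<omega>)\<^sup>2 + (m \<omega>)\<^sup>2 - 4 * (m \<omega> * \<bar>Y t0 \<omega>\<bar>) \<partial>M)"
    by (intro Bochner_Integration.integral_cong) (auto simp: power2_eq_square algebra_simps)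
  also have "\<dots> = 4 * (\<integral>\<omega>. (Y t0 \<omega>)\<^sup>2 \<partial>M) + (\<integral>\<omega>. (m \<omega>)\<^sup>2 \<partial>M) - 4 * (\<integral>\<omega>. m \<omega> * \<bar>Y t0 \<omega>\<bar> \<partial>M)"
    using ints by simp
  finally show ?case using mono ints Nil by simp
next
  case (Cons a ts)
  have a: "a \<in> {0..T}" "t0 \<le> a" using Cons.prems by auto
  define m' where "m' = (\<lambda>\<omega>. max (m \<omega>) \<bar>Y a \<omega>\<bar>)"
  have mFa[measurable]: "m \<in> borel_measurable (F a)" "Y a \<in> borel_measurable (F a)"
    using a Cons.prems(3) by (auto intro: measurable_F_mono[OF _ _ _ Cons.prems(4)] Y_meas)
  have m'_m: "m' \<in> borel_measurable (F a)" unfolding m'_def by measurable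
  have m'_L2: "square_integrable M m'"
    by (rule square_integrable_bound[of M "Y a" m])
       (use Y_L2 Cons.prems a measurable_F_M[OF _ m'_m] in \<open>auto simp: m'_def\<close>)
  have IH: "square_integrable M (\<lambda>\<omega>. maxabs (m' \<omega>) (map (\<lambda>t. Y t \<omega>) ts)) \<and>
    (\<integral>\<omega>. (maxabs (m' \<omega>) (map (\<lambda>t. Y t \<omega>) ts))\<^sup>2 \<partial>M)
      \<le> 4 * (\<integral>\<omega>. (Y T \<omega>)\<^sup>2 \<partial>M) + (\<integral>\<omega>. 2 * (m' \<omega>)\<^sup>2 - 4 * (m' \<omega> * \<bar>Y a \<omega>\<bar>) \<partial>M)"
    by (rule Cons.IH[OF _ _ a(1) m'_m m'_L2]) (use Cons.prems in \<open>auto simp: m'_def le_max_iff_disj\<close>)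
  have Yabs: "square_integrable M (\<lambda>\<omega>. \<bar>Y t \<omega>\<bar>)" if "t \<in> {0..T}" for t
    using Y_L2[OF that] by (auto simp: square_integrable_def)
  have t0m[measurable]: "m \<in> borel_measurable (F t0)" "Y t0 \<in> borel_measurable (F t0)"
    using Cons.prems(4) Y_meas[OF Cons.prems(3)] by auto
  have sgm: "(\<lambda>\<omega>. m \<omega> * sgn (Y t0 \<omega>)) \<in> borel_measurable (F t0)" by measurable
  have sg: "square_integrable M (\<lambda>\<omega>. m \<omega> * sgn (Y t0 \<omega>))"
    by (rule square_integrable_bound[of M m m])
       (use Cons.prems measurable_F_M[OF _ sgm] in \<open>auto simp: abs_mult sgn_real_def\<close>)
  have ints: "integrable M (\<lambda>\<omega>. (m \<omega>)\<^sup>2)" "integrable M (\<lambda>\<omega>. (m' \<omega>)\<^sup>2)" "integrable M (\<lambda>\<omega>. m \<omega> * \<bar>Y t0 \<omega>\<bar>)"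
     "integrable M (\<lambda>\<omega>. m \<omega> * \<bar>Y a \<omega>\<bar>)" "integrable M (\<lambda>\<omega>. m' \<omega> * \<bar>Y a \<omega>\<bar>)"
     "integrable M (\<lambda>\<omega>. (m \<omega> * sgn (Y t0 \<omega>)) * Y a \<omega>)"
    using Cons.prems m'_L2 Y_L2[of a] Yabs a sg by (auto intro!: square_integrable_mult_integrable simp: square_integrable_def)
  \<comment> \<open>The factor \<open>m * sgn (Y t0)\<close> is known at \<open>t0\<close>, so
    \<open>Y t0\<close> may be exchanged for \<open>Y a\<close>: the submartingale property of
    \<open>\<bar>Y\<bar>\<close> with weight \<open>m\<close>.\<close>
  have "(\<integral>\<omega>. m \<omega> * \<bar>Y t0 \<omega>\<bar> \<partial>M) = (\<integral>\<omega>. (m \<omega> * sgn (Y t0 \<omega>)) * Y t0 \<omega> \<partial>M)"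
    by (intro Bochner_Integration.integral_cong) (auto simp: sgn_real_def)
  also have "\<dots> = (\<integral>\<omega>. (m \<omega> * sgn (Y t0 \<omega>)) * Y a \<omega> \<partial>M)"
    using Y_mult[of t0, OF _ sgm sg] Y_mult[of a, OF _ measurable_F_mono[OF _ _ _ sgm] sg] Cons.prems a by auto
  also have "\<dots> \<le> (\<integral>\<omega>. m \<omega> * \<bar>Y a \<omega>\<bar> \<partial>M)"
  proof (rule integral_mono)
    fix \<omega>
    have "m \<omega> * (sgn (Y t0 \<omega>) * Y a \<omega>) \<le> m \<omega> * \<bar>Y a \<omega>\<bar>"
      by (rule mult_left_mono) (auto simp: sgn_real_def Cons.prems(6))
    then show "m \<omega> * sgn (Y t0 \<omega>) * Y a \<omega> \<le> m \<omega> * \<bar>Y a \<omega>\<bar>" by (simp add: mult.assoc)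
  qed (use ints in auto)
  finally have sub: "(\<integral>\<omega>. m \<omega> * \<bar>Y t0 \<omega>\<bar> \<partial>M) \<le> (\<integral>\<omega>. m \<omega> * \<bar>Y a \<omega>\<bar> \<partial>M)" .
  \<comment> \<open>At a new maximum the potential changes by exactly
    \<open>- 2 * (m - \<bar>Y a\<bar>)\<^sup>2\<close>; otherwise it keeps its value.\<close>
  have "(\<integral>\<omega>. 2 * (m' \<omega>)\<^sup>2 - 4 * (m' \<omega> * \<bar>Y a \<omega>\<bar>) \<partial>M) \<le> (\<integral>\<omega>. 2 * (m \<omega>)\<^sup>2 - 4 * (m \<omega> * \<bar>Y a \<omega>\<bar>) \<partial>M)"
  proof (rule integral_mono)
    fix \<omega>
    have "0 \<le> 2 * (m \<omega> - \<bar>Y a \<omega>\<bar>)\<^sup>2" by simp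
    also have "\<dots> = 2 * (m \<omega>)\<^sup>2 - 4 * (m \<omega> * \<bar>Y a \<omega>\<bar>) + 2 * \<bar>Y a \<omega>\<bar>\<^sup>2"
      by (simp add: power2_diff algebra_simps)
    finally show "2 * (m' \<omega>)\<^sup>2 - 4 * (m' \<omega> * \<bar>Y a \<omega>\<bar>) \<le> 2 * (m \<omega>)\<^sup>2 - 4 * (m \<omega> * \<bar>Y a \<omega>\<bar>)"
      by (cases "m \<omega> \<le> \<bar>Y a \<omega>\<bar>") (simp_all add: m'_def max_def power2_eq_square del: power2_abs abs_mult_self_eq)
  qed (use ints in auto)
  also have "\<dots> \<le> (\<integral>\<omega>. 2 * (m \<omega>)\<^sup>2 - 4 * (m \<omega> * \<bar>Y t0 \<omega>\<bar>) \<partial>M)"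
    using ints sub by simp
  finally show ?case using IH by (simp add: m'_def)
qed

end

section \<open>Cadlag modifications\<close>

lemma integral_enn2real:
  assumes "k \<in> borel_measurable M" "(\<integral>\<^sup>+x. k x \<partial>M) < \<infinity>"
  shows "integrable M (\<lambda>x. enn2real (k x))" "(\<integral>x. enn2real (k x) \<partial>M) = enn2real (\<integral>\<^sup>+x. k x \<partial>M)"
proof -
  note [measurable] = assms(1)
  have "AE x in M. k x \<noteq> \<infinity>" by (rule nn_integral_PInf_AE) (use assms in auto)
  then have eq: "(\<integral>\<^sup>+x. ennreal (enn2real (k x)) \<partial>M) = (\<integral>\<^sup>+x. k x \<partial>M)"
    by (intro nn_integral_cong_AE) (auto elim!: eventually_mono simp: less_top)
  show "integrable M (\<lambda>x. enn2real (k x))"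
    by (rule integrableI_nonneg) (use eq assms in auto)
  show "(\<integral>x. enn2real (k x) \<partial>M) = enn2real (\<integral>\<^sup>+x. k x \<partial>M)"
    by (subst integral_eq_nn_integral) (use eq in auto)
qed

text \<open>Dominated convergence along a sequence of times needs one integrable majorant for all of
  them; \<open>\<bar>x\<bar> \<le> 1 + x\<^sup>2\<close> makes one out of an integrable supremum of
  squares.\<close>

lemma (in finite_measure) dominated_by_square_sup:
  fixes X :: "'b \<Rightarrow> 'a \<Rightarrow> real"
  assumes Q: "countable Q" and X: "\<And>q. q \<in> Q \<Longrightarrow> X q \<in> borel_measurable M"
    and fin: "(\<integral>\<^sup>+\<omega>. (SUP q\<in>Q. ennreal ((X q \<omega>)\<^sup>2)) \<partial>M) < \<infinity>"
  shows "\<exists>S. integrable M S \<and> (AE \<omega> in M. \<forall>q\<in>Q. \<bar>X q \<omega>\<bar> \<le> S \<omega>)"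
proof -
  let ?S = "\<lambda>\<omega>. SUP q\<in>Q. ennreal ((X q \<omega>)\<^sup>2)"
  have Sm: "?S \<in> borel_measurable M"
    by (intro borel_measurable_SUP[OF Q] measurable_compose[OF _ measurable_ennreal] borel_measurable_power X)
  have ae: "AE \<omega> in M. ?S \<omega> \<noteq> \<infinity>" by (rule nn_integral_PInf_AE[OF Sm]) (use fin in auto)
  show ?thesis
  proof (intro exI[of _ "\<lambda>\<omega>. 1 + enn2real (?S \<omega>)"] conjI)
    show "integrable M (\<lambda>\<omega>. 1 + enn2real (?S \<omega>))"
      using integral_enn2real(1)[OF Sm fin] by simp
    show "AE \<omega> in M. \<forall>q\<in>Q. \<bar>X q \<omega>\<bar> \<le> 1 + enn2real (?S \<omega>)"
      using ae
    proof eventually_elim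
      case (elim \<omega>)
      show ?case
      proof
        fix q assume "q \<in> Q"
        then have "ennreal ((X q \<omega>)\<^sup>2) \<le> ?S \<omega>" by (rule SUP_upper)
        then have "(X q \<omega>)\<^sup>2 \<le> enn2real (?S \<omega>)"
          using elim by (metis enn2real_ennreal enn2real_mono infinity_ennreal_def less_top zero_le_power2)
        moreover have "0 \<le> (\<bar>X q \<omega>\<bar> - 1)\<^sup>2" by simp
        then have "2 * \<bar>X q \<omega>\<bar> \<le> 1 + (X q \<omega>)\<^sup>2" by (simp add: power2_diff)
        ultimately show "\<bar>X q \<omega>\<bar> \<le> 1 + enn2real (?S \<omega>)" by linarith
      qed
    qed
  qed
qed

context closed_L2_martingale
begin

text \<open>The expected counts are bounded uniformly in \<open>n\<close>. Inserting points can
  lower a greedy count, so there is no monotone convergence; Fatou's lemma gives a finite lower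
  limit, that is, a bound along infinitely many \<open>n\<close>.\<close>

lemma moves_liminf:
  fixes Fn :: "nat \<Rightarrow> real set"
  assumes e: "e > 0" and Fn: "\<And>n. finite (Fn n)" "\<And>n. Fn n \<subseteq> {0..T}"
  shows "AE \<omega> in M. \<exists>K. \<exists>\<^sub>\<infinity>n. moves e 0 (map (\<lambda>t. Y t \<omega>) (sorted_list_of_set (Fn n))) \<le> K"
proof -
  define N where "N n \<omega> = moves e 0 (map (\<lambda>t. Y t \<omega>) (sorted_list_of_set (Fn n)))" for n :: nat and \<omega>
  have [measurable]: "N n \<in> measurable M (count_space UNIV)" for n
    unfolding N_def by (rule measurable_moves[of "\<lambda>_. 0"]) (use Fn[of n] Y_measM in auto)
  have Nm: "(\<lambda>\<omega>. e\<^sup>2 * real (N n \<omega>)) \<in> borel_measurable M" for n by measurable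
  have intN: "integrable M (\<lambda>\<omega>. e\<^sup>2 * real (N n \<omega>))" for n
    by (rule integrable_const_bound[where B="e\<^sup>2 * real (card (Fn n))"])
       (use moves_le_length[of e 0 "map _ (sorted_list_of_set (Fn n))"] in
          \<open>auto simp: N_def intro!: mult_left_mono Nm[unfolded N_def]\<close>)
  have le: "(\<integral>\<^sup>+\<omega>. ennreal (e\<^sup>2 * real (N n \<omega>)) \<partial>M) \<le> ennreal (\<integral>\<omega>. (Y T \<omega>)\<^sup>2 \<partial>M)" for n
  proof -
    have "(\<integral>\<^sup>+\<omega>. ennreal (e\<^sup>2 * real (N n \<omega>)) \<partial>M) = ennreal (\<integral>\<omega>. e\<^sup>2 * real (N n \<omega>) \<partial>M)"
      by (rule nn_integral_eq_integral) (use intN in auto)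
    also have "(\<integral>\<omega>. e\<^sup>2 * real (N n \<omega>) \<partial>M) \<le> (\<integral>\<omega>. (Y T \<omega> - 0)\<^sup>2 \<partial>M)"
      unfolding N_def by (rule moves_bound[OF e, of _ 0 "\<lambda>_. 0"]) (use Fn[of n] T_pos square_integrable_const in auto)
    finally show ?thesis by (simp add: ennreal_leI)
  qed
  have "(\<integral>\<^sup>+\<omega>. liminf (\<lambda>n. ennreal (e\<^sup>2 * real (N n \<omega>))) \<partial>M) \<le> liminf (\<lambda>n. \<integral>\<^sup>+\<omega>. ennreal (e\<^sup>2 * real (N n \<omega>)) \<partial>M)"
    by (rule nn_integral_liminf) measurable
  also have "\<dots> \<le> liminf (\<lambda>n. ennreal (\<integral>\<omega>. (Y T \<omega>)\<^sup>2 \<partial>M))"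
    by (rule Liminf_mono) (use le in auto)
  also have "\<dots> < \<infinity>" by (simp add: Liminf_const)
  finally have "AE \<omega> in M. liminf (\<lambda>n. ennreal (e\<^sup>2 * real (N n \<omega>))) \<noteq> \<infinity>"
    by (intro nn_integral_PInf_AE) auto
  then show ?thesis
  proof eventually_elim
    case (elim \<omega>)
    show ?case
    proof (rule ccontr)
      assume "\<not> ?thesis"
      then have *: "\<forall>\<^sub>F n in sequentially. K < N n \<omega>" for K
        unfolding N_def by (auto simp: not_INFM not_le cofinite_eq_sequentially frequently_def)
      have "liminf (\<lambda>n. ennreal (e\<^sup>2 * real (N n \<omega>))) \<ge> of_nat K" for K
      proof -
        obtain k :: nat where k: "real K / e\<^sup>2 \<le> real k" using real_arch_simple by blast
        have "\<forall>\<^sub>F n in sequentially. ennreal (real K) \<le> ennreal (e\<^sup>2 * real (N n \<omega>))"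
          using *[of k]
        proof eventually_elim
          case (elim n)
          then have "real K / e\<^sup>2 \<le> real (N n \<omega>)" using k by linarith
          then show ?case using e by (intro ennreal_leI) (simp add: field_simps)
        qed
        then show ?thesis by (intro Liminf_bounded) (simp add: ennreal_of_nat_eq_real_of_nat)
      qed
      then show False using elim
        by (metis ennreal_Ex_less_of_nat infinity_ennreal_def not_less top.not_eq_extremum)
    qed
  qed
qed

lemma doob_countable:
  fixes Fn :: "nat \<Rightarrow> real set"
  assumes Fn: "\<And>n. finite (Fn n)" "\<And>n. Fn n \<subseteq> {0..T}" "incseq Fn"
  shows "(\<integral>\<^sup>+\<omega>. (SUP q\<in>(\<Union>n. Fn n). ennreal ((Y q \<omega>)\<^sup>2)) \<partial>M) \<le> ennreal (4 * (\<integral>\<omega>. (Y T \<omega>)\<^sup>2 \<partial>M))"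
proof -
  have bound: "(\<integral>\<^sup>+\<omega>. (SUP q\<in>Fn n. ennreal ((Y q \<omega>)\<^sup>2)) \<partial>M) \<le> ennreal (4 * (\<integral>\<omega>. (Y T \<omega>)\<^sup>2 \<partial>M))" for n
  proof -
    let ?X = "\<lambda>\<omega>. maxabs \<bar>Y 0 \<omega>\<bar> (map (\<lambda>t. Y t \<omega>) (sorted_list_of_set (Fn n)))"
    have 0: "(0::real) \<in> {0..T}" using T_pos by auto
    have D: "square_integrable M ?X \<and> (\<integral>\<omega>. (?X \<omega>)\<^sup>2 \<partial>M)
      \<le> 4 * (\<integral>\<omega>. (Y T \<omega>)\<^sup>2 \<partial>M) + (\<integral>\<omega>. 2 * \<bar>Y 0 \<omega>\<bar>\<^sup>2 - 4 * (\<bar>Y 0 \<omega>\<bar> * \<bar>Y 0 \<omega>\<bar>) \<partial>M)"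
      by (rule doob_bound[where ?t0.0=0])
         (use Fn(1,2)[of n] 0 Y_L2[OF 0] Y_meas[OF 0] in \<open>auto simp: square_integrable_def\<close>)
    have "(\<integral>\<omega>. 2 * \<bar>Y 0 \<omega>\<bar>\<^sup>2 - 4 * (\<bar>Y 0 \<omega>\<bar> * \<bar>Y 0 \<omega>\<bar>) \<partial>M) \<le> (\<integral>\<omega>. 0 \<partial>M)"
    proof (rule integral_mono)
      show "integrable M (\<lambda>\<omega>. 2 * \<bar>Y 0 \<omega>\<bar>\<^sup>2 - 4 * (\<bar>Y 0 \<omega>\<bar> * \<bar>Y 0 \<omega>\<bar>))"
        using Y_sq[OF 0] by (simp add: power2_eq_square)
    qed (auto simp: power2_eq_square)
    then have "(\<integral>\<omega>. (?X \<omega>)\<^sup>2 \<partial>M) \<le> 4 * (\<integral>\<omega>. (Y T \<omega>)\<^sup>2 \<partial>M)" using D by simp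
    then have "(\<integral>\<^sup>+\<omega>. ennreal ((?X \<omega>)\<^sup>2) \<partial>M) \<le> ennreal (4 * (\<integral>\<omega>. (Y T \<omega>)\<^sup>2 \<partial>M))"
      using D by (subst nn_integral_eq_integral) (auto simp: square_integrable_def intro: ennreal_leI)
    moreover have "(\<integral>\<^sup>+\<omega>. (SUP q\<in>Fn n. ennreal ((Y q \<omega>)\<^sup>2)) \<partial>M) \<le> (\<integral>\<^sup>+\<omega>. ennreal ((?X \<omega>)\<^sup>2) \<partial>M)"
    proof (intro nn_integral_mono SUP_least ennreal_leI)
      fix \<omega> q assume "q \<in> Fn n"
      then have "\<bar>Y q \<omega>\<bar> \<le> ?X \<omega>" by (intro maxabs_ge(2)) (use Fn in auto)
      then show "(Y q \<omega>)\<^sup>2 \<le> (?X \<omega>)\<^sup>2" using power_mono[of "\<bar>Y q \<omega>\<bar>" _ 2] by simp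
    qed
    ultimately show ?thesis by (rule order_trans[rotated])
  qed
  have [measurable]: "Y q \<in> borel_measurable M" if "q \<in> Fn n" for q n
    by (rule Y_measM) (use that Fn(2)[of n] in auto)
  have "(\<integral>\<^sup>+\<omega>. (SUP q\<in>(\<Union>n. Fn n). ennreal ((Y q \<omega>)\<^sup>2)) \<partial>M) = (\<integral>\<^sup>+\<omega>. (SUP n. SUP q\<in>Fn n. ennreal ((Y q \<omega>)\<^sup>2)) \<partial>M)"
    by (simp add: SUP_UNION)
  also have "\<dots> = (SUP n. \<integral>\<^sup>+\<omega>. (SUP q\<in>Fn n. ennreal ((Y q \<omega>)\<^sup>2)) \<partial>M)"
  proof (rule nn_integral_monotone_convergence_SUP)
    show "incseq (\<lambda>n \<omega>. SUP q\<in>Fn n. ennreal ((Y q \<omega>)\<^sup>2))"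
      using Fn(3) by (auto simp: incseq_def le_fun_def intro!: SUP_subset_mono)
    show "(\<lambda>\<omega>. SUP q\<in>Fn n. ennreal ((Y q \<omega>)\<^sup>2)) \<in> borel_measurable M" for n
      by (rule borel_measurable_SUP) (use Fn countable_finite in \<open>auto intro!: measurable_compose[OF _ measurable_ennreal] borel_measurable_power\<close>)
  qed
  also have "\<dots> \<le> ennreal (4 * (\<integral>\<omega>. (Y T \<omega>)\<^sup>2 \<partial>M))" by (intro SUP_least bound)
  finally show ?thesis .
qed

text \<open>The candidate is the right limit along a countable dense set of times. It agrees almost
  surely with \<open>Y t\<close> for two reasons: as a limit of values at times decreasing to
  \<open>t\<close> it is, up to a null set, \<open>F t\<close>-measurable by right continuity of the
  filtration, and by dominated convergence it has the same integrals as \<open>Y t\<close> over the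
  sets of \<open>F t\<close>. The null set depends on \<open>t\<close>.\<close>

lemma cadlag_modification:
  assumes rc: "\<And>t X. t \<in> {0..<T} \<Longrightarrow> (\<And>s. s \<in> {t<..T} \<Longrightarrow> X \<in> borel_measurable (F s)) \<Longrightarrow>
     (X :: 'a \<Rightarrow> real) \<in> borel_measurable (F t)"
  shows "\<exists>N. (AE \<omega> in M. cadlag_on 0 T (\<lambda>t. N t \<omega>)) \<and> (\<forall>t\<in>{0..T}. AE \<omega> in M. N t \<omega> = Y t \<omega>) \<and>
    (\<integral>\<^sup>+\<omega>. (SUP t\<in>{0..T}. ennreal ((N t \<omega>)\<^sup>2)) \<partial>M) < \<infinity>"
proof -
  \<comment> \<open>\<open>T\<close> is added since it may be irrational: the terminal value is not
    a right limit and is taken over unchanged.\<close>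
  define Q where "Q = insert T (\<rat> \<inter> {0..T})"
  have Q: "countable Q" "Q \<noteq> {}" "Q \<subseteq> {0..T}" "T \<in> Q" using T_pos countable_rat by (auto simp: Q_def)
  define Fn where "Fn n = from_nat_into Q ` {..n}" for n
  have Fn: "finite (Fn n)" "Fn n \<subseteq> {0..T}" "incseq Fn" for n
    using from_nat_into[OF Q(2)] Q(3) by (auto simp: Fn_def incseq_def)
  have "(\<Union>n. Fn n) = range (from_nat_into Q)" unfolding Fn_def by auto
  then have UQ: "(\<Union>n. Fn n) = Q" using range_from_nat_into[OF Q(2,1)] by simp
  let ?S = "\<lambda>\<omega>. SUP q\<in>Q. ennreal ((Y q \<omega>)\<^sup>2)"
  have YQ[measurable]: "Y q \<in> borel_measurable M" if "q \<in> Q" for q using that Q(3) Y_measM by auto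
  have S_fin: "(\<integral>\<^sup>+\<omega>. ?S \<omega> \<partial>M) < \<infinity>"
    using doob_countable[OF Fn] unfolding UQ by (rule le_less_trans) simp
  have dense: "at t within Q \<inter> {t<..} \<noteq> bot" if t: "t \<in> {0..<T}" for t
    unfolding trivial_limit_within islimpt_approachable not_not
  proof (intro allI impI)
    fix e :: real assume "e > 0"
    then obtain q where q: "q \<in> \<rat>" "t < q" "q < min T (t + e)" using Rats_dense_in_real[of t "min T (t+e)"] t by auto
    then show "\<exists>x'\<in>Q \<inter> {t<..}. x' \<noteq> t \<and> dist x' t < e"
      using t by (intro bexI[of _ q]) (auto simp: Q_def dist_real_def)
  qed
  \<comment> \<open>Countably many thresholds, hence one null set that serves all times.\<close>
  have "AE \<omega> in M. \<forall>k. \<exists>K. \<exists>\<^sub>\<infinity>n. moves (1 / Suc k) 0 (map (\<lambda>t. Y t \<omega>) (sorted_list_of_set (Fn n))) \<le> K"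
    unfolding AE_all_countable by (intro allI moves_liminf Fn) auto
  then have good: "AE \<omega> in M. \<forall>t. (\<exists>l. ((\<lambda>t. Y t \<omega>) \<longlongrightarrow> l) (at t within Q \<inter> {t<..})) \<and>
      (\<exists>l. ((\<lambda>t. Y t \<omega>) \<longlongrightarrow> l) (at t within Q \<inter> {..<t}))"
  proof eventually_elim
    case (elim \<omega>)
    interpret bounded_moves "\<lambda>t. Y t \<omega>" Fn
    proof
      fix e :: real assume "e > 0"
      then obtain k where "inverse (real (Suc k)) < e" using reals_Archimedean by blast
      then show "\<exists>d\<in>{0<..e}. \<exists>K. \<exists>\<^sub>\<infinity>n. moves d 0 (map (\<lambda>t. Y t \<omega>) (sorted_list_of_set (Fn n))) \<le> K"
        using elim by (intro bexI[of _ "1 / Suc k"]) (auto simp: inverse_eq_divide)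
    qed (use Fn in auto)
    show ?case using right_limit left_limit unfolding UQ by blast
  qed
  define N where "N t \<omega> = (if t < T then Lim (at t within Q \<inter> {t<..}) (\<lambda>q. Y q \<omega>) else Y T \<omega>)" for t \<omega>
  have N_lim: "AE \<omega> in M. \<forall>t\<in>{0..<T}. ((\<lambda>q. Y q \<omega>) \<longlongrightarrow> N t \<omega>) (at t within Q \<inter> {t<..})"
    using good
  proof eventually_elim
    case (elim \<omega>)
    show ?case
    proof
      fix t assume t: "t \<in> {0..<T}"
      obtain l where l: "((\<lambda>t. Y t \<omega>) \<longlongrightarrow> l) (at t within Q \<inter> {t<..})" using elim by blast
      have "N t \<omega> = l" unfolding N_def using t tendsto_Lim[OF dense[OF t] l] by simp
      with l show "((\<lambda>q. Y q \<omega>) \<longlongrightarrow> N t \<omega>) (at t within Q \<inter> {t<..})" by simp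
    qed
  qed
  have cadlag: "AE \<omega> in M. cadlag_on 0 T (\<lambda>t. N t \<omega>)"
    using good N_lim by eventually_elim (rule cadlag_on_right_limits[of T "\<lambda>q. Y q _"], use dense in auto)
  obtain w where w_int: "integrable M w" and w_bd: "AE \<omega> in M. \<forall>q\<in>Q. \<bar>Y q \<omega>\<bar> \<le> w \<omega>"
    using dominated_by_square_sup[OF Q(1) YQ S_fin] by blast
  have N_eq: "AE \<omega> in M. N t \<omega> = Y t \<omega>" if t: "t \<in> {0..T}" for t
  proof (cases "t < T")
    case True
    then have t': "t \<in> {0..<T}" using t by auto
    have "t islimpt Q \<inter> {t<..}" using dense[OF t'] by (simp add: trivial_limit_within)
    then obtain q where q: "\<And>n. q n \<in> Q \<inter> {t<..}" "q \<longlonglongrightarrow> t"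
      unfolding islimpt_sequential by blast
    have qT: "q n \<in> {0..T}" for n using q(1)[of n] Q(3) by auto
    \<comment> \<open>Given by \<open>lim\<close> on the whole space, so that its measurability
      needs no exceptional set; it agrees with \<open>N t\<close> only almost surely.\<close>
    define Z where "Z \<omega> = lim (\<lambda>n. Y (q n) \<omega>)" for \<omega>
    have ZN: "AE \<omega> in M. (\<lambda>n. Y (q n) \<omega>) \<longlonglongrightarrow> N t \<omega> \<and> Z \<omega> = N t \<omega>"
      using N_lim
    proof eventually_elim
      case (elim \<omega>)
      have "LIM n sequentially. q n :> at t within Q \<inter> {t<..}"
        using q by (auto simp: filterlim_at intro!: always_eventually less_imp_neq[symmetric])
      from filterlim_compose[OF bspec[OF elim t'] this]
      show ?case by (auto simp: Z_def limI)
    qed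
    have Z_F: "Z \<in> borel_measurable (F t)"
    proof (rule rc[OF t'])
      fix s assume s: "s \<in> {t<..T}"
      have "\<forall>\<^sub>F n in sequentially. q n < s" using order_tendstoD(2)[OF q(2)] s by auto
      then obtain k where k: "\<And>n. n \<ge> k \<Longrightarrow> q n < s" by (auto simp: eventually_sequentially)
      \<comment> \<open>Dropping the first \<open>k\<close> terms leaves \<open>lim\<close>
        unchanged, also on paths where the sequence diverges, and only times before \<open>s\<close>
        remain.\<close>
      have "Z = (\<lambda>\<omega>. lim (\<lambda>n. Y (q (n + k)) \<omega>))"
      proof -
        have "(\<lambda>n. Y (q n) \<omega>) \<longlonglongrightarrow> l \<longleftrightarrow> (\<lambda>n. Y (q (n + k)) \<omega>) \<longlonglongrightarrow> l" for \<omega> l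
          using LIMSEQ_offset[of "\<lambda>n. Y (q n) \<omega>" k l] LIMSEQ_ignore_initial_segment[of "\<lambda>n. Y (q n) \<omega>" l k] by blast
        then show ?thesis by (simp add: Z_def[abs_def] lim_def)
      qed
      moreover have "Y (q (n + k)) \<in> borel_measurable (F s)" for n
        by (rule measurable_F_mono[OF _ _ _ Y_meas]) (use qT[of "n+k"] k[of "n+k"] s in auto)
      ultimately show "Z \<in> borel_measurable (F s)" by simp
    qed
    have Z_M[measurable]: "Z \<in> borel_measurable M" using measurable_F_M[OF t Z_F] .
    have YqM[measurable]: "Y (q n) \<in> borel_measurable M" for n using Y_measM[OF qT] .
    have lim1: "AE \<omega> in M. (\<lambda>n. Y (q n) \<omega>) \<longlonglongrightarrow> Z \<omega>" using ZN by eventually_elim simp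
    have Zint: "integrable M Z"
      by (rule integrable_dominated_convergence[of _ _ "\<lambda>n. Y (q n)" w])
         (use lim1 w_int w_bd q(1) in \<open>auto elim: eventually_mono\<close>)
    have Z_A: "(\<integral>\<omega>\<in>A. Y t \<omega> \<partial>M) = (\<integral>\<omega>\<in>A. Z \<omega> \<partial>M)" if A: "A \<in> sets (F t)" for A
    proof -
      have [measurable]: "A \<in> sets M" using sets_F_M[OF t A] .
      have "(\<lambda>n. \<integral>\<omega>\<in>A. Y (q n) \<omega> \<partial>M) \<longlonglongrightarrow> (\<integral>\<omega>\<in>A. Z \<omega> \<partial>M)"
        unfolding set_lebesgue_integral_def
      proof (rule integral_dominated_convergence[where w=w])
        show "AE \<omega> in M. (\<lambda>n. indicat_real A \<omega> *\<^sub>R Y (q n) \<omega>) \<longlonglongrightarrow> indicat_real A \<omega> *\<^sub>R Z \<omega>"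
          using lim1 by eventually_elim (intro tendsto_intros)
        show "AE \<omega> in M. norm (indicat_real A \<omega> *\<^sub>R Y (q n) \<omega>) \<le> w \<omega>" for n
          using w_bd by eventually_elim (use q(1)[of n] in \<open>auto simp: indicator_def intro: order_trans[OF abs_ge_zero]\<close>)
      qed (use w_int in auto)
      moreover have "(\<integral>\<omega>\<in>A. Y (q n) \<omega> \<partial>M) = (\<integral>\<omega>\<in>A. Y t \<omega> \<partial>M)" for n
      proof -
        have "A \<in> sets (F (q n))" using filtration_mono[of t "q n"] A q(1)[of n] qT[of n] t by auto
        then show ?thesis using Y_closed[OF qT] Y_closed[OF t A] by metis
      qed
      ultimately show ?thesis by (simp add: LIMSEQ_const_iff)
    qed
    interpret S: finite_measure_subalgebra M "F t" by (rule fin_subalg[OF t])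
    have Yint: "integrable M (Y t)" using square_integrable_integrable[OF Y_L2[OF t]] .
    have "AE \<omega> in M. real_cond_exp M (F t) (Y t) \<omega> = Z \<omega>"
      by (rule S.real_cond_exp_charact) (use Z_A Yint Zint Z_F in auto)
    moreover have "AE \<omega> in M. real_cond_exp M (F t) (Y t) \<omega> = Y t \<omega>"
      by (rule S.real_cond_exp_F_meas[OF Yint Y_meas[OF t]])
    ultimately show ?thesis using ZN by eventually_elim simp
  next
    case False
    then show ?thesis using t by (auto simp: N_def)
  qed
  \<comment> \<open>The supremum over uncountably many times is compared almost surely with the
    countable one, so its own measurability is never asked for.\<close>
  have "(\<integral>\<^sup>+\<omega>. (SUP t\<in>{0..T}. ennreal ((N t \<omega>)\<^sup>2)) \<partial>M) \<le> (\<integral>\<^sup>+\<omega>. ?S \<omega> \<partial>M)"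
  proof (rule nn_integral_mono_AE)
    show "AE \<omega> in M. (SUP t\<in>{0..T}. ennreal ((N t \<omega>)\<^sup>2)) \<le> ?S \<omega>"
      using N_lim
    proof eventually_elim
      case (elim \<omega>)
      show ?case
      proof (rule SUP_least)
        fix t assume t: "t \<in> {0..T}"
        show "ennreal ((N t \<omega>)\<^sup>2) \<le> ?S \<omega>"
        proof (cases "t < T")
          case True
          then have t': "t \<in> {0..<T}" using t by auto
          have "((\<lambda>q. ennreal ((Y q \<omega>)\<^sup>2)) \<longlongrightarrow> ennreal ((N t \<omega>)\<^sup>2)) (at t within Q \<inter> {t<..})"
            using elim t' by (intro tendsto_ennrealI tendsto_intros) auto
          moreover have "eventually (\<lambda>q. ennreal ((Y q \<omega>)\<^sup>2) \<le> ?S \<omega>) (at t within Q \<inter> {t<..})"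
            by (auto simp: eventually_at_filter intro!: always_eventually SUP_upper)
          ultimately show ?thesis using tendsto_upperbound dense[OF t'] by blast
        next
          case False
          then have "t = T" using t by auto
          then show ?thesis using Q(4) by (auto simp: N_def intro: SUP_upper)
        qed
      qed
    qed
  qed
  with S_fin have "(\<integral>\<^sup>+\<omega>. (SUP t\<in>{0..T}. ennreal ((N t \<omega>)\<^sup>2)) \<partial>M) < \<infinity>" by (rule order.strict_trans1[rotated])
  with cadlag N_eq show ?thesis by blast
qed

end

section \<open>Martingales of finite variation\<close>

lemma LBINT_singleton_eq_0: "(LBINT r:{s..s}. h r) = (0 :: real)" for s :: real
  unfolding set_lebesgue_integral_def
  by (rule integral_eq_zero_AE, rule AE_mp[OF AE_lborel_singleton[of s]]) auto

lemma indefinite_integral_increment: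
  fixes h :: "real \<Rightarrow> real"
  assumes h: "set_integrable lborel {s..T} h" and ab: "s \<le> a" "a \<le> b" "b \<le> T"
  shows "(LBINT r:{s..b}. h r) = (LBINT r:{s..a}. h r) + (LBINT r:{a<..b}. h r)"
proof -
  have "{s..b} = {s..a} \<union> {a<..b}" using ab by auto
  then show ?thesis
    by (simp only:, intro set_integral_Un) (use ab in \<open>auto intro!: set_integrable_subset[OF h]\<close>)
qed

lemma indefinite_integral_increment_le:
  fixes h :: "real \<Rightarrow> real"
  assumes h: "set_integrable lborel {s..T} h" and ab: "s \<le> a" "a \<le> b" "b \<le> T"
  shows "\<bar>(LBINT r:{s..b}. h r) - (LBINT r:{s..a}. h r)\<bar> \<le> (LBINT r:{s..b}. \<bar>h r\<bar>) - (LBINT r:{s..a}. \<bar>h r\<bar>)"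
proof -
  have h': "set_integrable lborel {s..T} (\<lambda>r. \<bar>h r\<bar>)" using h by (rule set_integrable_abs)
  have "set_integrable lborel {a<..b} h" by (rule set_integrable_subset[OF h]) (use ab in auto)
  then have "\<bar>LBINT r:{a<..b}. h r\<bar> \<le> (LBINT r:{a<..b}. \<bar>h r\<bar>)"
    using set_integral_norm_bound[of lborel "{a<..b}" h] by simp
  then show ?thesis
    using indefinite_integral_increment[OF h ab] indefinite_integral_increment[OF h' ab] by simp
qed

lemma indefinite_integral_continuous:
  fixes h :: "real \<Rightarrow> real"
  assumes h: "set_integrable lborel {s..T} h"
  shows "continuous_on {s..T} (\<lambda>t. LBINT r:{s..t}. h r)"
proof -
  have "continuous_on {s..T} (\<lambda>t. integral {s..t} h)"
    by (intro indefinite_integral_continuous_1 set_borel_integral_eq_integral(1) h)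
  moreover have "(LBINT r:{s..t}. h r) = integral {s..t} h" if "t \<in> {s..T}" for t
    by (rule set_borel_integral_eq_integral(2)) (rule set_integrable_subset[OF h], use that in auto)
  ultimately show ?thesis by (subst continuous_on_cong[OF refl]) auto
qed

section \<open>A smooth convex substitute for the absolute value\<close>

context
  fixes a b :: real
begin

text \<open>With \<open>s\<close> and \<open>q\<close> the roots at \<open>a\<close> and
  \<open>b\<close>, the first-order remainder is \<open>(s * q - (1 + a * b)) / s\<close>. Its sign
  is Cauchy-Schwarz for the vectors \<open>(1, a)\<close> and \<open>(1, b)\<close>; the quadratic
  bound comes from \<open>2 * s * q \<le> s\<^sup>2 + q\<^sup>2\<close>, the linear one from slopes
  bounded by 1.\<close>

lemma sqrt_convex_remainder_nonneg:
  "0 \<le> sqrt (1 + b\<^sup>2) - sqrt (1 + a\<^sup>2) - a / sqrt (1 + a\<^sup>2) * (b - a)"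
  and sqrt_convex_remainder_le_square:
  "sqrt (1 + b\<^sup>2) - sqrt (1 + a\<^sup>2) - a / sqrt (1 + a\<^sup>2) * (b - a) \<le> (b - a)\<^sup>2"
  and sqrt_convex_remainder_le_abs:
  "sqrt (1 + b\<^sup>2) - sqrt (1 + a\<^sup>2) - a / sqrt (1 + a\<^sup>2) * (b - a) \<le> 2 * \<bar>b - a\<bar>"
proof -
  define s where "s = sqrt (1 + a\<^sup>2)"
  define q where "q = sqrt (1 + b\<^sup>2)"
  have s1: "s \<ge> 1" by (simp add: s_def)
  moreover have "s\<^sup>2 = 1 + a\<^sup>2" by (simp add: s_def)
  ultimately have s: "s \<ge> 1" "s\<^sup>2 = 1 + a\<^sup>2" "s > 0" by linarith+
  have q: "q \<ge> 1" "q\<^sup>2 = 1 + b\<^sup>2" by (auto simp: q_def)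
  have "(1 + a * b)\<^sup>2 \<le> (1 + a\<^sup>2) * (1 + b\<^sup>2)"
    using zero_le_power2[of "a - b"] by (simp add: power2_eq_square algebra_simps)
  then have "(1 + a * b)\<^sup>2 \<le> (s * q)\<^sup>2" unfolding power_mult_distrib s(2) q(2) .
  moreover have "0 \<le> s * q" using s(1) q(1) by simp
  ultimately have 1: "1 + a * b \<le> s * q" by (rule power2_le_imp_le)
  have eq: "q - s - a / s * (b - a) = (s * q - (1 + a * b)) / s"
    using s(2,3) by (simp add: field_simps power2_eq_square)
  show "0 \<le> sqrt (1 + b\<^sup>2) - sqrt (1 + a\<^sup>2) - a / sqrt (1 + a\<^sup>2) * (b - a)"
    using 1 s(3) unfolding s_def[symmetric] q_def[symmetric] eq by simp
  have "0 \<le> (s - q)\<^sup>2" by simp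
  then have "2 * (s * q) \<le> s\<^sup>2 + q\<^sup>2" by (simp add: power2_diff)
  then have "2 * (s * q - (1 + a * b)) \<le> (b - a)\<^sup>2" unfolding s(2) q(2) by (simp add: power2_diff algebra_simps)
  moreover have "2 * z \<le> w \<Longrightarrow> 0 \<le> z \<Longrightarrow> z \<le> w" for z w :: real by linarith
  ultimately have "s * q - (1 + a * b) \<le> (b - a)\<^sup>2" using 1 by (metis diff_ge_0_iff_ge)
  also have "\<dots> \<le> (b - a)\<^sup>2 * s" using s(1) mult_left_mono[of 1 s "(b - a)\<^sup>2"] by simp
  finally show "sqrt (1 + b\<^sup>2) - sqrt (1 + a\<^sup>2) - a / sqrt (1 + a\<^sup>2) * (b - a) \<le> (b - a)\<^sup>2"
    using s(3) unfolding s_def[symmetric] q_def[symmetric] eq by (simp add: divide_le_eq)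
  have as: "\<bar>a\<bar> \<le> s" unfolding s_def by (rule real_le_rsqrt) simp
  have "q \<le> s + \<bar>b - a\<bar>"
  proof (rule power2_le_imp_le)
    have "a * (b - a) \<le> s * \<bar>b - a\<bar>"
      using mult_right_mono[OF as, of "\<bar>b - a\<bar>"] abs_le_D1[of "a * (b - a)"] by (simp add: abs_mult)
    then show "q\<^sup>2 \<le> (s + \<bar>b - a\<bar>)\<^sup>2" unfolding q(2) power2_sum s(2)
      by (simp add: power2_eq_square algebra_simps)
  qed (use s(1) in auto)
  moreover have "\<bar>a / s * (b - a)\<bar> \<le> 1 * \<bar>b - a\<bar>"
    unfolding abs_mult using as s(3) by (intro mult_right_mono) (auto simp: abs_divide divide_le_eq)
  moreover have "q \<le> s + w \<Longrightarrow> \<bar>z\<bar> \<le> 1 * w \<Longrightarrow> q - s - z \<le> 2 * w" for z w by linarith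
  ultimately show "sqrt (1 + b\<^sup>2) - sqrt (1 + a\<^sup>2) - a / sqrt (1 + a\<^sup>2) * (b - a) \<le> 2 * \<bar>b - a\<bar>"
    unfolding s_def[symmetric] q_def[symmetric] by blast
qed

end

text \<open>Trades an increment \<open>d\<close> of the discrete variation for a decrement of
  \<open>exp (- V)\<close>, so that a sum telescopes; the price is \<open>1 + c\<close>, where
  \<open>c\<close> bounds a single increment. The source is
  \<open>1 + d \<le> exp d\<close>.\<close>

lemma min_le_one_minus_exp:
  fixes d c :: real
  assumes "0 \<le> d" "d \<le> c"
  shows "d \<le> (1 + c) * (1 - exp (- d))"
proof -
  have "1 + d \<le> exp d" by (rule exp_ge_add_one_self)
  then have "exp (- d) \<le> 1 / (1 + d)" using assms by (simp add: exp_minus field_simps)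
  then have "d / (1 + d) \<le> 1 - exp (- d)" using assms by (simp add: field_simps)
  then have "(1 + d) * (d / (1 + d)) \<le> (1 + c) * (1 - exp (- d))" using assms by (intro mult_mono) auto
  then show ?thesis using assms by simp
qed

context filtered_prob_space
begin

lemma martingale_increment:
  assumes N: "martingale M F {0..T} N" and rt: "0 \<le> r" "r \<le> t" "t \<le> T"
    and Z: "Z \<in> borel_measurable (F r)" "\<And>\<omega>. \<bar>Z \<omega>\<bar> \<le> (B::real)"
  shows "integrable M (\<lambda>\<omega>. Z \<omega> * (N t \<omega> - N r \<omega>))" "(\<integral>\<omega>. Z \<omega> * (N t \<omega> - N r \<omega>) \<partial>M) = 0"
proof -
  have r: "r \<in> {0..T}" and t: "t \<in> {0..T}" using rt by auto
  interpret S: finite_measure_subalgebra M "F r" by (rule fin_subalg[OF r])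
  have [measurable]: "Z \<in> borel_measurable M" using measurable_F_M[OF r Z(1)] .
  have Nt: "integrable M (N t)" "integrable M (N r)" and ce: "AE \<omega> in M. real_cond_exp M (F r) (N t) \<omega> = N r \<omega>"
    using N r t rt unfolding martingale_def by auto
  have ZN: "integrable M (\<lambda>\<omega>. Z \<omega> * N q \<omega>)" if "integrable M (N q)" for q
  proof (rule Bochner_Integration.integrable_bound[of _ "\<lambda>\<omega>. B * N q \<omega>"])
    show "AE \<omega> in M. norm (Z \<omega> * N q \<omega>) \<le> norm (B * N q \<omega>)"
      using Z(2) by (intro AE_I2) (auto simp: abs_mult intro!: mult_right_mono intro: order_trans[OF _ abs_ge_self])
  qed (use that in auto)
  have "(\<integral>\<omega>. Z \<omega> * N t \<omega> \<partial>M) = (\<integral>\<omega>. Z \<omega> * real_cond_exp M (F r) (N t) \<omega> \<partial>M)"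
    by (rule S.real_cond_exp_intg(2)[symmetric]) (use ZN Z Nt in auto)
  also have "\<dots> = (\<integral>\<omega>. Z \<omega> * N r \<omega> \<partial>M)"
  proof (rule integral_cong_AE)
    show "AE \<omega> in M. Z \<omega> * real_cond_exp M (F r) (N t) \<omega> = Z \<omega> * N r \<omega>" using ce by eventually_elim simp
    show "(\<lambda>\<omega>. Z \<omega> * real_cond_exp M (F r) (N t) \<omega>) \<in> borel_measurable M"
      by (intro borel_measurable_times borel_measurable_cond_exp2) auto
  qed (use Nt in auto)
  finally show "(\<integral>\<omega>. Z \<omega> * (N t \<omega> - N r \<omega>) \<partial>M) = 0"
    using ZN Nt by (simp add: right_diff_distrib)
  show "integrable M (\<lambda>\<omega>. Z \<omega> * (N t \<omega> - N r \<omega>))"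
    using ZN Nt by (simp add: right_diff_distrib)
qed

text \<open>
  The variation of \<open>N\<close> need not be integrable. On a grid, let \<open>V\<close> be the discrete variation and
  \<open>\<Phi> x = sqrt (1 + x\<^sup>2) - 1\<close>. The weight \<open>exp (- V)\<close> bounds the sum of the second-order remainders of
  \<open>\<Phi>\<close> by a multiple of \<open>1 + 2 S\<close>, while pathwise this sum is at most the mesh oscillation times
  the variation; hence \<open>exp (- V) * \<Phi> (N T)\<close> has mean tending to 0.
\<close>

lemma absolutely_continuous_martingale_eq_0:
  assumes N: "martingale M F {0..T} N" and s: "s \<in> {0..T}"
    and dom: "\<And>Q. countable Q \<Longrightarrow> Q \<subseteq> {s..T} \<Longrightarrow> \<exists>S. integrable M S \<and> (AE \<omega> in M. \<forall>q\<in>Q. \<bar>N q \<omega>\<bar> \<le> S \<omega>)"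
    and int: "AE \<omega> in M. set_integrable lborel {s..T} (\<theta> \<omega>)"
    and eq: "\<And>t. t \<in> {s..T} \<Longrightarrow> AE \<omega> in M. N t \<omega> = (LBINT r:{s..t}. \<theta> \<omega> r)"
  shows "AE \<omega> in M. N T \<omega> = 0"
proof -
  define g where "g n k = s + (T - s) * real k / real (Suc n)" for n k
  have g_le: "s \<le> g n k" "g n k \<le> T" if "k \<le> Suc n" for n k
  proof -
    have "(T - s) * real k / real (Suc n) \<le> T - s"
      using that s by (simp add: divide_le_eq mult_left_mono del: of_nat_Suc)
    then show "g n k \<le> T" unfolding g_def by linarith
    show "s \<le> g n k" using s unfolding g_def by simp
  qed
  have g_step: "g n (Suc k) = g n k + (T - s) / real (Suc n)" for n k
    unfolding g_def by (simp add: add_divide_distrib distrib_left del: of_nat_Suc) (simp add: add_divide_distrib distrib_left)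
  have g_mono: "g n k \<le> g n (Suc k)" for n k using s unfolding g_step by simp
  have g_ends: "g n 0 = s" "g n (Suc n) = T" for n unfolding g_def by (auto simp del: of_nat_Suc)
  have g_in: "g n k \<in> {0..T}" if "k \<le> Suc n" for n k using g_le[OF that] s by auto
  define Q where "Q = {g n k | n k. k \<le> Suc n}"
  have "Q \<subseteq> range (case_prod g)" unfolding Q_def by auto
  then have Q1: "countable Q" by (rule countable_subset) simp
  have Q2: "Q \<subseteq> {s..T}" using g_le unfolding Q_def by auto
  note Q = Q1 Q2
  obtain S where S: "integrable M S" "AE \<omega> in M. \<forall>q\<in>Q. \<bar>N q \<omega>\<bar> \<le> S \<omega>" using dom[OF Q] by blast
  have eqQ: "AE \<omega> in M. \<forall>q\<in>Q. N q \<omega> = (LBINT r:{s..q}. \<theta> \<omega> r)"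
    using Q eq by (subst AE_ball_countable) auto
  define X where "X n k \<omega> = N (g n k) \<omega>" for n k \<omega>
  define V where "V n k \<omega> = (\<Sum>j<k. \<bar>X n (Suc j) \<omega> - X n j \<omega>\<bar>)" for n k \<omega>
  define \<Phi> :: "real \<Rightarrow> real" where "\<Phi> x = sqrt (1 + x\<^sup>2) - 1" for x
  define R :: "real \<Rightarrow> real \<Rightarrow> real" where "R a b = \<Phi> b - \<Phi> a - a / sqrt (1 + a\<^sup>2) * (b - a)" for a b
  have R: "0 \<le> R a b" "R a b \<le> (b - a)\<^sup>2" "R a b \<le> 2 * \<bar>b - a\<bar>" for a b
    using sqrt_convex_remainder_nonneg[of b a] sqrt_convex_remainder_le_square[of b a]
      sqrt_convex_remainder_le_abs[of b a] unfolding R_def \<Phi>_def by auto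
  define W where "W n \<omega> = (\<Sum>k<Suc n. exp (- V n k \<omega>) * R (X n k \<omega>) (X n (Suc k) \<omega>))" for n \<omega>
  have \<Phi>_nn: "0 \<le> \<Phi> x" for x by (simp add: \<Phi>_def)
  have \<Phi>_0: "\<Phi> x = 0 \<longleftrightarrow> x = 0" for x by (simp add: \<Phi>_def)
  have V_nn: "0 \<le> V n k \<omega>" for n k \<omega> unfolding V_def by (simp add: sum_nonneg)
  have NF: "N t \<in> borel_measurable (F t)" if "t \<in> {0..T}" for t using N that by (auto simp: martingale_def)
  have XF: "X n j \<in> borel_measurable (F (g n k))" if "j \<le> k" "k \<le> Suc n" for n j k
    unfolding X_def
  proof (rule measurable_F_mono[OF _ _ _ NF])
    show "g n j \<le> g n k" using lift_Suc_mono_le[of "g n", OF g_mono that(1)] .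
  qed (use g_in that in auto)
  have VF: "V n k \<in> borel_measurable (F (g n k))" if "k \<le> Suc n" for n k
    unfolding V_def[abs_def]
    by (intro borel_measurable_sum borel_measurable_abs borel_measurable_diff XF) (use that in auto)
  have [measurable]: "X n k \<in> borel_measurable M" if "k \<le> Suc n" for n k
    using XF[of k k n] that measurable_F_M g_in by blast
  have [measurable]: "V n k \<in> borel_measurable M" if "k \<le> Suc n" for n k
    using VF[of k n] that measurable_F_M g_in by blast
  have [measurable]: "\<Phi> \<in> borel_measurable borel" unfolding \<Phi>_def by measurable
  have [measurable]: "W n \<in> borel_measurable M" for n
    unfolding W_def[abs_def] R_def
    by (intro borel_measurable_sum) measurable
  \<comment> \<open>The weight is frozen at the left end of each cell, where it is already known. As
    \<open>\<Phi>\<close> is nonnegative and \<open>V\<close> grows, this only enlarges the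
    right-hand side.\<close>
  have step: "exp (- V n m \<omega>) * \<Phi> (X n m \<omega>) \<le> \<Phi> (X n 0 \<omega>) +
      (\<Sum>k<m. exp (- V n k \<omega>) * (\<Phi> (X n (Suc k) \<omega>) - \<Phi> (X n k \<omega>)))" for n m \<omega>
  proof (induction m)
    case 0 show ?case by (simp add: V_def)
  next
    case (Suc m)
    have "exp (- V n (Suc m) \<omega>) * \<Phi> (X n (Suc m) \<omega>) \<le> exp (- V n m \<omega>) * \<Phi> (X n (Suc m) \<omega>)"
      using \<Phi>_nn by (intro mult_right_mono) (auto simp: V_def)
    then show ?case using Suc.IH by (simp add: right_diff_distrib)
  qed
  have X0: "AE \<omega> in M. X n 0 \<omega> = 0" for n
  proof -
    show ?thesis using LBINT_singleton_eq_0 eq[of s] s unfolding X_def g_ends by auto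
  qed
  then have X0': "AE \<omega> in M. \<forall>n. X n 0 \<omega> = 0" unfolding AE_all_countable by blast
  \<comment> \<open>The first-order part of the increment of \<open>\<Phi>\<close>. Its coefficient
    is bounded and known at \<open>g n k\<close>, so the mean vanishes without any integrability of
    the variation.\<close>
  define D where "D n k \<omega> = (exp (- V n k \<omega>) * (X n k \<omega> / sqrt (1 + (X n k \<omega>)\<^sup>2))) * (X n (Suc k) \<omega> - X n k \<omega>)" for n k \<omega>
  have D: "integrable M (D n k)" "(\<integral>\<omega>. D n k \<omega> \<partial>M) = 0" if k: "k \<le> n" for n k
  proof -
    have [measurable]: "X n k \<in> borel_measurable (F (g n k))" "V n k \<in> borel_measurable (F (g n k))"
      using XF[of k k n] VF[of k n] k by auto
    have m: "(\<lambda>\<omega>. exp (- V n k \<omega>) * (X n k \<omega> / sqrt (1 + (X n k \<omega>)\<^sup>2))) \<in> borel_measurable (F (g n k))"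
      by measurable
    have b: "\<bar>exp (- V n k \<omega>) * (X n k \<omega> / sqrt (1 + (X n k \<omega>)\<^sup>2))\<bar> \<le> 1" for \<omega>
    proof -
      have "\<bar>X n k \<omega>\<bar> \<le> sqrt (1 + (X n k \<omega>)\<^sup>2)" by (rule real_le_rsqrt) simp
      then have "\<bar>X n k \<omega> / sqrt (1 + (X n k \<omega>)\<^sup>2)\<bar> \<le> 1"
        by (simp add: abs_divide divide_le_eq) (smt (verit) real_sqrt_gt_0_iff zero_le_power2)
      then show ?thesis using V_nn[of n k \<omega>] unfolding abs_mult by (intro mult_le_one) auto
    qed
    note * = martingale_increment[OF N _ g_mono[of n k] _ m b, folded X_def]
    show "integrable M (D n k)" "(\<integral>\<omega>. D n k \<omega> \<partial>M) = 0"
      unfolding D_def[abs_def] using *  g_in[of k n] g_in[of "Suc k" n] k by auto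
  qed
  have good: "AE \<omega> in M. (\<forall>n. exp (- V n (Suc n) \<omega>) * \<Phi> (N T \<omega>) \<le> W n \<omega> + (\<Sum>k<Suc n. D n k \<omega>)) \<and>
      (\<forall>n. \<bar>W n \<omega>\<bar> \<le> 2 * (1 + 2 * S \<omega>)) \<and> (\<lambda>n. W n \<omega>) \<longlonglongrightarrow> 0 \<and> (\<exists>K. \<forall>n. V n (Suc n) \<omega> \<le> K)"
    using int eqQ S(2) X0'
  proof eventually_elim
    case (elim \<omega>)
    let ?I = "\<lambda>t. LBINT r:{s..t}. \<theta> \<omega> r" and ?J = "\<lambda>t. LBINT r:{s..t}. \<bar>\<theta> \<omega> r\<bar>"
    define d where "d n k = \<bar>X n (Suc k) \<omega> - X n k \<omega>\<bar>" for n k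
    have inQ: "g n k \<in> Q" if "k \<le> Suc n" for n k using that unfolding Q_def by blast
    have XI: "X n k \<omega> = ?I (g n k)" "\<bar>X n k \<omega>\<bar> \<le> S \<omega>" if "k \<le> Suc n" for n k
      using elim(2,3) inQ[OF that] unfolding X_def by auto
    have d_le: "d n k \<le> ?J (g n (Suc k)) - ?J (g n k)" if "k < Suc n" for n k
      unfolding d_def using XI(1)[of k n] XI(1)[of "Suc k" n] that
        indefinite_integral_increment_le[OF elim(1) _ g_mono[of n k]] g_le[of k n] g_le[of "Suc k" n] by simp
    have "?J s = 0" by (rule LBINT_singleton_eq_0)
    have VK: "V n (Suc n) \<omega> \<le> ?J T" for n
    proof -
      have "V n (Suc n) \<omega> \<le> (\<Sum>k<Suc n. ?J (g n (Suc k)) - ?J (g n k))"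
        unfolding V_def d_def[symmetric] by (intro sum_mono d_le) auto
      also have "\<dots> = ?J T - ?J s"
        by (subst sum_lessThan_telescope[of "\<lambda>k. ?J (g n k)"]) (simp add: g_ends)
      finally show ?thesis using \<open>?J s = 0\<close> by simp
    qed
    have S_nn: "0 \<le> S \<omega>" using XI(2)[of 0 0] by simp
    have W_nn: "0 \<le> W n \<omega>" for n unfolding W_def using R(1) by (intro sum_nonneg) simp
    \<comment> \<open>Both ends of a cell are bounded by \<open>S \<omega>\<close>, so a single
      increment is at most \<open>2 * S \<omega>\<close>: the \<open>c\<close> of the exponential
      estimate.\<close>
    have W_bd: "W n \<omega> \<le> 2 * (1 + 2 * S \<omega>)" for n
    proof -
      have "W n \<omega> \<le> (\<Sum>k<Suc n. 2 * (1 + 2 * S \<omega>) * (exp (- V n k \<omega>) - exp (- V n (Suc k) \<omega>)))"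
        unfolding W_def
      proof (rule sum_mono)
        fix k assume k: "k \<in> {..<Suc n}"
        have "d n k \<le> 2 * S \<omega>" unfolding d_def using XI(2)[of k n] XI(2)[of "Suc k" n] k by auto
        then have "d n k \<le> (1 + 2 * S \<omega>) * (1 - exp (- d n k))"
          by (intro min_le_one_minus_exp) (auto simp: d_def)
        then have "2 * d n k \<le> 2 * ((1 + 2 * S \<omega>) * (1 - exp (- d n k)))"
          by (rule mult_left_mono) simp
        then have "R (X n k \<omega>) (X n (Suc k) \<omega>) \<le> 2 * ((1 + 2 * S \<omega>) * (1 - exp (- d n k)))"
          by (rule order_trans[rotated]) (simp add: d_def R(3))
        then have "exp (- V n k \<omega>) * R (X n k \<omega>) (X n (Suc k) \<omega>) \<le>
            exp (- V n k \<omega>) * (2 * ((1 + 2 * S \<omega>) * (1 - exp (- d n k))))"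
          by (intro mult_left_mono) auto
        also have "\<dots> = 2 * (1 + 2 * S \<omega>) * (exp (- V n k \<omega>) - exp (- V n k \<omega>) * exp (- d n k))"
          by (simp add: algebra_simps)
        also have "exp (- V n k \<omega>) * exp (- d n k) = exp (- V n (Suc k) \<omega>)"
          unfolding V_def d_def by (simp add: exp_add[symmetric])
        finally show "exp (- V n k \<omega>) * R (X n k \<omega>) (X n (Suc k) \<omega>)
          \<le> 2 * (1 + 2 * S \<omega>) * (exp (- V n k \<omega>) - exp (- V n (Suc k) \<omega>))" .
      qed
      also have "\<dots> = 2 * (1 + 2 * S \<omega>) * (1 - exp (- V n (Suc n) \<omega>))"
        unfolding sum_distrib_left[symmetric]
        by (subst sum_lessThan_telescope'[of "\<lambda>k. exp (- V n k \<omega>)"]) (simp add: V_def)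
      also have "\<dots> \<le> 2 * (1 + 2 * S \<omega>) * 1" using S_nn by (intro mult_left_mono) auto
      finally show ?thesis by simp
    qed
    have W_lim: "(\<lambda>n. W n \<omega>) \<longlonglongrightarrow> 0"
    proof (rule LIMSEQ_I)
      fix r :: real assume "r > 0"
      \<comment> \<open>Makes \<open>e\<close> times the whole variation smaller than
        \<open>r\<close>; the summand 1 covers vanishing variation.\<close>
      define e where "e = r / (1 + ?J T)"
      have J_nn: "0 \<le> ?J T" using VK[of 0] V_nn[of 0 "Suc 0" \<omega>] by linarith
      then have e: "e > 0" using \<open>r > 0\<close> by (simp add: e_def)
      have "uniformly_continuous_on {s..T} ?I"
        by (intro compact_uniformly_continuous indefinite_integral_continuous elim(1)) auto
      then obtain \<delta> where \<delta>: "\<delta> > 0" "\<And>x y. x \<in> {s..T} \<Longrightarrow> y \<in> {s..T} \<Longrightarrow> dist x y < \<delta> \<Longrightarrow> dist (?I x) (?I y) < e"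
        using e unfolding uniformly_continuous_on_def by metis
      obtain n0 :: nat where n0: "(T - s) / \<delta> < real n0" using reals_Archimedean2 by blast
      have "W n \<omega> < r" if n: "n \<ge> n0" for n
      proof -
        have small: "(T - s) / real (Suc n) < \<delta>"
        proof -
          have "(T - s) / \<delta> < real (Suc n)" using n0 n by linarith
          then show ?thesis using \<delta>(1) by (simp add: divide_less_eq mult.commute del: of_nat_Suc)
        qed
        have de: "d n k \<le> e" if "k < Suc n" for k
        proof -
          have "dist (g n (Suc k)) (g n k) < \<delta>"
            using small s unfolding g_step by (simp add: dist_real_def del: of_nat_Suc)
          then have "dist (?I (g n (Suc k))) (?I (g n k)) < e"
            using that g_le[of k n] g_le[of "Suc k" n] by (intro \<delta>(2)) auto
          then show ?thesis unfolding d_def dist_real_def using XI(1)[of k n] XI(1)[of "Suc k" n] that by simp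
        qed
        have "W n \<omega> \<le> (\<Sum>k<Suc n. e * d n k)"
          unfolding W_def
        proof (rule sum_mono)
          fix k assume k: "k \<in> {..<Suc n}"
          have "exp (- V n k \<omega>) * R (X n k \<omega>) (X n (Suc k) \<omega>) \<le> 1 * R (X n k \<omega>) (X n (Suc k) \<omega>)"
            using R(1) V_nn by (intro mult_right_mono) auto
          also have "\<dots> \<le> (d n k)\<^sup>2" using R(2)[of "X n k \<omega>" "X n (Suc k) \<omega>"] by (simp add: d_def)
          also have "\<dots> \<le> e * d n k"
            unfolding power2_eq_square using de[of k] k by (intro mult_right_mono) (auto simp: d_def)
          finally show "exp (- V n k \<omega>) * R (X n k \<omega>) (X n (Suc k) \<omega>) \<le> e * d n k" .
        qed
        also have "\<dots> = e * V n (Suc n) \<omega>" unfolding V_def d_def by (simp only: sum_distrib_left)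
        also have "\<dots> \<le> e * ?J T" using VK e by (intro mult_left_mono) auto
        also have "\<dots> < r" using \<open>r > 0\<close> J_nn by (simp add: e_def divide_less_eq mult_strict_left_mono algebra_simps)
        finally show ?thesis .
      qed
      then show "\<exists>n0. \<forall>n\<ge>n0. norm (W n \<omega> - 0) < r" using W_nn by auto
    qed
    have main: "exp (- V n (Suc n) \<omega>) * \<Phi> (N T \<omega>) \<le> W n \<omega> + (\<Sum>k<Suc n. D n k \<omega>)" for n
    proof -
      have "exp (- V n (Suc n) \<omega>) * \<Phi> (N T \<omega>) \<le>
          (\<Sum>k<Suc n. exp (- V n k \<omega>) * (\<Phi> (X n (Suc k) \<omega>) - \<Phi> (X n k \<omega>)))"
        using step[of n "Suc n" \<omega>] elim(4)[rule_format, of n] \<Phi>_0[of 0] by (simp add: X_def g_ends del: sum.lessThan_Suc)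
      also have "\<dots> = W n \<omega> + (\<Sum>k<Suc n. D n k \<omega>)"
        unfolding W_def D_def sum.distrib[symmetric] R_def
        by (intro sum.cong refl) (simp add: algebra_simps)
      finally show ?thesis .
    qed
    from main W_bd W_nn W_lim VK show ?case by auto
  qed
  have good': "AE \<omega> in M. norm (W n \<omega>) \<le> 2 * (1 + 2 * S \<omega>)" "AE \<omega> in M. (\<lambda>n. W n \<omega>) \<longlonglongrightarrow> 0" for n
    using good by (eventually_elim, simp)+
  have Wint: "integrable M (W n)" for n
    by (rule Bochner_Integration.integrable_bound[of _ "\<lambda>\<omega>. 2 * (1 + 2 * S \<omega>)"])
       (use S(1) good'(1)[of n] in \<open>auto elim: eventually_mono\<close>)
  have "(\<lambda>n. \<integral>\<omega>. W n \<omega> \<partial>M) \<longlonglongrightarrow> (\<integral>\<omega>. 0 \<partial>M)"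
    by (rule integral_dominated_convergence[where w="\<lambda>\<omega>. 2 * (1 + 2 * S \<omega>)"])
       (use S(1) good' in auto)
  then have Wlim: "(\<lambda>n. ennreal (\<integral>\<omega>. W n \<omega> \<partial>M)) \<longlonglongrightarrow> 0"
    using tendsto_ennrealI by fastforce
  have NTm[measurable]: "N T \<in> borel_measurable M" using measurable_F_M[OF _ NF[of T]] s by auto
  have a_m: "(\<lambda>\<omega>. exp (- V n (Suc n) \<omega>) * \<Phi> (N T \<omega>)) \<in> borel_measurable M" for n by measurable
  have a_le: "(\<integral>\<^sup>+\<omega>. ennreal (exp (- V n (Suc n) \<omega>) * \<Phi> (N T \<omega>)) \<partial>M) \<le> ennreal (\<integral>\<omega>. W n \<omega> \<partial>M)" for n
  proof -
    have Dint: "integrable M (\<lambda>\<omega>. \<Sum>k<Suc n. D n k \<omega>)" by (intro Bochner_Integration.integrable_sum D(1)) auto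
    have Dzero: "(\<integral>\<omega>. (\<Sum>k<Suc n. D n k \<omega>) \<partial>M) = 0"
      by (subst Bochner_Integration.integral_sum) (use D in auto)
    have ae: "AE \<omega> in M. exp (- V n (Suc n) \<omega>) * \<Phi> (N T \<omega>) \<le> W n \<omega> + (\<Sum>k<Suc n. D n k \<omega>)"
      using good by eventually_elim blast
    have "integrable M (\<lambda>\<omega>. exp (- V n (Suc n) \<omega>) * \<Phi> (N T \<omega>))"
    proof (rule Bochner_Integration.integrable_bound[of _ "\<lambda>\<omega>. W n \<omega> + (\<Sum>k<Suc n. D n k \<omega>)"])
      show "AE \<omega> in M. norm (exp (- V n (Suc n) \<omega>) * \<Phi> (N T \<omega>)) \<le> norm (W n \<omega> + (\<Sum>k<Suc n. D n k \<omega>))"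
        using ae by eventually_elim (use \<Phi>_nn in \<open>auto simp: abs_mult simp del: sum.lessThan_Suc\<close>)
    qed (use Wint Dint a_m in auto)
    then have "(\<integral>\<^sup>+\<omega>. ennreal (exp (- V n (Suc n) \<omega>) * \<Phi> (N T \<omega>)) \<partial>M) = ennreal (\<integral>\<omega>. exp (- V n (Suc n) \<omega>) * \<Phi> (N T \<omega>) \<partial>M)"
      by (intro nn_integral_eq_integral) (auto simp: \<Phi>_nn)
    also have "\<dots> \<le> ennreal (\<integral>\<omega>. W n \<omega> + (\<Sum>k<Suc n. D n k \<omega>) \<partial>M)"
      by (intro ennreal_leI integral_mono_AE \<open>integrable M (\<lambda>\<omega>. exp (- V n (Suc n) \<omega>) * \<Phi> (N T \<omega>))\<close> Bochner_Integration.integrable_add Wint Dint ae)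
    also have "(\<integral>\<omega>. W n \<omega> + (\<Sum>k<Suc n. D n k \<omega>) \<partial>M) = (\<integral>\<omega>. W n \<omega> \<partial>M)"
      using Wint Dint Dzero by (subst Bochner_Integration.integral_add) auto
    finally show ?thesis .
  qed
  \<comment> \<open>The weights depend on \<open>n\<close> and are not shown to converge. Fatou's
    lemma suffices, because on almost every path \<open>V\<close> is bounded uniformly in
    \<open>n\<close> and the weights stay above some \<open>exp (- K)\<close>.\<close>
  have "(\<integral>\<^sup>+\<omega>. liminf (\<lambda>n. ennreal (exp (- V n (Suc n) \<omega>) * \<Phi> (N T \<omega>))) \<partial>M)
      \<le> liminf (\<lambda>n. \<integral>\<^sup>+\<omega>. ennreal (exp (- V n (Suc n) \<omega>) * \<Phi> (N T \<omega>)) \<partial>M)"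
    by (rule nn_integral_liminf) (use a_m in auto)
  also have "\<dots> \<le> liminf (\<lambda>n. ennreal (\<integral>\<omega>. W n \<omega> \<partial>M))"
    by (rule Liminf_mono) (use a_le in auto)
  also have "\<dots> = 0" using Wlim by (simp add: lim_imp_Liminf)
  finally have "AE \<omega> in M. liminf (\<lambda>n. ennreal (exp (- V n (Suc n) \<omega>) * \<Phi> (N T \<omega>))) = 0"
    by (subst nn_integral_0_iff_AE[symmetric]) (use a_m in auto)
  then show ?thesis using good
  proof eventually_elim
    case (elim \<omega>)
    then obtain K where K: "\<And>n. V n (Suc n) \<omega> \<le> K" by blast
    have "ennreal (exp (- K) * \<Phi> (N T \<omega>)) \<le> liminf (\<lambda>n. ennreal (exp (- V n (Suc n) \<omega>) * \<Phi> (N T \<omega>)))"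
      by (intro Liminf_bounded always_eventually allI ennreal_leI mult_right_mono) (auto simp: K \<Phi>_nn)
    then have "exp (- K) * \<Phi> (N T \<omega>) \<le> 0" using elim(1) by (simp add: ennreal_eq_0_iff)
    then have "\<Phi> (N T \<omega>) = 0" using \<Phi>_nn[of "N T \<omega>"] by (simp add: mult_le_0_iff)
    then show ?case using \<Phi>_0 by blast
  qed
qed

end

section \<open>Completed filtrations\<close>

context filtered_prob_space
begin

abbreviation "Mc \<equiv> completion M"
abbreviation "Fc \<equiv> completed_filtration F M"

lemma space_Fc: "t \<in> {0..T} \<Longrightarrow> space (Fc t) = space M"
  and sets_Fc: "t \<in> {0..T} \<Longrightarrow> sets (Fc t) = sigma_sets (space M) (sets (F t) \<union> null_sets Mc)"
proof -
  assume t: "t \<in> {0..T}"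
  have "sets (F t) \<union> null_sets Mc \<subseteq> Pow (space M)"
    using sets.space_closed[of "F t"] space_F[OF t] sets.space_closed[of Mc] by (auto simp: null_sets_def)
  then show "space (Fc t) = space M" "sets (Fc t) = sigma_sets (space M) (sets (F t) \<union> null_sets Mc)"
    unfolding completed_filtration_def by (auto simp: space_measure_of sets_measure_of)
qed

lemma filtered_completion: "filtered_prob_space Mc Fc T"
proof (intro filtered_prob_space.intro filtered_prob_space_axioms.intro)
  show "prob_space Mc" by (rule prob_space_completion)
  show "0 < T" by (rule T_pos)
  fix t assume t: "t \<in> {0..T}"
  have "sigma_sets (space Mc) (sets (F t) \<union> null_sets Mc) \<subseteq> sets Mc"
    by (rule sets.sigma_sets_subset) (use sets_F_M[OF t] sets_completionI_sets in auto)
  then show "subalgebra Mc (Fc t)"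
    using t by (auto simp: subalgebra_def space_Fc sets_Fc)
next
  fix r t assume "0 \<le> r" "r \<le> t" "t \<le> T"
  then show "sets (Fc r) \<subseteq> sets (Fc t)"
    using filtration_mono[of r t] by (subst (1 2) sets_Fc) (auto intro!: sigma_sets_mono')
qed

text \<open>Sets that coincide almost surely with a member of \<open>F t\<close> form a
  sigma-algebra containing both kinds of generators. Tests over \<open>Fc t\<close> thereby reduce
  to tests over \<open>F t\<close>.\<close>

lemma Fc_approx:
  assumes t: "t \<in> {0..T}" and A: "A \<in> sets (Fc t)"
  shows "\<exists>B\<in>sets (F t). AE \<omega> in M. \<omega> \<in> A \<longleftrightarrow> \<omega> \<in> B"
  using A unfolding sets_Fc[OF t]
proof (induction rule: sigma_sets.induct)
  case (Basic A)
  then consider "A \<in> sets (F t)" | "A \<in> null_sets Mc" by blast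
  then show ?case
  proof cases
    case 2
    then have "AE \<omega> in Mc. \<omega> \<notin> A" by (rule AE_not_in)
    then show ?thesis by (intro bexI[of _ "{}"]) (auto simp: AE_completion_iff)
  qed auto
next
  case Empty
  show ?case by (intro bexI[of _ "{}"]) auto
next
  case (Compl A)
  then obtain B where B: "B \<in> sets (F t)" "AE \<omega> in M. \<omega> \<in> A \<longleftrightarrow> \<omega> \<in> B" by blast
  have "space (F t) - B \<in> sets (F t)" using B by auto
  moreover have "AE \<omega> in M. \<omega> \<in> space M - A \<longleftrightarrow> \<omega> \<in> space (F t) - B"
    using B(2) by eventually_elim (auto simp: space_F[OF t])
  ultimately show ?case by blast
next
  case (Union A)
  then have "\<forall>i. \<exists>B. B \<in> sets (F t) \<and> (AE \<omega> in M. \<omega> \<in> A i \<longleftrightarrow> \<omega> \<in> B)" by blast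
  then obtain B where B: "\<And>i. B i \<in> sets (F t)" "\<And>i. AE \<omega> in M. \<omega> \<in> A i \<longleftrightarrow> \<omega> \<in> B i" by metis
  have "AE \<omega> in M. \<forall>i. \<omega> \<in> A i \<longleftrightarrow> \<omega> \<in> B i" using B(2) by (simp add: AE_all_countable)
  then have "AE \<omega> in M. \<omega> \<in> (\<Union>i::nat. A i) \<longleftrightarrow> \<omega> \<in> (\<Union>i. B i)" by eventually_elim auto
  then show ?case using B(1) by (intro bexI[of _ "\<Union>i. B i"]) auto
qed

text \<open>The exceptional null set absorbs all differences: each of its subsets is negligible and
  hence belongs to \<open>Fc t\<close>.\<close>

lemma measurable_Fc_AE:
  fixes X X' :: "'a \<Rightarrow> real"
  assumes t: "t \<in> {0..T}" and X: "X \<in> borel_measurable (F t)" and eq: "AE \<omega> in M. X' \<omega> = X \<omega>"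
  shows "X' \<in> borel_measurable (Fc t)"
proof (rule measurableI)
  obtain N where N: "{\<omega> \<in> space M. X' \<omega> \<noteq> X \<omega>} \<subseteq> N" "N \<in> null_sets M"
    using eq by (auto elim: AE_E3 simp: eventually_ae_filter)
  fix B :: "real set" assume B: "B \<in> sets borel"
  have "X -` B \<inter> space M \<in> sets (Fc t)"
    using measurable_sets[OF X B] unfolding space_F[OF t] sets_Fc[OF t] by auto
  moreover have "N \<in> sets (Fc t)"
    using null_sets_completionI[OF N(2)] unfolding sets_Fc[OF t] by auto
  moreover have "X' -` B \<inter> N \<inter> space M \<in> sets (Fc t)"
    unfolding sets_Fc[OF t] using null_sets_completion_iff2[of "X' -` B \<inter> N \<inter> space M"] N(2) by auto
  moreover have "X' -` B \<inter> space (Fc t) = (X -` B \<inter> space M - N) \<union> (X' -` B \<inter> N \<inter> space M)"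
    using N(1) by (auto simp: space_Fc[OF t])
  ultimately show "X' -` B \<inter> space (Fc t) \<in> sets (Fc t)" by auto
qed auto

text \<open>The single passage from the raw to the completed basis. Equality of \<open>X t\<close>
  and \<open>Z t\<close> is asked separately for each \<open>t\<close>, which is all that a
  modification offers.\<close>

lemma martingale_completionI:
  assumes Z: "\<And>t. t \<in> {0..T} \<Longrightarrow> Z t \<in> borel_measurable (F t)" "\<And>t. t \<in> {0..T} \<Longrightarrow> integrable M (Z t)"
    and closed: "\<And>t A. t \<in> {0..T} \<Longrightarrow> A \<in> sets (F t) \<Longrightarrow> (\<integral>\<omega>\<in>A. Z T \<omega> \<partial>M) = (\<integral>\<omega>\<in>A. Z t \<omega> \<partial>M)"
    and X: "\<And>t. t \<in> {0..T} \<Longrightarrow> AE \<omega> in M. X t \<omega> = (Z t \<omega> :: real)"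
  shows "martingale Mc Fc {0..T} X"
proof -
  interpret C: filtered_prob_space Mc Fc T by (rule filtered_completion)
  have XF: "X t \<in> borel_measurable (Fc t)" if "t \<in> {0..T}" for t
    by (rule measurable_Fc_AE[OF that Z(1)[OF that] X[OF that]])
  have XM: "X t \<in> borel_measurable Mc" if "t \<in> {0..T}" for t
    using C.measurable_F_M[OF that XF[OF that]] .
  have Xc: "AE \<omega> in Mc. X t \<omega> = Z t \<omega>" if "t \<in> {0..T}" for t
    using X[OF that] by (rule AE_completion)
  have Xint: "integrable Mc (X t)" if "t \<in> {0..T}" for t
  proof -
    have "integrable Mc (Z t)" using Z(2)[OF that] by (subst integrable_completion) auto
    moreover have "AE \<omega> in Mc. Z t \<omega> = X t \<omega>" using Xc[OF that] by eventually_elim simp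
    ultimately show ?thesis by (rule integrable_cong_AE_imp[OF _ XM[OF that]])
  qed
  have XA: "(\<integral>\<omega>\<in>A. X t \<omega> \<partial>Mc) = (\<integral>\<omega>\<in>B. Z t \<omega> \<partial>M)"
    if t: "t \<in> {0..T}" and A: "A \<in> sets Mc" and B: "B \<in> sets M" and AB: "AE \<omega> in M. \<omega> \<in> A \<longleftrightarrow> \<omega> \<in> B" for t A B
  proof -
    have Zm: "(\<lambda>\<omega>. indicat_real B \<omega> *\<^sub>R Z t \<omega>) \<in> borel_measurable M" using Z(2)[OF t] B by auto
    have "(\<integral>\<omega>\<in>A. X t \<omega> \<partial>Mc) = (\<integral>\<omega>. indicat_real B \<omega> *\<^sub>R Z t \<omega> \<partial>Mc)"
      unfolding set_lebesgue_integral_def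
    proof (rule integral_cong_AE)
      show "AE \<omega> in Mc. indicat_real A \<omega> *\<^sub>R X t \<omega> = indicat_real B \<omega> *\<^sub>R Z t \<omega>"
        using Xc[OF t] AE_completion[OF AB] by eventually_elim (auto simp: indicator_def)
    qed (use XM[OF t] A measurable_completion[OF Zm] in auto)
    also have "\<dots> = (\<integral>\<omega>\<in>B. Z t \<omega> \<partial>M)"
      unfolding set_lebesgue_integral_def by (rule integral_completion[OF Zm])
    finally show ?thesis .
  qed
  show ?thesis
    unfolding martingale_def
  proof (intro conjI ballI impI)
    fix r t assume r: "r \<in> {0..T}" and t: "t \<in> {0..T}" and "r \<le> t"
    interpret S: finite_measure_subalgebra Mc "Fc r" by (rule C.fin_subalg[OF r])
    show "AE \<omega> in Mc. real_cond_exp Mc (Fc r) (X t) \<omega> = X r \<omega>"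
    proof (rule S.real_cond_exp_charact)
      fix A assume A: "A \<in> sets (Fc r)"
      obtain B where B: "B \<in> sets (F r)" "AE \<omega> in M. \<omega> \<in> A \<longleftrightarrow> \<omega> \<in> B" using Fc_approx[OF r A] by blast
      have B': "B \<in> sets (F t)" using filtration_mono[of r t] B r t \<open>r \<le> t\<close> by auto
      note XAB = XA[OF _ C.sets_F_M[OF r A] sets_F_M[OF r B(1)] B(2)]
      show "(\<integral>\<omega>\<in>A. X t \<omega> \<partial>Mc) = (\<integral>\<omega>\<in>A. X r \<omega> \<partial>Mc)"
        using closed[OF r B(1)] closed[OF t B'] unfolding XAB[OF r] XAB[OF t] by simp
    qed (use Xint XF r t in auto)
  qed (use XF Xint in auto)
qed

end

section \<open>Approximating times from the right\<close>

lemma tendsto_right_sequence: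
  assumes f: "(f \<longlongrightarrow> f a) (at_right (a::real))" and x: "x \<longlonglongrightarrow> a" "\<And>n. a \<le> x n"
  shows "(\<lambda>n. f (x n)) \<longlonglongrightarrow> f a"
proof (rule topological_tendstoI)
  fix S assume S: "open S" "f a \<in> S"
  have "\<forall>\<^sub>F y in at_right a. f y \<in> S" using f S by (rule topological_tendstoD)
  then obtain b where b: "b > a" "\<And>y. a < y \<Longrightarrow> y < b \<Longrightarrow> f y \<in> S"
    unfolding eventually_at_right_field by blast
  have "\<forall>\<^sub>F n in sequentially. x n < b" using order_tendstoD(2)[OF x(1) b(1)] .
  then show "\<forall>\<^sub>F n in sequentially. f (x n) \<in> S"
  proof eventually_elim
    case (elim n)
    then show ?case using b(2)[of "x n"] x(2)[of n] S(2) by (cases "x n = a") auto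
  qed
qed

text \<open>Strictly to the right of \<open>r\<close>, at most \<open>1 / Suc n\<close> away, with
  countably many values: a right-continuous path is recovered as the limit of its values at these
  times.\<close>

definition upper_grid :: "nat \<Rightarrow> real \<Rightarrow> real" where
  "upper_grid n r = (of_int \<lfloor>real (Suc n) * r\<rfloor> + 1) / real (Suc n)"

lemma upper_grid_ge: "r \<le> upper_grid n r"
proof -
  have "real (Suc n) * r \<le> of_int \<lfloor>real (Suc n) * r\<rfloor> + 1" by linarith
  then show ?thesis unfolding upper_grid_def by (simp add: pos_le_divide_eq mult.commute del: of_nat_Suc)
qed

lemma upper_grid_tendsto: "(\<lambda>n. upper_grid n r) \<longlonglongrightarrow> r"
proof (rule real_tendsto_sandwich[of "\<lambda>_. r" _ _ "\<lambda>n. r + 1 / real (Suc n)"])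
  show "\<forall>\<^sub>F n in sequentially. upper_grid n r \<le> r + 1 / real (Suc n)"
  proof (rule always_eventually, rule allI)
    fix n
    have "of_int \<lfloor>real (Suc n) * r\<rfloor> + 1 \<le> real (Suc n) * r + 1" by linarith
    then have "upper_grid n r \<le> (real (Suc n) * r + 1) / real (Suc n)"
      unfolding upper_grid_def by (intro divide_right_mono) auto
    then show "upper_grid n r \<le> r + 1 / real (Suc n)" by (simp add: add_divide_distrib del: of_nat_Suc)
  qed
  have "(\<lambda>n. r + 1 / real (Suc n)) \<longlonglongrightarrow> r + 0"
    by (intro tendsto_add tendsto_const LIMSEQ_Suc lim_1_over_n)
  then show "(\<lambda>n. r + 1 / real (Suc n)) \<longlonglongrightarrow> r" by simp
qed (auto simp: upper_grid_ge)

lemma upper_grid_clamp_tendsto: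
  assumes "c = (\<lambda>r. max a (min b r))"
  shows "(\<lambda>n. c (upper_grid n r)) \<longlonglongrightarrow> c r" "c r \<le> c (upper_grid n r)"
  using upper_grid_ge[of r n] unfolding assms by (auto intro!: tendsto_intros upper_grid_tendsto)

text \<open>The grid time depends on \<open>r x\<close> only through an integer, so measurability
  splits into countably many cases with a fixed time \<open>c\<close>.\<close>

lemma measurable_upper_grid_compose:
  assumes "\<And>c. (\<lambda>x. h c x) \<in> measurable M N" and r[measurable]: "r \<in> borel_measurable M"
  shows "(\<lambda>x. h (upper_grid n (r x)) x) \<in> measurable M N"
proof -
  have "(\<lambda>x. (\<lambda>i x. h ((of_int i + 1) / real (Suc n)) x) \<lfloor>real (Suc n) * r x\<rfloor> x) \<in> measurable M N"
    by (rule measurable_compose_countable) (use assms(1) in auto)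
  then show ?thesis unfolding upper_grid_def .
qed

section \<open>Path space\<close>

lemma path_sigma_gen_subset: "{{\<omega> \<in> path_space T. \<omega> r \<in> A} | r A. r \<in> I \<and> A \<in> sets borel} \<subseteq> Pow (path_space T)"
  by auto

lemma space_path_sigma[simp]: "space (path_sigma T I) = path_space T"
  unfolding path_sigma_def by (simp add: space_measure_of_conv)

lemma sets_path_sigma:
  "sets (path_sigma T I) = sigma_sets (path_space T) {{\<omega> \<in> path_space T. \<omega> r \<in> A} | r A. r \<in> I \<and> A \<in> sets borel}"
  unfolding path_sigma_def by (rule sets_measure_of[OF path_sigma_gen_subset])

lemma sets_path_sigma_mono: "I \<subseteq> J \<Longrightarrow> sets (path_sigma T I) \<subseteq> sets (path_sigma T J)"
  unfolding sets_path_sigma by (intro sigma_sets_mono') blast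

lemma measurable_eval:
  assumes "r \<in> I"
  shows "(\<lambda>\<omega>. \<omega> r) \<in> borel_measurable (path_sigma T I)"
proof (rule measurableI)
  fix A :: "'a set" assume "A \<in> sets borel"
  then have "{\<omega> \<in> path_space T. \<omega> r \<in> A} \<in> sets (path_sigma T I)"
    unfolding sets_path_sigma using assms by (intro sigma_sets.Basic) blast
  moreover have "(\<lambda>\<omega>. \<omega> r) -` A \<inter> space (path_sigma T I) = {\<omega> \<in> path_space T. \<omega> r \<in> A}" by auto
  ultimately show "(\<lambda>\<omega>. \<omega> r) -` A \<inter> space (path_sigma T I) \<in> sets (path_sigma T I)" by simp
qed auto

lemma path_right_continuous:
  "\<omega> \<in> path_space T \<Longrightarrow> 0 \<le> t \<Longrightarrow> t < T \<Longrightarrow> (\<omega> \<longlongrightarrow> \<omega> t) (at_right t)"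
  by (auto simp: path_space_def cadlag_on_def)

lemma path_tendsto_from_right:
  assumes "\<omega> \<in> path_space T" "0 \<le> a" "a \<le> T" "x \<longlonglongrightarrow> a" "\<And>n. a \<le> x n" "\<And>n. x n \<le> T"
  shows "(\<lambda>n. \<omega> (x n)) \<longlonglongrightarrow> \<omega> a"
proof (cases "a < T")
  case True
  show ?thesis by (rule tendsto_right_sequence[OF path_right_continuous[OF assms(1,2) True] assms(4,5)])
next
  case False
  then have "x n = a" for n using assms(3) assms(5)[of n] assms(6)[of n] by linarith
  then show ?thesis by simp
qed

text \<open>Progressive measurability. Clamping keeps the grid times, which lie to the right of
  \<open>r\<close>, from exceeding \<open>t\<close>, so the approximations use the path up to time
  \<open>t\<close> only.\<close>

lemma measurable_eval_joint:
  assumes t: "0 \<le> t" "t \<le> T"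
  shows "(\<lambda>(r, \<omega>). \<omega> (max 0 (min t r))) \<in> borel_measurable (borel \<Otimes>\<^sub>M path_sigma T {0..t})"
proof (rule borel_measurable_LIMSEQ_metric)
  let ?c = "\<lambda>r::real. max 0 (min t r)"
  let ?M = "(borel :: real measure) \<Otimes>\<^sub>M (path_sigma T {0..t} :: (real \<Rightarrow> 'a) measure)"
  show "(\<lambda>(r, \<omega>). \<omega> (?c (upper_grid n r))) \<in> borel_measurable ?M" for n
  proof -
    have *: "(\<lambda>z. snd z (?c c)) \<in> borel_measurable ?M" for c
      by (rule measurable_compose[OF measurable_snd measurable_eval]) (use t in auto)
    have "(\<lambda>z. snd z (?c (upper_grid n (fst z)))) \<in> borel_measurable ?M"
      by (rule measurable_upper_grid_compose[OF *, where r=fst and n=n]) simp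
    then show ?thesis by (simp add: case_prod_beta')
  qed
  fix z assume "z \<in> space ?M"
  then obtain r \<omega> where z: "z = (r, \<omega>)" "\<omega> \<in> path_space T" by (auto simp: space_pair_measure)
  have "(\<lambda>n. \<omega> (?c (upper_grid n r))) \<longlonglongrightarrow> \<omega> (?c r)"
    by (rule path_tendsto_from_right[OF z(2) _ _ upper_grid_clamp_tendsto[OF refl]]) (use t in auto)
  then show "(\<lambda>n. case z of (r, \<omega>) \<Rightarrow> \<omega> (?c (upper_grid n r))) \<longlonglongrightarrow> (case z of (r, \<omega>) \<Rightarrow> \<omega> (?c r))"
    by (simp add: z)
qed

lemma space_path_filtration[simp]: "space (path_filtration T t) = path_space T"
  unfolding path_filtration_def by (simp add: space_measure_of_conv)

text \<open>An intersection of sigma-algebras on the same space is one already, so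
  \<open>sigma\<close> adds nothing.\<close>

lemma sets_path_filtration:
  assumes "0 \<le> t" "t < T"
  shows "sets (path_filtration T t :: (real \<Rightarrow> 'a::polish_space) measure) = (\<Inter>s\<in>{t<..T}. sets (path_sigma T {0..s}))"
proof -
  let ?A = "\<Inter>s\<in>{t<..T}. sets (path_sigma T {0..s} :: (real \<Rightarrow> 'a) measure)"
  have sub: "?A \<subseteq> Pow (path_space T)"
    using sets.space_closed[of "path_sigma T {0..T}"] assms by fastforce
  have "sigma_sets (path_space T) ?A \<subseteq> sets (path_sigma T {0..s})" if "s \<in> {t<..T}" for s
    by (rule sets.sigma_sets_subset[of _ "path_sigma T {0..s}", unfolded space_path_sigma]) (use that in blast)
  then have "sigma_sets (path_space T) ?A \<subseteq> ?A" by (rule INT_greatest)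
  then have "sigma_sets (path_space T) ?A = ?A" using sigma_sets.Basic by blast
  then show ?thesis unfolding path_filtration_def using assms(2) sub by (simp add: sets_measure_of)
qed

lemma sets_path_filtration_T: "t \<ge> T \<Longrightarrow> sets (path_filtration T t) = sets (path_sigma T {0..T})"
  unfolding path_filtration_def by auto

lemma path_sigma_subset_filtration:
  assumes "0 \<le> t" "t \<le> T"
  shows "sets (path_sigma T {0..t}) \<subseteq> sets (path_filtration T t)"
proof (cases "t < T")
  case True
  show ?thesis unfolding sets_path_filtration[OF assms(1) True]
    by (intro INT_greatest sets_path_sigma_mono) auto
qed (use assms in \<open>auto simp: sets_path_filtration_T\<close>)

lemma path_filtration_subset_sigma:
  assumes "0 \<le> t" "t < s" "s \<le> T"
  shows "sets (path_filtration T t) \<subseteq> sets (path_sigma T {0..s})"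
  using assms by (subst sets_path_filtration) auto

lemma measurable_path_filtration:
  "0 \<le> t \<Longrightarrow> t \<le> T \<Longrightarrow> f \<in> measurable (path_sigma T {0..t}) N \<Longrightarrow> f \<in> measurable (path_filtration T t) N"
  using path_sigma_subset_filtration[of t T] unfolding measurable_def by auto

lemma path_filtration_right_continuous:
  assumes t: "t \<in> {0..<T}" and X: "\<And>s. s \<in> {t<..T} \<Longrightarrow> X \<in> measurable (path_filtration T s) N"
  shows "X \<in> measurable (path_filtration T t) N"
proof (rule measurableI)
  show "X \<omega> \<in> space N" if "\<omega> \<in> space (path_filtration T t)" for \<omega>
    using measurable_space[OF X[of T]] t that by auto
  fix A assume A: "A \<in> sets N"
  show "X -` A \<inter> space (path_filtration T t) \<in> sets (path_filtration T t)"
  proof (subst sets_path_filtration)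
    show "X -` A \<inter> space (path_filtration T t) \<in> (\<Inter>s\<in>{t<..T}. sets (path_sigma T {0..s}))"
    proof
      fix s assume s: "s \<in> {t<..T}"
      \<comment> \<open>The midpoint lies strictly before \<open>s\<close>, so the right-limit
        sigma-algebra there is still contained in the one generated up to \<open>s\<close>.\<close>
      have "X -` A \<inter> path_space T \<in> sets (path_filtration T ((t + s) / 2))"
        using measurable_sets[OF X A, of "(t + s) / 2"] s t by auto
      then show "X -` A \<inter> space (path_filtration T t) \<in> sets (path_sigma T {0..s})"
        using path_filtration_subset_sigma[of "(t + s) / 2" s T] s t by auto
    qed
  qed (use t in auto)
qed

lemma filtered_path_space:
  assumes "prob_space Q" "sets Q = sets (path_sigma T {0..T})" "0 < T"
  shows "filtered_prob_space Q (path_filtration T) T"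
proof (intro filtered_prob_space.intro filtered_prob_space_axioms.intro assms(1,3))
  have sp: "space Q = path_space T" using sets_eq_imp_space_eq[OF assms(2)] by simp
  have le: "sets (path_filtration T t) \<subseteq> sets (path_sigma T {0..T})" if "t \<in> {0..T}" for t
    using path_filtration_subset_sigma[of t T T] sets_path_filtration_T[of T t] that by (cases "t < T") auto
  fix t assume "t \<in> {0..T}"
  then show "subalgebra Q (path_filtration T t)"
    using le[of t] unfolding subalgebra_def assms(2) sp by simp
next
  fix r t :: real assume rt: "0 \<le> r" "r \<le> t" "t \<le> T"
  show "sets (path_filtration T r) \<subseteq> sets (path_filtration T t)"
  proof (cases "r < t")
    case True
    show ?thesis
      by (rule subset_trans[OF path_filtration_subset_sigma path_sigma_subset_filtration]) (use rt True in auto)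
  qed (use rt in auto)
qed

text \<open>Cutting off at the time interval discards arbitrary values elsewhere and gives a Borel
  function on the whole product, so that restricted spaces no longer occur.\<close>

lemma borel_funs_measurable:
  assumes "\<phi> \<in> borel_funs T"
  shows "(\<lambda>(r, y). indicator {0..T} r * \<phi> r y) \<in> borel_measurable (borel \<Otimes>\<^sub>M borel)"
proof -
  have S: "{0..T} \<times> UNIV \<inter> space borel \<in> sets (borel :: (real \<times> 'a) measure)"
    by (auto intro!: borel_closed closed_Times)
  have "(\<lambda>z. (case z of (t, x) \<Rightarrow> \<phi> t x) * indicator ({0..T} \<times> UNIV) z) \<in> borel_measurable borel"
    using assms unfolding borel_funs_def mem_Collect_eq borel_measurable_restrict_space_iff[OF S] by (simp add: mult.commute)
  then show ?thesis unfolding borel_prod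
    by (rule measurable_cong[THEN iffD1, rotated]) (auto simp: indicator_def)
qed

lemma measurable_path_process:
  assumes \<phi>: "\<phi> \<in> borel_funs T" and ab: "0 \<le> a" "0 \<le> b" "b \<le> T"
  shows "(\<lambda>(r, \<omega>). indicator {a..b} r * \<phi> r (\<omega> r)) \<in> borel_measurable (borel \<Otimes>\<^sub>M path_sigma T {0..b})"
proof -
  let ?M = "(borel :: real measure) \<Otimes>\<^sub>M (path_sigma T {0..b} :: (real \<Rightarrow> 'a) measure)"
  have "(\<lambda>z. (fst z, (\<lambda>(r, \<omega>). \<omega> (max 0 (min b r))) z)) \<in> measurable ?M (borel \<Otimes>\<^sub>M borel)"
    by (rule measurable_Pair[OF measurable_fst measurable_eval_joint[OF ab(2,3)]])
  from measurable_compose[OF this borel_funs_measurable[OF \<phi>]]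
  have "(\<lambda>z. indicator {0..T} (fst z) * \<phi> (fst z) (snd z (max 0 (min b (fst z))))) \<in> borel_measurable ?M"
    by (simp add: case_prod_beta')
  moreover have "(\<lambda>z. indicat_real {a..b} (fst z)) \<in> borel_measurable ?M"
    by (rule measurable_compose[OF measurable_fst]) simp
  ultimately have "(\<lambda>z. indicat_real {a..b} (fst z) * (indicator {0..T} (fst z) * \<phi> (fst z) (snd z (max 0 (min b (fst z))))))
      \<in> borel_measurable ?M" (is "?f \<in> _")
    by (rule borel_measurable_times[rotated])
  moreover have "?f = (\<lambda>(r, \<omega>). indicator {a..b} r * \<phi> r (\<omega> r))"
    using ab by (auto simp: fun_eq_iff indicator_def max_def min_def)
  ultimately show ?thesis by simp
qed

lemma measurable_path_integral:
  assumes \<phi>: "\<phi> \<in> borel_funs T" and ab: "0 \<le> a" "0 \<le> b" "b \<le> T"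
  shows "(\<lambda>\<omega>. LBINT r:{a..b}. \<phi> r (\<omega> r)) \<in> borel_measurable (path_sigma T {0..b})"
proof -
  have "(\<lambda>(\<omega>, r). indicator {a..b} r * \<phi> r (\<omega> r)) \<in> borel_measurable (path_sigma T {0..b} \<Otimes>\<^sub>M lborel)"
    using measurable_compose[OF measurable_pair_swap' measurable_path_process[OF assms]]
    by (simp add: case_prod_beta' cong: measurable_cong_sets sets_pair_measure_cong)
  from lborel.borel_measurable_lebesgue_integral[OF this]
  show ?thesis unfolding set_lebesgue_integral_def by simp
qed

section \<open>The Markov property\<close>

locale markov_class =
  fixes T :: real and p :: "real \<Rightarrow> 'e::polish_space \<Rightarrow> real \<Rightarrow> 'e measure"
    and P :: "real \<Rightarrow> 'e \<Rightarrow> (real \<Rightarrow> 'e) measure"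
  assumes T_pos: "0 < T"
    and transition: "transition_function T p"
    and markov: "markov_canonical_class T p P"
begin

lemma prob_P: "s \<in> {0..T} \<Longrightarrow> prob_space (P s x)"
  and sets_P: "s \<in> {0..T} \<Longrightarrow> sets (P s x) = sets (path_sigma T {0..T})"
  and law_P: "s \<in> {0..T} \<Longrightarrow> t \<in> {0..T} \<Longrightarrow> A \<in> sets borel \<Longrightarrow>
    measure (P s x) {\<omega> \<in> space (P s x). \<omega> t \<in> A} = measure (p s x t) A"
  and markov_P: "s \<in> {0..T} \<Longrightarrow> t \<in> {s..T} \<Longrightarrow> u \<in> {t..T} \<Longrightarrow> A \<in> sets borel \<Longrightarrow>
    AE \<omega> in P s x. real_cond_exp (P s x) (path_filtration T t) (\<lambda>\<omega>'. indicator A (\<omega>' u)) \<omega>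
      = measure (p t (\<omega> t) u) A"
  using markov unfolding markov_canonical_class_def by blast+

lemma space_P: "s \<in> {0..T} \<Longrightarrow> space (P s x) = path_space T"
  using sets_eq_imp_space_eq[OF sets_P] by simp

lemma measurable_P_cong: "s \<in> {0..T} \<Longrightarrow> measurable (P s x) N = measurable (path_sigma T {0..T}) N"
  by (rule measurable_cong_sets[OF sets_P refl])

lemma eval_P: "s \<in> {0..T} \<Longrightarrow> t \<in> {0..T} \<Longrightarrow> (\<lambda>\<omega>. \<omega> t) \<in> borel_measurable (P s x)"
  unfolding measurable_P_cong by (rule measurable_eval)

lemma prob_p: "s \<in> {0..T} \<Longrightarrow> t \<in> {0..T} \<Longrightarrow> prob_space (p s x t)"
  and sets_p: "s \<in> {0..T} \<Longrightarrow> t \<in> {0..T} \<Longrightarrow> sets (p s x t) = sets borel"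
  and measurable_p: "s \<in> {0..T} \<Longrightarrow> t \<in> {0..T} \<Longrightarrow> A \<in> sets borel \<Longrightarrow> (\<lambda>x. measure (p s x t) A) \<in> borel_measurable borel"
  and p_diag: "s \<in> {0..T} \<Longrightarrow> t \<in> {0..T} \<Longrightarrow> A \<in> sets borel \<Longrightarrow> t \<le> s \<Longrightarrow> measure (p s x t) A = indicator A x"
  using transition unfolding transition_function_def by blast+

lemma distr_P: "distr (P s x) borel (\<lambda>\<omega>. \<omega> t) = p s x t" if st: "s \<in> {0..T}" "t \<in> {0..T}"
proof (rule measure_eqI)
  interpret Q: prob_space "P s x" by (rule prob_P[OF st(1)])
  interpret p: prob_space "p s x t" by (rule prob_p[OF st])
  show "sets (distr (P s x) borel (\<lambda>\<omega>. \<omega> t)) = sets (p s x t)" by (simp add: sets_p[OF st])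
  fix A assume "A \<in> sets (distr (P s x) borel (\<lambda>\<omega>. \<omega> t))"
  then have A: "A \<in> sets borel" by simp
  have "emeasure (distr (P s x) borel (\<lambda>\<omega>. \<omega> t)) A = emeasure (P s x) {\<omega> \<in> space (P s x). \<omega> t \<in> A}"
    using eval_P[OF st] A by (subst emeasure_distr) (auto intro!: arg_cong[where f="emeasure _"])
  then show "emeasure (distr (P s x) borel (\<lambda>\<omega>. \<omega> t)) A = emeasure (p s x t) A"
    using law_P[OF st A] by (simp add: Q.emeasure_eq_measure p.emeasure_eq_measure)
qed

lemma kernel_p: "t \<in> {0..T} \<Longrightarrow> q \<in> {0..T} \<Longrightarrow> (\<lambda>y. p t y q) \<in> measurable borel (subprob_algebra borel)"
proof (rule measurable_subprob_algebra)
  fix A :: "'e set" assume tq: "t \<in> {0..T}" "q \<in> {0..T}" and A: "A \<in> sets borel"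
  have "(\<lambda>y. ennreal (measure (p t y q) A)) \<in> borel_measurable borel"
    by (intro measurable_compose[OF measurable_p measurable_ennreal] tq A)
  then show "(\<lambda>y. emeasure (p t y q) A) \<in> borel_measurable borel"
    using prob_p[OF tq] by (simp add: prob_space_def finite_measure.emeasure_eq_measure)
qed (auto simp: sets_p prob_p prob_space_imp_subprob_space)

lemma nn_integral_eval:
  assumes "s \<in> {0..T}" "t \<in> {0..T}" "h \<in> borel_measurable borel"
  shows "(\<integral>\<^sup>+\<omega>. h (\<omega> t) \<partial>P s x) = (\<integral>\<^sup>+y. h y \<partial>p s x t)"
  unfolding distr_P[OF assms(1,2), symmetric] using eval_P[OF assms(1,2)] assms(3) by (simp add: nn_integral_distr)

lemma filtered_P: "s \<in> {0..T} \<Longrightarrow> filtered_prob_space (P s x) (path_filtration T) T"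
  by (rule filtered_path_space[OF prob_P sets_P T_pos])

lemma AE_start:
  assumes s: "s \<in> {0..T}"
  shows "AE \<omega> in P s x. \<omega> s = x"
proof -
  interpret Q: prob_space "P s x" by (rule prob_P[OF s])
  have "measure (P s x) {\<omega> \<in> space (P s x). \<omega> s \<in> {x}} = 1"
    using law_P[OF s s, of "{x}"] p_diag[OF s s, of "{x}"] by simp
  then show ?thesis by (subst (asm) Q.prob_Collect_eq_1) (use eval_P[OF s s] in auto)
qed

text \<open>For an indicator \<open>h\<close> this is the defining property integrated over
  \<open>A\<close>. It then says that two measures coincide, the law of \<open>\<omega> q\<close> on
  \<open>A\<close> and the law of \<open>\<omega> t\<close> on \<open>A\<close> pushed through the
  kernel, and equal measures integrate every nonnegative \<open>h\<close> alike.\<close>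

lemma markov_single_time:
  assumes s: "s \<in> {0..T}" and t: "t \<in> {s..T}" and q: "q \<in> {t..T}"
    and A: "A \<in> sets (path_filtration T t)" and h: "h \<in> borel_measurable borel"
  shows "(\<integral>\<^sup>+\<omega>. indicator A \<omega> * h (\<omega> q) \<partial>P s x)
    = (\<integral>\<^sup>+\<omega>. indicator A \<omega> * (\<integral>\<^sup>+\<omega>'. h (\<omega>' q) \<partial>P t (\<omega> t)) \<partial>P s x)"
proof -
  interpret filtered_prob_space "P s x" "path_filtration T" T by (rule filtered_P[OF s])
  have t0: "t \<in> {0..T}" and q0: "q \<in> {0..T}" using s t q by auto
  interpret S: finite_measure_subalgebra "P s x" "path_filtration T t" by (rule fin_subalg[OF t0])
  have A_Q[measurable]: "A \<in> sets (P s x)" using sets_F_M[OF t0 A] .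
  note [measurable] = eval_P[OF s t0] eval_P[OF s q0] kernel_p[OF t0 q0] h
  define N0 where "N0 = density (P s x) (indicator A)"
  define N1 where "N1 = distr N0 borel (\<lambda>\<omega>. \<omega> q)"
  define N2 where "N2 = distr N0 borel (\<lambda>\<omega>. \<omega> t) \<bind> (\<lambda>y. p t y q)"
  have [measurable_cong]: "sets N0 = sets (P s x)" by (simp add: N0_def)
  have N1: "(\<integral>\<^sup>+y. k y \<partial>N1) = (\<integral>\<^sup>+\<omega>. indicator A \<omega> * k (\<omega> q) \<partial>P s x)" if [measurable]: "k \<in> borel_measurable borel" for k
    unfolding N1_def N0_def by (subst nn_integral_distr) (auto simp: nn_integral_density)
  have N2: "(\<integral>\<^sup>+y. k y \<partial>N2) = (\<integral>\<^sup>+\<omega>. indicator A \<omega> * (\<integral>\<^sup>+y. k y \<partial>p t (\<omega> t) q) \<partial>P s x)" if [measurable]: "k \<in> borel_measurable borel" for k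
  proof -
    have m: "(\<lambda>y. \<integral>\<^sup>+z. k z \<partial>p t y q) \<in> borel_measurable borel"
      by (rule measurable_compose[OF kernel_p[OF t0 q0] nn_integral_measurable_subprob_algebra]) fact
    have "(\<integral>\<^sup>+y. k y \<partial>N2) = (\<integral>\<^sup>+y. \<integral>\<^sup>+z. k z \<partial>p t y q \<partial>distr N0 borel (\<lambda>\<omega>. \<omega> t))"
      unfolding N2_def by (rule nn_integral_bind[where B=borel]) auto
    also have "\<dots> = (\<integral>\<^sup>+\<omega>. (\<integral>\<^sup>+z. k z \<partial>p t (\<omega> t) q) \<partial>N0)"
      by (rule nn_integral_distr) (use m in auto)
    also have "\<dots> = (\<integral>\<^sup>+\<omega>. indicator A \<omega> * (\<integral>\<^sup>+y. k y \<partial>p t (\<omega> t) q) \<partial>P s x)"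
      unfolding N0_def by (rule nn_integral_density) (use measurable_compose[OF eval_P[OF s t0] m] in auto)
    finally show ?thesis .
  qed
  have "N1 = N2"
  proof (rule measure_eqI)
    show "sets N1 = sets N2"
      unfolding N1_def N2_def by (subst sets_bind[where N=borel]) (simp_all add: sets_p[OF t0 q0])
    fix B assume "B \<in> sets N1"
    then have B[measurable]: "B \<in> sets borel" by (simp add: N1_def)
    have B2: "B \<in> sets N2" using \<open>sets N1 = sets N2\<close> \<open>B \<in> sets N1\<close> by simp
    have m1: "(\<lambda>\<omega>. indicat_real B (\<omega> q)) \<in> borel_measurable (P s x)" by measurable
    have m2: "(\<lambda>\<omega>. measure (p t (\<omega> t) q) B) \<in> borel_measurable (P s x)"
      by (rule measurable_compose[OF eval_P[OF s t0] measurable_p[OF t0 q0 B]])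
    have le1: "measure (p t y q) B \<le> 1" for y using prob_space.prob_le_1[OF prob_p[OF t0 q0]] .
    have i1: "integrable (P s x) (\<lambda>\<omega>. indicat_real A \<omega> * indicat_real B (\<omega> q))"
      by (rule integrable_const_bound[where B=1]) (auto simp: indicator_def)
    have i2: "integrable (P s x) (\<lambda>\<omega>. indicat_real A \<omega> * measure (p t (\<omega> t) q) B)"
      by (rule integrable_const_bound[where B=1]) (use m2 le1 in \<open>auto simp: indicator_def\<close>)
    have iB: "integrable (P s x) (\<lambda>\<omega>. indicat_real B (\<omega> q))"
      by (rule integrable_const_bound[where B=1]) (auto simp: indicator_def)
    have "(\<integral>\<omega>. indicat_real A \<omega> * indicat_real B (\<omega> q) \<partial>P s x) = (\<integral>\<omega>. indicat_real A \<omega> * measure (p t (\<omega> t) q) B \<partial>P s x)"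
    proof -
      have "(\<integral>\<omega>\<in>A. indicat_real B (\<omega> q) \<partial>P s x)
        = (\<integral>\<omega>\<in>A. real_cond_exp (P s x) (path_filtration T t) (\<lambda>\<omega>'. indicat_real B (\<omega>' q)) \<omega> \<partial>P s x)"
        by (rule S.real_cond_exp_intA[OF iB A])
      also have "\<dots> = (\<integral>\<omega>\<in>A. measure (p t (\<omega> t) q) B \<partial>P s x)"
        unfolding set_lebesgue_integral_def
      proof (rule integral_cong_AE)
        show "AE \<omega> in P s x. indicat_real A \<omega> *\<^sub>R real_cond_exp (P s x) (path_filtration T t) (\<lambda>\<omega>'. indicat_real B (\<omega>' q)) \<omega>
            = indicat_real A \<omega> *\<^sub>R measure (p t (\<omega> t) q) B"
          using markov_P[OF s t q B] by eventually_elim simp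
        show "(\<lambda>\<omega>. indicat_real A \<omega> *\<^sub>R real_cond_exp (P s x) (path_filtration T t) (\<lambda>\<omega>'. indicat_real B (\<omega>' q)) \<omega>) \<in> borel_measurable (P s x)"
          by (intro borel_measurable_scaleR borel_measurable_cond_exp2) auto
      qed (use m2 in auto)
      finally show ?thesis by (simp add: set_lebesgue_integral_def)
    qed
    then have eq: "(\<integral>\<^sup>+\<omega>. ennreal (indicat_real A \<omega> * indicat_real B (\<omega> q)) \<partial>P s x) = (\<integral>\<^sup>+\<omega>. ennreal (indicat_real A \<omega> * measure (p t (\<omega> t) q) B) \<partial>P s x)"
      using i1 i2 by (simp add: nn_integral_eq_integral)
    have "emeasure N1 B = (\<integral>\<^sup>+\<omega>. indicator A \<omega> * indicator B (\<omega> q) \<partial>P s x)"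
      using N1[of "indicator B"] by (simp add: N1_def)
    also have "\<dots> = (\<integral>\<^sup>+\<omega>. ennreal (indicat_real A \<omega> * indicat_real B (\<omega> q)) \<partial>P s x)"
      by (intro nn_integral_cong) (auto simp: indicator_def)
    also have "\<dots> = (\<integral>\<^sup>+\<omega>. indicator A \<omega> * (\<integral>\<^sup>+y. indicator B y \<partial>p t (\<omega> t) q) \<partial>P s x)"
      unfolding eq
    proof (intro nn_integral_cong)
      fix \<omega>
      interpret p: prob_space "p t (\<omega> t) q" by (rule prob_p[OF t0 q0])
      have "B \<in> sets (p t (\<omega> t) q)" by (simp add: sets_p[OF t0 q0])
      then show "ennreal (indicat_real A \<omega> * measure (p t (\<omega> t) q) B) = indicator A \<omega> * (\<integral>\<^sup>+y. indicator B y \<partial>p t (\<omega> t) q)"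
        by (cases "\<omega> \<in> A") (simp_all add: p.emeasure_eq_measure)
    qed
    also have "\<dots> = emeasure N2 B" using N2[of "indicator B"] B2 by simp
    finally show "emeasure N1 B = emeasure N2 B" .
  qed
  then show ?thesis
    using N1[OF h] N2[OF h] nn_integral_eval[OF t0 q0 h] by simp
qed

text \<open>The time is clamped to \<open>{t..T}\<close> so that this is a total kernel in the pair
  of time and starting point.\<close>

definition law_at :: "real \<Rightarrow> real \<times> 'e \<Rightarrow> 'e measure" where
  "law_at t z = distr (P t (snd z)) borel (\<lambda>\<omega>. \<omega> (max t (min T (fst z))))"

text \<open>
  Joint measurability in time and starting point: against bounded continuous functions the law is
  right-continuous in time, and indicators of closed sets are limits of such functions.
\<close>

lemma kernel_law_at:
  assumes t: "t \<in> {0..T}"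
  shows "law_at t \<in> measurable (borel \<Otimes>\<^sub>M borel) (subprob_algebra borel)"
proof (rule measurable_subprob_algebra_generated[where \<Omega>=UNIV and G="Collect closed"])
  let ?c = "\<lambda>q. max t (min T q)"
  let ?M = "(borel :: real measure) \<Otimes>\<^sub>M (borel :: 'e measure)"
  have c_in: "?c q \<in> {0..T}" for q using t by auto
  note ev = eval_P[OF t c_in]
  show "sets (borel :: 'e measure) = sigma_sets UNIV (Collect closed)" by (simp add: borel_eq_closed)
  show "Int_stable (Collect (closed :: 'e set \<Rightarrow> bool))" by (auto simp: Int_stable_def)
  show "subprob_space (law_at t z)" for z
    unfolding law_at_def using ev by (intro prob_space_imp_subprob_space prob_space.prob_space_distr prob_P t)
  show "sets (law_at t z) = sets borel" for z by (simp add: law_at_def)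
  have em: "emeasure (law_at t z) C = ennreal (\<integral>\<omega>. indicat_real C (\<omega> (?c (fst z))) \<partial>P t (snd z))" if [measurable]: "C \<in> sets borel" for C z
  proof -
    interpret Q: prob_space "P t (snd z)" by (rule prob_P[OF t])
    note [measurable] = ev
    have "emeasure (law_at t z) C = (\<integral>\<^sup>+y. indicator C y \<partial>law_at t z)"
      by (simp add: law_at_def)
    also have "\<dots> = (\<integral>\<^sup>+\<omega>. ennreal (indicat_real C (\<omega> (?c (fst z)))) \<partial>P t (snd z))"
      unfolding law_at_def by (subst nn_integral_distr) (auto simp: ennreal_indicator)
    also have "\<dots> = ennreal (\<integral>\<omega>. indicat_real C (\<omega> (?c (fst z))) \<partial>P t (snd z))"
      by (intro nn_integral_eq_integral Q.integrable_const_bound[where B=1]) auto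
    finally show ?thesis .
  qed
  have cont: "(\<lambda>z. \<integral>\<omega>. k (\<omega> (?c (fst z))) \<partial>P t (snd z)) \<in> borel_measurable ?M"
    if k: "continuous_on UNIV k" "\<And>y. \<bar>k y\<bar> \<le> 1" for k :: "'e \<Rightarrow> real"
  proof (rule borel_measurable_LIMSEQ_real)
    have km[measurable]: "k \<in> borel_measurable borel" using k(1) by (rule borel_measurable_continuous_onI)
    show "(\<lambda>z. \<integral>\<omega>. k (\<omega> (?c (upper_grid n (fst z)))) \<partial>P t (snd z)) \<in> borel_measurable ?M" for n
    proof (rule measurable_upper_grid_compose[where r=fst])
      fix c :: real
      have "(\<lambda>y. \<integral>z. k z \<partial>p t y (?c c)) \<in> borel_measurable borel"
        by (rule measurable_compose[OF kernel_p[OF t c_in] integral_measurable_subprob_algebra]) simp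
      moreover have "(\<integral>\<omega>. k (\<omega> (?c c)) \<partial>P t y) = (\<integral>z. k z \<partial>p t y (?c c))" for y
        unfolding distr_P[OF t c_in, symmetric] by (rule integral_distr[OF ev, symmetric]) simp
      ultimately show "(\<lambda>z. \<integral>\<omega>. k (\<omega> (?c c)) \<partial>P t (snd z)) \<in> borel_measurable ?M" by simp
    qed simp
    fix z :: "real \<times> 'e"
    interpret Q: prob_space "P t (snd z)" by (rule prob_P[OF t])
    note [measurable] = ev
    show "(\<lambda>n. \<integral>\<omega>. k (\<omega> (?c (upper_grid n (fst z)))) \<partial>P t (snd z)) \<longlonglongrightarrow> (\<integral>\<omega>. k (\<omega> (?c (fst z))) \<partial>P t (snd z))"
    proof (rule integral_dominated_convergence[where w="\<lambda>_. 1"])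
      show "AE \<omega> in P t (snd z). (\<lambda>n. k (\<omega> (?c (upper_grid n (fst z))))) \<longlonglongrightarrow> k (\<omega> (?c (fst z)))"
      proof (rule AE_I2)
        fix \<omega> assume "\<omega> \<in> space (P t (snd z))"
        then have "(\<lambda>n. \<omega> (?c (upper_grid n (fst z)))) \<longlonglongrightarrow> \<omega> (?c (fst z))"
          by (intro path_tendsto_from_right[OF _ _ _ upper_grid_clamp_tendsto[OF refl]]) (use t in \<open>auto simp: space_P\<close>)
        then show "(\<lambda>n. k (\<omega> (?c (upper_grid n (fst z))))) \<longlonglongrightarrow> k (\<omega> (?c (fst z)))"
          by (rule continuous_on_tendsto_compose[OF k(1)]) auto
      qed
    qed (use k(2) in auto)
  qed
  show cl: "(\<lambda>z. emeasure (law_at t z) C) \<in> borel_measurable ?M" if "C \<in> Collect closed" for C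
  \<comment> \<open>The distance \<open>infdist\<close> to the empty set is 0 by convention, so the
    functions used below would tend to 1 instead of 0.\<close>
  proof (cases "C = {}")
    case False
    have C: "closed C" and [measurable]: "C \<in> sets borel" using that by auto
    have "(\<lambda>z. \<integral>\<omega>. indicat_real C (\<omega> (?c (fst z))) \<partial>P t (snd z)) \<in> borel_measurable ?M"
    proof (rule borel_measurable_LIMSEQ_real)
      let ?k = "\<lambda>n y. max 0 (1 - real n * infdist y C)"
      have k: "continuous_on UNIV (?k n)" "\<bar>?k n y\<bar> \<le> 1" for n y
        by (auto intro!: continuous_intros simp: infdist_nonneg)
      show "(\<lambda>z. \<integral>\<omega>. ?k n (\<omega> (?c (fst z))) \<partial>P t (snd z)) \<in> borel_measurable ?M" for n
        by (rule cont[OF k])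
      fix z :: "real \<times> 'e"
      interpret Q: prob_space "P t (snd z)" by (rule prob_P[OF t])
      note [measurable] = ev
      have [measurable]: "?k n \<in> borel_measurable borel" for n using k(1) by (rule borel_measurable_continuous_onI)
      show "(\<lambda>n. \<integral>\<omega>. ?k n (\<omega> (?c (fst z))) \<partial>P t (snd z)) \<longlonglongrightarrow> (\<integral>\<omega>. indicat_real C (\<omega> (?c (fst z))) \<partial>P t (snd z))"
      proof (rule integral_dominated_convergence[where w="\<lambda>_. 1"])
        have "(\<lambda>n. ?k n y) \<longlonglongrightarrow> indicat_real C y" for y
        proof (cases "y \<in> C")
          case True
          then show ?thesis by simp
        next
          case n: False
          then have pos: "0 < infdist y C" using C False infdist_pos_not_in_closed by blast
          obtain n0 :: nat where n0: "1 / infdist y C < real n0" using reals_Archimedean2 by blast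
          have "?k n y = 0" if "n \<ge> n0" for n
          proof -
            have "1 / infdist y C \<le> real n" using n0 that by linarith
            then have "1 \<le> real n * infdist y C" using pos by (simp add: divide_le_eq)
            then show ?thesis by simp
          qed
          then have "\<forall>\<^sub>F n in sequentially. ?k n y = indicat_real C y" using n eventually_sequentially by auto
          then show ?thesis by (rule tendsto_eventually)
        qed
        then show "AE \<omega> in P t (snd z). (\<lambda>n. ?k n (\<omega> (?c (fst z)))) \<longlonglongrightarrow> indicat_real C (\<omega> (?c (fst z)))"
          by auto
      qed (use k(2) in auto)
    qed
    then show ?thesis by (simp add: em)
  qed simp
  show "(\<lambda>z. emeasure (law_at t z) UNIV) \<in> borel_measurable ?M" by (rule cl) simp
qed simp

end

section \<open>The Markov property for additive functionals\<close>

lemma integral_eq_enn2real_parts: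
  assumes "k \<in> borel_measurable M" "(\<integral>\<^sup>+x. ennreal \<bar>k x\<bar> \<partial>M) < \<infinity>"
  shows "(\<integral>x. k x \<partial>M) = enn2real (\<integral>\<^sup>+x. ennreal (k x) \<partial>M) - enn2real (\<integral>\<^sup>+x. ennreal (- k x) \<partial>M)"
  by (rule real_lebesgue_integral_def) (use assms in \<open>auto simp: integrable_iff_bounded\<close>)

context markov_class
begin

lemma measurable_clamped_process:
  assumes t: "t \<in> {0..T}" and r: "r \<in> {0..T}" and \<nu>: "sets \<nu> = sets borel"
    and h: "(\<lambda>(q, y). h q y) \<in> measurable (borel \<Otimes>\<^sub>M borel) N"
  shows "(\<lambda>(\<omega>, q). h q (\<omega> (max t (min T q)))) \<in> measurable (P r y \<Otimes>\<^sub>M \<nu>) N"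
proof -
  let ?M = "(path_sigma T {0..T} :: (real \<Rightarrow> 'e) measure) \<Otimes>\<^sub>M (borel :: real measure)"
  have cong: "measurable (P r y \<Otimes>\<^sub>M \<nu>) N = measurable ?M N"
    by (intro measurable_cong_sets refl sets_pair_measure_cong sets_P r \<nu>)
  have "(\<lambda>z. (\<lambda>(r, \<omega>). \<omega> (max 0 (min T r))) (max t (min T (snd z)), fst z)) \<in> borel_measurable ?M"
    by (rule measurable_compose[OF _ measurable_eval_joint]) (use T_pos in auto)
  also have "(\<lambda>z. (\<lambda>(r, \<omega>). \<omega> (max 0 (min T r))) (max t (min T (snd z)), fst z)) = (\<lambda>z. fst z (max t (min T (snd z))) :: 'e)"
    using t by (auto simp: fun_eq_iff max_def min_def)
  finally have "(\<lambda>z. (snd z, fst z (max t (min T (snd z))))) \<in> measurable ?M (borel \<Otimes>\<^sub>M borel)"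
    by (intro measurable_Pair) auto
  from measurable_compose[OF this h] show ?thesis
    unfolding cong by (simp add: case_prod_beta')
qed

text \<open>Tonelli reduces the claim to a single time \<open>q\<close>, where the Markov property
  applies, and a second exchange restores the functional; the joint measurability of
  \<open>k\<close> makes the exchanges legitimate. A general \<open>\<nu>\<close> covers both
  Lebesgue measure, for running costs, and a point mass at \<open>T\<close>, for the terminal
  value.\<close>

lemma markov_additive_nn:
  fixes \<nu> :: "real measure" and H :: "real \<Rightarrow> 'e \<Rightarrow> ennreal"
  defines "c \<equiv> \<lambda>t q. max t (min T q)"
  assumes s: "s \<in> {0..T}" and t: "t \<in> {s..T}" and \<nu>: "sigma_finite_measure \<nu>" "sets \<nu> = sets borel"
    and H: "(\<lambda>(q, y). H q y) \<in> borel_measurable (borel \<Otimes>\<^sub>M borel)"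
  shows "(\<lambda>y. \<integral>\<^sup>+\<omega>. \<integral>\<^sup>+q. H q (\<omega> (c t q)) \<partial>\<nu> \<partial>P t y) \<in> borel_measurable borel"
    and "A \<in> sets (path_filtration T t) \<Longrightarrow>
      (\<integral>\<^sup>+\<omega>. indicator A \<omega> * (\<integral>\<^sup>+q. H q (\<omega> (c t q)) \<partial>\<nu>) \<partial>P s x)
      = (\<integral>\<^sup>+\<omega>. indicator A \<omega> * (\<integral>\<^sup>+\<omega>'. \<integral>\<^sup>+q. H q (\<omega>' (c t q)) \<partial>\<nu> \<partial>P t (\<omega> t)) \<partial>P s x)"
proof -
  interpret \<nu>: sigma_finite_measure \<nu> by fact
  have t0: "t \<in> {0..T}" using s t by auto
  have c_in: "c t q \<in> {t..T}" "c t q \<in> {0..T}" for q using t0 by (auto simp: c_def)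
  have joint: "(\<lambda>(\<omega>, q). H q (\<omega> (c t q))) \<in> borel_measurable (P r y \<Otimes>\<^sub>M \<nu>)" if r: "r \<in> {0..T}" for r y
    unfolding c_def by (rule measurable_clamped_process[OF t0 r \<nu>(2) H])
  have sect: "(\<lambda>y. H q y) \<in> borel_measurable borel" for q
    using measurable_compose[OF _ H, of "\<lambda>y. (q, y)" borel] by simp
  define K where "K y = (\<integral>\<^sup>+\<omega>. \<integral>\<^sup>+q. H q (\<omega> (c t q)) \<partial>\<nu> \<partial>P t y)" for y
  define k where "k q y = (\<integral>\<^sup>+z. H q z \<partial>law_at t (q, y))" for q y
  have k_eq: "k q y = (\<integral>\<^sup>+\<omega>. H q (\<omega> (c t q)) \<partial>P t y)" for q y
    unfolding k_def law_at_def c_def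
    by (subst nn_integral_distr) (use sect eval_P[OF t0] c_in in \<open>auto simp: c_def\<close>)
  have K_eq: "K y = (\<integral>\<^sup>+q. k q y \<partial>\<nu>)" for y
  proof -
    interpret Q: prob_space "P t y" by (rule prob_P[OF t0])
    interpret pair_sigma_finite "P t y" \<nu> ..
    show ?thesis unfolding K_def k_eq using Fubini'[OF joint[OF t0]] by simp
  qed
  have k_m: "(\<lambda>(q, y). k q y) \<in> borel_measurable (borel \<Otimes>\<^sub>M borel)"
  proof -
    have "(\<lambda>z. integral\<^sup>N (law_at t z) (\<lambda>y. H (fst z) y)) \<in> borel_measurable (borel \<Otimes>\<^sub>M borel)"
    proof (rule nn_integral_measurable_subprob_algebra2[OF _ kernel_law_at[OF t0]])
      have "(\<lambda>z. (\<lambda>(q, y). H q y) (fst (fst z), snd z)) \<in> borel_measurable ((borel \<Otimes>\<^sub>M (borel :: 'e measure)) \<Otimes>\<^sub>M borel)"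
        by (rule measurable_compose[OF _ H]) auto
      then show "(\<lambda>(z, y). H (fst z) y) \<in> borel_measurable ((borel \<Otimes>\<^sub>M (borel :: 'e measure)) \<Otimes>\<^sub>M borel)"
        by (simp add: case_prod_beta')
    qed
    then show ?thesis by (simp add: k_def case_prod_beta')
  qed
  have k_m': "(\<lambda>(y, q). k q y) \<in> borel_measurable (borel \<Otimes>\<^sub>M \<nu>)"
  proof -
    have "(\<lambda>z. (\<lambda>(q, y). k q y) (snd z, fst z)) \<in> borel_measurable (borel \<Otimes>\<^sub>M \<nu>)"
      by (rule measurable_compose[OF _ k_m])
         (auto simp: measurable_cong_sets[OF sets_pair_measure_cong[OF refl \<nu>(2)] refl])
    then show ?thesis by (simp add: case_prod_beta')
  qed
  have Km: "K \<in> borel_measurable borel"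
    using \<nu>.borel_measurable_nn_integral_fst[OF k_m'] unfolding K_eq[abs_def] by simp
  then show "(\<lambda>y. \<integral>\<^sup>+\<omega>. \<integral>\<^sup>+q. H q (\<omega> (c t q)) \<partial>\<nu> \<partial>P t y) \<in> borel_measurable borel"
    unfolding K_def .
  assume A: "A \<in> sets (path_filtration T t)"
  interpret Q: prob_space "P s x" by (rule prob_P[OF s])
  interpret QF: filtered_prob_space "P s x" "path_filtration T" T by (rule filtered_P[OF s])
  have [measurable]: "A \<in> sets (P s x)" using QF.sets_F_M[OF t0 A] .
  interpret pair_sigma_finite "P s x" \<nu> ..
  have m1: "(\<lambda>(\<omega>, q). indicator A \<omega> * H q (\<omega> (c t q))) \<in> borel_measurable (P s x \<Otimes>\<^sub>M \<nu>)"
    using joint[OF s] by (auto simp: case_prod_beta' intro!: borel_measurable_times measurable_compose[OF measurable_fst])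
  have ev_k: "(\<lambda>(\<omega>, q). k q (\<omega> t)) \<in> borel_measurable (P s x \<Otimes>\<^sub>M \<nu>)"
  proof -
    have "(\<lambda>z. (\<lambda>(y, q). k q y) (fst z t, snd z)) \<in> borel_measurable (P s x \<Otimes>\<^sub>M \<nu>)"
      by (rule measurable_compose[OF _ k_m']) (auto intro!: measurable_Pair measurable_compose[OF measurable_fst eval_P[OF s t0]])
    then show ?thesis by (simp add: case_prod_beta')
  qed
  have m2: "(\<lambda>(\<omega>, q). indicator A \<omega> * k q (\<omega> t)) \<in> borel_measurable (P s x \<Otimes>\<^sub>M \<nu>)"
    using ev_k by (auto simp: case_prod_beta' intro!: borel_measurable_times measurable_compose[OF measurable_fst])
  have sec: "(\<lambda>q. H q (\<omega> (c t q))) \<in> borel_measurable \<nu>" if "\<omega> \<in> space (P s x)" for \<omega>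
    using measurable_compose[OF measurable_Pair1'[OF that] joint[OF s]] by simp
  have seck: "(\<lambda>q. k q (\<omega> t)) \<in> borel_measurable \<nu>" if "\<omega> \<in> space (P s x)" for \<omega>
    using measurable_compose[OF measurable_Pair1'[OF that] ev_k] by simp
  have "(\<integral>\<^sup>+\<omega>. indicator A \<omega> * (\<integral>\<^sup>+q. H q (\<omega> (c t q)) \<partial>\<nu>) \<partial>P s x)
      = (\<integral>\<^sup>+\<omega>. \<integral>\<^sup>+q. indicator A \<omega> * H q (\<omega> (c t q)) \<partial>\<nu> \<partial>P s x)"
    by (intro nn_integral_cong) (simp add: nn_integral_cmult sec)
  also have "\<dots> = (\<integral>\<^sup>+q. \<integral>\<^sup>+\<omega>. indicator A \<omega> * H q (\<omega> (c t q)) \<partial>P s x \<partial>\<nu>)"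
    using Fubini'[OF m1] by simp
  also have "\<dots> = (\<integral>\<^sup>+q. \<integral>\<^sup>+\<omega>. indicator A \<omega> * k q (\<omega> t) \<partial>P s x \<partial>\<nu>)"
    unfolding k_eq by (intro nn_integral_cong markov_single_time s t c_in A sect)
  also have "\<dots> = (\<integral>\<^sup>+\<omega>. \<integral>\<^sup>+q. indicator A \<omega> * k q (\<omega> t) \<partial>\<nu> \<partial>P s x)"
    using Fubini'[OF m2] by simp
  also have "\<dots> = (\<integral>\<^sup>+\<omega>. indicator A \<omega> * K (\<omega> t) \<partial>P s x)"
    unfolding K_eq by (intro nn_integral_cong) (simp add: nn_integral_cmult seck)
  finally show "(\<integral>\<^sup>+\<omega>. indicator A \<omega> * (\<integral>\<^sup>+q. H q (\<omega> (c t q)) \<partial>\<nu>) \<partial>P s x)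
      = (\<integral>\<^sup>+\<omega>. indicator A \<omega> * (\<integral>\<^sup>+\<omega>'. \<integral>\<^sup>+q. H q (\<omega>' (c t q)) \<partial>\<nu> \<partial>P t (\<omega> t)) \<partial>P s x)"
    unfolding K_def .
qed

text \<open>The nonnegative case is applied to the positive and the negative part. Finiteness from
  every starting point \<open>y\<close> makes \<open>J t y\<close> a difference of two finite
  numbers everywhere, so it is a genuine Borel function of \<open>y\<close>.\<close>

lemma markov_additive:
  fixes \<nu> :: "real measure" and h :: "real \<Rightarrow> 'e \<Rightarrow> real"
  defines "c \<equiv> \<lambda>t q. max t (min T q)"
  defines "I \<equiv> \<lambda>t \<omega>. \<integral>q. h q (\<omega> (c t q)) \<partial>\<nu>"
  defines "J \<equiv> \<lambda>t y. \<integral>\<omega>. I t \<omega> \<partial>P t y"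
  assumes s: "s \<in> {0..T}" and t: "t \<in> {s..T}" and \<nu>: "sigma_finite_measure \<nu>" "sets \<nu> = sets borel"
    and h: "(\<lambda>(q, y). h q y) \<in> borel_measurable (borel \<Otimes>\<^sub>M borel)"
    and fin: "\<And>y. (\<integral>\<^sup>+\<omega>. \<integral>\<^sup>+q. ennreal \<bar>h q (\<omega> (c t q))\<bar> \<partial>\<nu> \<partial>P t y) < \<infinity>"
    and finQ: "(\<integral>\<^sup>+\<omega>. \<integral>\<^sup>+q. ennreal \<bar>h q (\<omega> (c t q))\<bar> \<partial>\<nu> \<partial>P s x) < \<infinity>"
  shows "J t \<in> borel_measurable borel" "integrable (P s x) (I t)" "integrable (P s x) (\<lambda>\<omega>. J t (\<omega> t))"
    and "A \<in> sets (path_filtration T t) \<Longrightarrow> (\<integral>\<omega>\<in>A. I t \<omega> \<partial>P s x) = (\<integral>\<omega>\<in>A. J t (\<omega> t) \<partial>P s x)"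
proof -
  have t0: "t \<in> {0..T}" using s t by auto
  interpret \<nu>: sigma_finite_measure \<nu> by fact
  \<comment> \<open>Since \<open>ennreal\<close> sends negative numbers to 0, \<open>e = 1\<close>
    and \<open>e = -1\<close> select the positive and the negative part.\<close>
  define F where "F e \<omega> = (\<integral>\<^sup>+q. ennreal (e * h q (\<omega> (c t q))) \<partial>\<nu>)" for e \<omega>
  define J' where "J' e y = (\<integral>\<^sup>+\<omega>. F e \<omega> \<partial>P t y)" for e y
  have he: "(\<lambda>(q, y). ennreal (e * h q y)) \<in> borel_measurable (borel \<Otimes>\<^sub>M borel)" for e
    using h by (auto simp: case_prod_beta')
  have hc: "(\<lambda>(\<omega>, q). h q (\<omega> (c t q))) \<in> borel_measurable (P r y \<Otimes>\<^sub>M \<nu>)" if r: "r \<in> {0..T}" for r y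
    unfolding c_def by (rule measurable_clamped_process[OF t0 r \<nu>(2) h])
  have F_m: "F e \<in> borel_measurable (P r y)" if r: "r \<in> {0..T}" for e r y
  proof -
    have "(\<lambda>(\<omega>, q). ennreal (e * h q (\<omega> (c t q)))) \<in> borel_measurable (P r y \<Otimes>\<^sub>M \<nu>)"
      using hc[OF r] by (auto simp: case_prod_beta')
    from \<nu>.borel_measurable_nn_integral_fst[OF this] show ?thesis unfolding F_def[abs_def] by simp
  qed
  have sec: "(\<lambda>q. h q (\<omega> (c t q))) \<in> borel_measurable \<nu>" if "\<omega> \<in> space (P r y)" "r \<in> {0..T}" for \<omega> r y
    using measurable_compose[OF measurable_Pair1'[OF that(1)] hc[OF that(2)]] by simp
  have F_le: "F e \<omega> \<le> (\<integral>\<^sup>+q. ennreal \<bar>h q (\<omega> (c t q))\<bar> \<partial>\<nu>)" if "e = 1 \<or> e = -1" for e \<omega>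
    unfolding F_def using that by (intro nn_integral_mono ennreal_leI) auto
  have abs_m: "(\<lambda>\<omega>. \<integral>\<^sup>+q. ennreal \<bar>h q (\<omega> (c t q))\<bar> \<partial>\<nu>) \<in> borel_measurable (P r y)" if r: "r \<in> {0..T}" for r y
  proof -
    have "(\<lambda>(\<omega>, q). ennreal \<bar>h q (\<omega> (c t q))\<bar>) \<in> borel_measurable (P r y \<Otimes>\<^sub>M \<nu>)"
      using hc[OF r] by (auto simp: case_prod_beta')
    from \<nu>.borel_measurable_nn_integral_fst[OF this] show ?thesis by simp
  qed
  have I_eq: "AE \<omega> in P r y. I t \<omega> = enn2real (F 1 \<omega>) - enn2real (F (-1) \<omega>)"
    if r: "r \<in> {0..T}" and f: "(\<integral>\<^sup>+\<omega>. \<integral>\<^sup>+q. ennreal \<bar>h q (\<omega> (c t q))\<bar> \<partial>\<nu> \<partial>P r y) < \<infinity>" for r y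
  proof -
    have "AE \<omega> in P r y. (\<integral>\<^sup>+q. ennreal \<bar>h q (\<omega> (c t q))\<bar> \<partial>\<nu>) \<noteq> \<infinity>"
      by (rule nn_integral_PInf_AE) (use abs_m[OF r] f in auto)
    then show ?thesis
    proof (rule AE_mp, intro AE_I2 impI)
      fix \<omega> assume "\<omega> \<in> space (P r y)" "(\<integral>\<^sup>+q. ennreal \<bar>h q (\<omega> (c t q))\<bar> \<partial>\<nu>) \<noteq> \<infinity>"
      then show "I t \<omega> = enn2real (F 1 \<omega>) - enn2real (F (-1) \<omega>)"
        unfolding I_def F_def using sec[OF _ r]
        by (subst integral_eq_enn2real_parts) (auto simp: less_top)
    qed
  qed
  have I_m: "I t \<in> borel_measurable (P r y)" if r: "r \<in> {0..T}" for r y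
    using \<nu>.borel_measurable_lebesgue_integral[OF hc[OF r]] unfolding I_def by simp
  have F_fin: "(\<integral>\<^sup>+\<omega>. F e \<omega> \<partial>P r y) < \<infinity>"
    if "(\<integral>\<^sup>+\<omega>. \<integral>\<^sup>+q. ennreal \<bar>h q (\<omega> (c t q))\<bar> \<partial>\<nu> \<partial>P r y) < \<infinity>" "e = 1 \<or> e = -1" for e r y
    using nn_integral_mono[of "P r y", OF F_le[OF that(2)]] that(1) by (rule le_less_trans)
  have J_eq: "J t y = enn2real (J' 1 y) - enn2real (J' (-1) y)" for y
  proof -
    note e = integral_enn2real[OF F_m[OF t0] F_fin[OF fin]]
    have "J t y = (\<integral>\<omega>. enn2real (F 1 \<omega>) - enn2real (F (-1) \<omega>) \<partial>P t y)"
      unfolding J_def by (rule integral_cong_AE) (use I_eq[OF t0 fin] I_m[OF t0] F_m[OF t0] in auto)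
    also have "\<dots> = enn2real (J' 1 y) - enn2real (J' (-1) y)"
      unfolding J'_def using e by (subst Bochner_Integration.integral_diff) auto
    finally show ?thesis .
  qed
  have J'_m: "J' e \<in> borel_measurable borel" for e
    unfolding J'_def[abs_def] F_def c_def using markov_additive_nn(1)[OF s t \<nu> he] by simp
  have J'_ev: "(\<lambda>\<omega>. J' e (\<omega> t)) \<in> borel_measurable (P s x)" for e
    using measurable_compose[OF eval_P[OF s t0] J'_m] .
  have tr: "(\<integral>\<^sup>+\<omega>. indicator A \<omega> * F e \<omega> \<partial>P s x) = (\<integral>\<^sup>+\<omega>. indicator A \<omega> * J' e (\<omega> t) \<partial>P s x)"
    if "A \<in> sets (path_filtration T t)" for A e
    unfolding J'_def F_def c_def by (rule markov_additive_nn(2)[OF s t \<nu> he that])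
  have sp: "space (path_filtration T t) = space (P s x)" by (simp add: space_P[OF s])
  \<comment> \<open>With the whole space as \<open>A\<close>, the transfer identity carries
    finiteness over to the conditioned side.\<close>
  have J'_fin: "(\<integral>\<^sup>+\<omega>. J' e (\<omega> t) \<partial>P s x) < \<infinity>" if "e = 1 \<or> e = -1" for e
  proof -
    have "(\<integral>\<^sup>+\<omega>. J' e (\<omega> t) \<partial>P s x) = (\<integral>\<^sup>+\<omega>. indicator (space (P s x)) \<omega> * J' e (\<omega> t) \<partial>P s x)"
      by (intro nn_integral_cong) auto
    also have "\<dots> = (\<integral>\<^sup>+\<omega>. indicator (space (P s x)) \<omega> * F e \<omega> \<partial>P s x)"
      using tr[OF sets.top] unfolding sp by simp
    also have "\<dots> = (\<integral>\<^sup>+\<omega>. F e \<omega> \<partial>P s x)" by (intro nn_integral_cong) auto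
    finally show ?thesis using F_fin[OF finQ that] by simp
  qed
  show "J t \<in> borel_measurable borel" unfolding J_eq[abs_def] using J'_m by auto
  have Fint: "integrable (P s x) (\<lambda>\<omega>. enn2real (F e \<omega>))" if "e = 1 \<or> e = -1" for e
    by (rule integral_enn2real[OF F_m[OF s] F_fin[OF finQ that]])
  have Jint: "integrable (P s x) (\<lambda>\<omega>. enn2real (J' e (\<omega> t)))" if "e = 1 \<or> e = -1" for e
    by (rule integral_enn2real[OF J'_ev J'_fin[OF that]])
  show Ii: "integrable (P s x) (I t)"
    by (rule integrable_cong_AE_imp[of _ "\<lambda>\<omega>. enn2real (F 1 \<omega>) - enn2real (F (-1) \<omega>)"])
       (use Fint I_m[OF s] I_eq[OF s finQ] in \<open>auto elim: eventually_mono\<close>)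
  show "integrable (P s x) (\<lambda>\<omega>. J t (\<omega> t))" unfolding J_eq using Jint by auto
  assume A: "A \<in> sets (path_filtration T t)"
  interpret QF: filtered_prob_space "P s x" "path_filtration T" T by (rule filtered_P[OF s])
  have AQ[measurable]: "A \<in> sets (P s x)" using QF.sets_F_M[OF t0 A] .
  have part: "(\<integral>\<omega>. indicat_real A \<omega> * enn2real (F e \<omega>) \<partial>P s x) = (\<integral>\<omega>. indicat_real A \<omega> * enn2real (J' e (\<omega> t)) \<partial>P s x)"
    if e: "e = 1 \<or> e = -1" for e
  proof -
    have ind: "indicat_real A \<omega> * enn2real z = enn2real (indicator A \<omega> * z)" for \<omega> z
      by (auto simp: indicator_def)
    have fin1: "(\<integral>\<^sup>+\<omega>. indicator A \<omega> * F e \<omega> \<partial>P s x) < \<infinity>"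
      by (rule le_less_trans[OF nn_integral_mono F_fin[OF finQ e]]) (auto simp: indicator_def)
    have "(\<integral>\<omega>. enn2real (indicator A \<omega> * F e \<omega>) \<partial>P s x) = enn2real (\<integral>\<^sup>+\<omega>. indicator A \<omega> * F e \<omega> \<partial>P s x)"
      by (rule integral_enn2real) (use fin1 F_m[OF s] in auto)
    moreover have "(\<integral>\<omega>. enn2real (indicator A \<omega> * J' e (\<omega> t)) \<partial>P s x) = enn2real (\<integral>\<^sup>+\<omega>. indicator A \<omega> * J' e (\<omega> t) \<partial>P s x)"
      by (rule integral_enn2real) (use fin1 tr[OF A, of e] J'_ev in auto)
    ultimately show ?thesis unfolding ind using tr[OF A, of e] by simp
  qed
  have ind_int: "integrable (P s x) (\<lambda>\<omega>. indicat_real A \<omega> * k \<omega>)" if "integrable (P s x) k" for k :: "_ \<Rightarrow> real"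
    using integrable_real_mult_indicator[OF AQ that] by (simp add: mult.commute)
  have "(\<integral>\<omega>\<in>A. I t \<omega> \<partial>P s x) = (\<integral>\<omega>. indicat_real A \<omega> * enn2real (F 1 \<omega>) - indicat_real A \<omega> * enn2real (F (-1) \<omega>) \<partial>P s x)"
    unfolding set_lebesgue_integral_def
  proof (rule integral_cong_AE)
    show "AE \<omega> in P s x. indicat_real A \<omega> *\<^sub>R I t \<omega> = indicat_real A \<omega> * enn2real (F 1 \<omega>) - indicat_real A \<omega> * enn2real (F (-1) \<omega>)"
      using I_eq[OF s finQ] by eventually_elim (simp add: right_diff_distrib)
  qed (use I_m[OF s] F_m[OF s] in auto)
  also have "\<dots> = (\<integral>\<omega>. indicat_real A \<omega> * enn2real (F 1 \<omega>) \<partial>P s x) - (\<integral>\<omega>. indicat_real A \<omega> * enn2real (F (-1) \<omega>) \<partial>P s x)"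
    by (intro Bochner_Integration.integral_diff ind_int Fint) auto
  also have "\<dots> = (\<integral>\<omega>. indicat_real A \<omega> * enn2real (J' 1 (\<omega> t)) \<partial>P s x) - (\<integral>\<omega>. indicat_real A \<omega> * enn2real (J' (-1) (\<omega> t)) \<partial>P s x)"
    using part[of 1] part[of "-1"] by simp
  also have "\<dots> = (\<integral>\<omega>. indicat_real A \<omega> * enn2real (J' 1 (\<omega> t)) - indicat_real A \<omega> * enn2real (J' (-1) (\<omega> t)) \<partial>P s x)"
    by (intro Bochner_Integration.integral_diff[symmetric] ind_int Jint) auto
  also have "\<dots> = (\<integral>\<omega>\<in>A. J t (\<omega> t) \<partial>P s x)"
    unfolding set_lebesgue_integral_def J_eq by (simp add: right_diff_distrib)
  finally show "(\<integral>\<omega>\<in>A. I t \<omega> \<partial>P s x) = (\<integral>\<omega>\<in>A. J t (\<omega> t) \<partial>P s x)" .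
qed

end

section \<open>Time integrals along paths\<close>

lemma borel_funs_section:
  assumes "\<phi> \<in> borel_funs T" "t \<in> {0..T}"
  shows "\<phi> t \<in> borel_measurable borel"
  using measurable_compose[OF measurable_Pair1'[of t borel] borel_funs_measurable[OF assms(1)]] assms(2) by simp

lemma borel_funs_uminus: "\<phi> \<in> borel_funs T \<Longrightarrow> (\<lambda>r y. - \<phi> r y) \<in> borel_funs T"
  and borel_funs_add: "\<phi> \<in> borel_funs T \<Longrightarrow> \<psi> \<in> borel_funs T \<Longrightarrow> (\<lambda>r y. \<phi> r y + \<psi> r y) \<in> borel_funs T"
  and borel_funs_diff: "\<phi> \<in> borel_funs T \<Longrightarrow> \<psi> \<in> borel_funs T \<Longrightarrow> (\<lambda>r y. \<phi> r y - \<psi> r y) \<in> borel_funs T"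
  and borel_funs_mult: "\<phi> \<in> borel_funs T \<Longrightarrow> \<psi> \<in> borel_funs T \<Longrightarrow> (\<lambda>r y. \<phi> r y * \<psi> r y) \<in> borel_funs T"
  and borel_funs_cmult: "\<phi> \<in> borel_funs T \<Longrightarrow> (\<lambda>r y. a * \<phi> r y) \<in> borel_funs T"
  and borel_funs_power: "\<phi> \<in> borel_funs T \<Longrightarrow> (\<lambda>r y. (\<phi> r y)^k) \<in> borel_funs T"
  unfolding borel_funs_def by (auto simp: case_prod_beta')

context markov_class
begin

text \<open>The class \<open>LX T P 1\<close>, written without \<open>powr\<close>.\<close>

definition path_integrable :: "(real \<Rightarrow> 'e \<Rightarrow> real) \<Rightarrow> bool" where
  "path_integrable \<phi> \<longleftrightarrow> \<phi> \<in> borel_funs T \<and>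
     (\<forall>s\<in>{0..T}. \<forall>x. (\<integral>\<^sup>+\<omega>. (\<integral>\<^sup>+r\<in>{s..T}. ennreal \<bar>\<phi> r (\<omega> r)\<bar> \<partial>lborel) \<partial>P s x) < \<infinity>)"

lemma path_process_P:
  assumes \<phi>: "\<phi> \<in> borel_funs T" and s: "s \<in> {0..T}" and ab: "0 \<le> a" "b \<le> T"
  shows "(\<lambda>(\<omega>, r). indicator {a..b} r * \<phi> r (\<omega> r)) \<in> borel_measurable (P s x \<Otimes>\<^sub>M lborel)"
proof -
  have "(\<lambda>(q, y). indicator {a..b} q * (indicator {0..T} q * \<phi> q y)) \<in> borel_measurable (borel \<Otimes>\<^sub>M borel)"
    using borel_funs_measurable[OF \<phi>] by (auto simp: case_prod_beta' intro!: borel_measurable_times measurable_compose[OF measurable_fst])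
  from measurable_clamped_process[OF _ s _ this, of 0 lborel] T_pos
  have "(\<lambda>(\<omega>, q). indicator {a..b} q * (indicator {0..T} q * \<phi> q (\<omega> (max 0 (min T q))))) \<in> borel_measurable (P s x \<Otimes>\<^sub>M lborel)"
    by simp
  also have "(\<lambda>(\<omega>, q). indicator {a..b} q * (indicator {0..T} q * \<phi> q (\<omega> (max 0 (min T q)))))
      = (\<lambda>(\<omega>, r). indicator {a..b} r * \<phi> r (\<omega> r) :: real)"
    using ab by (auto simp: fun_eq_iff indicator_def max_absorb2 min_absorb2)
  finally show ?thesis .
qed

lemma path_process_section:
  assumes \<phi>: "\<phi> \<in> borel_funs T" and s: "s \<in> {0..T}" and ab: "0 \<le> a" "b \<le> T" and \<omega>: "\<omega> \<in> space (P s x)"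
  shows "(\<lambda>r. indicator {a..b} r * \<phi> r (\<omega> r)) \<in> borel_measurable lborel"
  using measurable_compose[OF measurable_Pair1'[OF \<omega>] path_process_P[OF \<phi> s ab]] by simp

lemma path_integral_P:
  assumes \<phi>: "\<phi> \<in> borel_funs T" and s: "s \<in> {0..T}" and ab: "0 \<le> a" "b \<le> T"
  shows "(\<lambda>\<omega>. LBINT r:{a..b}. \<phi> r (\<omega> r)) \<in> borel_measurable (P s x)"
  using lborel.borel_measurable_lebesgue_integral[OF path_process_P[OF assms]]
  unfolding set_lebesgue_integral_def by simp

lemma path_nn_integral_P:
  assumes \<phi>: "\<phi> \<in> borel_funs T" and s: "s \<in> {0..T}" and ab: "0 \<le> a" "b \<le> T"
  shows "(\<lambda>\<omega>. \<integral>\<^sup>+r\<in>{a..b}. ennreal (\<phi> r (\<omega> r)) \<partial>lborel) \<in> borel_measurable (P s x)"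
proof -
  have "(\<lambda>(\<omega>, r). ennreal (indicator {a..b} r * \<phi> r (\<omega> r))) \<in> borel_measurable (P s x \<Otimes>\<^sub>M lborel)"
    using path_process_P[OF assms] by (auto simp: case_prod_beta')
  from lborel.borel_measurable_nn_integral_fst[OF this]
  have "(\<lambda>\<omega>. \<integral>\<^sup>+r. ennreal (indicator {a..b} r * \<phi> r (\<omega> r)) \<partial>lborel) \<in> borel_measurable (P s x)" by simp
  moreover have "(\<integral>\<^sup>+r. ennreal (indicator {a..b} r * \<phi> r (\<omega> r)) \<partial>lborel) = (\<integral>\<^sup>+r\<in>{a..b}. ennreal (\<phi> r (\<omega> r)) \<partial>lborel)" for \<omega>
    by (intro nn_integral_cong) (auto simp: indicator_def)
  ultimately show ?thesis by simp
qed

lemma path_integrable_borel: "path_integrable \<phi> \<Longrightarrow> \<phi> \<in> borel_funs T"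
  and path_integrable_fin: "path_integrable \<phi> \<Longrightarrow> s \<in> {0..T} \<Longrightarrow>
    (\<integral>\<^sup>+\<omega>. (\<integral>\<^sup>+r\<in>{s..T}. ennreal \<bar>\<phi> r (\<omega> r)\<bar> \<partial>lborel) \<partial>P s x) < \<infinity>"
  by (auto simp: path_integrable_def)

lemma borel_funs_abs: "\<phi> \<in> borel_funs T \<Longrightarrow> (\<lambda>r y. \<bar>\<phi> r y\<bar>) \<in> borel_funs T"
  unfolding borel_funs_def by (auto simp: case_prod_beta')

lemma path_integrable_bound:
  assumes "path_integrable \<phi>" "path_integrable \<psi>" "\<rho> \<in> borel_funs T"
    and le: "\<And>r y. r \<in> {0..T} \<Longrightarrow> \<bar>\<rho> r y\<bar> \<le> \<bar>\<phi> r y\<bar> + \<bar>\<psi> r y\<bar>"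
  shows "path_integrable \<rho>"
  unfolding path_integrable_def
proof (intro conjI ballI allI)
  fix s x assume s: "s \<in> {0..T}"
  note bf = path_integrable_borel[OF assms(1), THEN borel_funs_abs] path_integrable_borel[OF assms(2), THEN borel_funs_abs]
  have sec: "(\<lambda>r. ennreal \<bar>\<phi> r (\<omega> r)\<bar> * indicator {s..T} r) \<in> borel_measurable lborel"
    if "\<phi> \<in> borel_funs T" "\<omega> \<in> space (P s x)" for \<phi> \<omega>
  proof -
    have "(\<lambda>r. ennreal (indicator {s..T} r * \<bar>\<phi> r (\<omega> r)\<bar>)) \<in> borel_measurable lborel"
      by (rule measurable_compose[OF path_process_section[OF borel_funs_abs[OF that(1)] s _ _ that(2)] measurable_ennreal]) (use s in auto)
    also have "(\<lambda>r. ennreal (indicator {s..T} r * \<bar>\<phi> r (\<omega> r)\<bar>)) = (\<lambda>r. ennreal \<bar>\<phi> r (\<omega> r)\<bar> * indicator {s..T} r)"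
      by (auto simp: fun_eq_iff indicator_def)
    finally show ?thesis .
  qed
  have "(\<integral>\<^sup>+\<omega>. (\<integral>\<^sup>+r\<in>{s..T}. ennreal \<bar>\<rho> r (\<omega> r)\<bar> \<partial>lborel) \<partial>P s x)
    \<le> (\<integral>\<^sup>+\<omega>. (\<integral>\<^sup>+r\<in>{s..T}. ennreal \<bar>\<phi> r (\<omega> r)\<bar> \<partial>lborel) + (\<integral>\<^sup>+r\<in>{s..T}. ennreal \<bar>\<psi> r (\<omega> r)\<bar> \<partial>lborel) \<partial>P s x)"
  proof (intro nn_integral_mono)
    fix \<omega> assume \<omega>: "\<omega> \<in> space (P s x)"
    have "(\<integral>\<^sup>+r\<in>{s..T}. ennreal \<bar>\<rho> r (\<omega> r)\<bar> \<partial>lborel) \<le>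
       (\<integral>\<^sup>+r. ennreal \<bar>\<phi> r (\<omega> r)\<bar> * indicator {s..T} r + ennreal \<bar>\<psi> r (\<omega> r)\<bar> * indicator {s..T} r \<partial>lborel)"
      using le s by (intro nn_integral_mono) (auto simp: indicator_def ennreal_plus[symmetric] simp del: ennreal_plus intro!: ennreal_leI)
    also have "\<dots> = (\<integral>\<^sup>+r\<in>{s..T}. ennreal \<bar>\<phi> r (\<omega> r)\<bar> \<partial>lborel) + (\<integral>\<^sup>+r\<in>{s..T}. ennreal \<bar>\<psi> r (\<omega> r)\<bar> \<partial>lborel)"
      by (rule nn_integral_add) (use sec \<omega> assms(1,2) path_integrable_borel in auto)
    finally show "(\<integral>\<^sup>+r\<in>{s..T}. ennreal \<bar>\<rho> r (\<omega> r)\<bar> \<partial>lborel) \<le>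
       (\<integral>\<^sup>+r\<in>{s..T}. ennreal \<bar>\<phi> r (\<omega> r)\<bar> \<partial>lborel) + (\<integral>\<^sup>+r\<in>{s..T}. ennreal \<bar>\<psi> r (\<omega> r)\<bar> \<partial>lborel)" .
  qed
  also have "\<dots> = (\<integral>\<^sup>+\<omega>. (\<integral>\<^sup>+r\<in>{s..T}. ennreal \<bar>\<phi> r (\<omega> r)\<bar> \<partial>lborel) \<partial>P s x) + (\<integral>\<^sup>+\<omega>. (\<integral>\<^sup>+r\<in>{s..T}. ennreal \<bar>\<psi> r (\<omega> r)\<bar> \<partial>lborel) \<partial>P s x)"
    by (rule nn_integral_add; rule path_nn_integral_P[OF _ s]) (use bf s in auto)
  also have "\<dots> < \<infinity>" using path_integrable_fin[OF assms(1) s] path_integrable_fin[OF assms(2) s] by simp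
  finally show "(\<integral>\<^sup>+\<omega>. (\<integral>\<^sup>+r\<in>{s..T}. ennreal \<bar>\<rho> r (\<omega> r)\<bar> \<partial>lborel) \<partial>P s x) < \<infinity>" .
qed fact

lemma path_integrable_one: "path_integrable (\<lambda>r y. 1)"
  unfolding path_integrable_def
proof (intro conjI ballI allI)
  fix s x assume s: "s \<in> {0..T}"
  interpret Q: prob_space "P s x" by (rule prob_P[OF s])
  show "(\<integral>\<^sup>+\<omega>. (\<integral>\<^sup>+r\<in>{s..T}. ennreal \<bar>1\<bar> \<partial>lborel) \<partial>P s x) < \<infinity>"
    using s by (simp add: Q.emeasure_space_1)
qed (auto simp: borel_funs_def)

lemma path_integrable_product:
  assumes \<phi>: "path_integrable \<phi>" and s: "s \<in> {0..T}" and t: "t \<in> {s..T}"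
  shows "integrable (P s x \<Otimes>\<^sub>M lborel) (\<lambda>(\<omega>, r). indicator {t..T} r * \<phi> r (\<omega> r))"
proof (rule integrableI_bounded)
  note m = path_process_P[OF path_integrable_borel[OF \<phi>] s, of t T x]
  show "(\<lambda>(\<omega>, r). indicator {t..T} r * \<phi> r (\<omega> r)) \<in> borel_measurable (P s x \<Otimes>\<^sub>M lborel)"
    using m s t by auto
  then have m': "(\<lambda>z. ennreal (norm (case z of (\<omega>, r) \<Rightarrow> indicator {t..T} r * \<phi> r (\<omega> r)))) \<in> borel_measurable (P s x \<Otimes>\<^sub>M lborel)"
    by measurable
  have "(\<integral>\<^sup>+z. ennreal (norm (case z of (\<omega>, r) \<Rightarrow> indicator {t..T} r * \<phi> r (\<omega> r))) \<partial>(P s x \<Otimes>\<^sub>M lborel))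
      = (\<integral>\<^sup>+\<omega>. \<integral>\<^sup>+r. ennreal \<bar>indicator {t..T} r * \<phi> r (\<omega> r)\<bar> \<partial>lborel \<partial>P s x)"
    using lborel.nn_integral_fst[OF m'] by simp
  also have "\<dots> \<le> (\<integral>\<^sup>+\<omega>. (\<integral>\<^sup>+r\<in>{s..T}. ennreal \<bar>\<phi> r (\<omega> r)\<bar> \<partial>lborel) \<partial>P s x)"
    using t by (intro nn_integral_mono) (auto simp: indicator_def)
  also have "\<dots> < \<infinity>" by (rule path_integrable_fin[OF \<phi> s])
  finally show "(\<integral>\<^sup>+z. ennreal (norm (case z of (\<omega>, r) \<Rightarrow> indicator {t..T} r * \<phi> r (\<omega> r))) \<partial>(P s x \<Otimes>\<^sub>M lborel)) < \<infinity>" .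
qed

lemma path_set_integrable:
  assumes \<phi>: "path_integrable \<phi>" and s: "s \<in> {0..T}"
  shows "AE \<omega> in P s x. set_integrable lborel {s..T} (\<lambda>r. \<phi> r (\<omega> r))"
proof -
  interpret Q: prob_space "P s x" by (rule prob_P[OF s])
  interpret pair_sigma_finite "P s x" lborel ..
  have "s \<in> {s..T}" using s by auto
  from AE_integrable_fst'[OF path_integrable_product[OF \<phi> s this]]
  show ?thesis unfolding set_integrable_def by simp
qed

text \<open>The additive property with \<open>\<nu>\<close> Lebesgue measure. The indicator of
  \<open>{t..T}\<close> in the integrand makes the clamping invisible, and Fubini brings the
  conditioned side into the shape in which the identification problem states it.\<close>

lemma markov_time_integral:
  assumes \<phi>: "path_integrable \<phi>" and s: "s \<in> {0..T}" and t: "t \<in> {s..T}"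
  defines "J \<equiv> \<lambda>y. LBINT q:{t..T}. transition_op P t q (\<phi> q) y"
  shows "J \<in> borel_measurable borel" "integrable (P s x) (\<lambda>\<omega>. LBINT q:{t..T}. \<phi> q (\<omega> q))"
    "integrable (P s x) (\<lambda>\<omega>. J (\<omega> t))"
    and "A \<in> sets (path_filtration T t) \<Longrightarrow>
      (\<integral>\<omega>\<in>A. (LBINT q:{t..T}. \<phi> q (\<omega> q)) \<partial>P s x) = (\<integral>\<omega>\<in>A. J (\<omega> t) \<partial>P s x)"
proof -
  have t0: "t \<in> {0..T}" using s t by auto
  let ?h = "\<lambda>q y. indicator {t..T} q * \<phi> q y :: real"
  let ?c = "\<lambda>q. max t (min T q)"
  have hc: "?h q (\<omega> (?c q)) = indicator {t..T} q * \<phi> q (\<omega> q)" for q \<omega>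
    by (auto simp: indicator_def max_def min_def)
  have h: "(\<lambda>(q, y). ?h q y) \<in> borel_measurable (borel \<Otimes>\<^sub>M borel)"
  proof -
    have "(\<lambda>(q, y). indicator {t..T} q * (indicator {0..T} q * \<phi> q y)) \<in> borel_measurable (borel \<Otimes>\<^sub>M borel)"
      using borel_funs_measurable[OF path_integrable_borel[OF \<phi>]]
      by (auto simp: case_prod_beta' intro!: borel_measurable_times measurable_compose[OF measurable_fst])
    also have "(\<lambda>(q, y). indicator {t..T} q * (indicator {0..T} q * \<phi> q y)) = (\<lambda>(q, y). ?h q y)"
      using t0 by (auto simp: fun_eq_iff indicator_def)
    finally show ?thesis .
  qed
  have fin: "(\<integral>\<^sup>+\<omega>. \<integral>\<^sup>+q. ennreal \<bar>?h q (\<omega> (?c q))\<bar> \<partial>lborel \<partial>P r y) < \<infinity>" if r: "r \<in> {0..T}" "r \<le> t" for r y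
  proof -
    have "(\<integral>\<^sup>+\<omega>. \<integral>\<^sup>+q. ennreal \<bar>?h q (\<omega> (?c q))\<bar> \<partial>lborel \<partial>P r y) \<le> (\<integral>\<^sup>+\<omega>. (\<integral>\<^sup>+q\<in>{r..T}. ennreal \<bar>\<phi> q (\<omega> q)\<bar> \<partial>lborel) \<partial>P r y)"
      unfolding hc using r by (intro nn_integral_mono) (auto simp: indicator_def)
    then show ?thesis using path_integrable_fin[OF \<phi> r(1)] by (rule le_less_trans)
  qed
  have Jeq: "(\<integral>\<omega>. (\<integral>q. indicator {t..T} q * \<phi> q (\<omega> q) \<partial>lborel) \<partial>P t y) = J y" for y
  proof -
    interpret Q: prob_space "P t y" by (rule prob_P[OF t0])
    interpret pair_sigma_finite "P t y" lborel ..
    have "integrable (P t y \<Otimes>\<^sub>M lborel) (\<lambda>(\<omega>, q). indicator {t..T} q * \<phi> q (\<omega> q))"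
      by (rule path_integrable_product[OF \<phi> t0]) (use t0 in auto)
    from Fubini_integral[OF this]
    show ?thesis unfolding J_def set_lebesgue_integral_def transition_op_def by simp
  qed
  have st: "s \<le> t" using t by auto
  note * = markov_additive[OF s t lborel.sigma_finite_measure_axioms sets_lborel h fin[OF t0 order_refl] fin[OF s st, of x]]
  show "J \<in> borel_measurable borel" "integrable (P s x) (\<lambda>\<omega>. LBINT q:{t..T}. \<phi> q (\<omega> q))"
    "integrable (P s x) (\<lambda>\<omega>. J (\<omega> t))"
    using *(1-3) unfolding hc Jeq by (simp_all add: set_lebesgue_integral_def)
  assume A: "A \<in> sets (path_filtration T t)"
  show "(\<integral>\<omega>\<in>A. (LBINT q:{t..T}. \<phi> q (\<omega> q)) \<partial>P s x) = (\<integral>\<omega>\<in>A. J (\<omega> t) \<partial>P s x)"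
    using *(4)[OF A] unfolding hc Jeq by (simp add: set_lebesgue_integral_def)
qed

text \<open>The additive property with \<open>\<nu>\<close> the point mass at
  \<open>T\<close>.\<close>

lemma markov_terminal:
  assumes g: "g \<in> borel_measurable borel" and int: "\<And>s x. s \<in> {0..T} \<Longrightarrow> integrable (P s x) (\<lambda>\<omega>. g (\<omega> T))"
    and s: "s \<in> {0..T}" and t: "t \<in> {s..T}"
  shows "transition_op P t T g \<in> borel_measurable borel" "integrable (P s x) (\<lambda>\<omega>. transition_op P t T g (\<omega> t))"
    and "A \<in> sets (path_filtration T t) \<Longrightarrow>
      (\<integral>\<omega>\<in>A. g (\<omega> T) \<partial>P s x) = (\<integral>\<omega>\<in>A. transition_op P t T g (\<omega> t) \<partial>P s x)"
proof -
  have t0: "t \<in> {0..T}" using s t by auto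
  have h: "(\<lambda>(q :: real, y). g y) \<in> borel_measurable (borel \<Otimes>\<^sub>M borel)"
    using g by (auto simp: case_prod_beta' intro: measurable_compose[OF measurable_snd])
  have c: "max t (min T T) = T" using t0 by auto
  interpret R: prob_space "return borel T" by (rule prob_space_return) simp
  have cm: "(\<lambda>q. \<omega> (max t (min T q))) \<in> borel_measurable borel" if "\<omega> \<in> space (P r y)" "r \<in> {0..T}" for \<omega> r y
  proof -
    have "(\<lambda>(\<omega>, q). (\<lambda>(q::real) y. y) q (\<omega> (max t (min T q)))) \<in> borel_measurable (P r y \<Otimes>\<^sub>M borel)"
      by (rule measurable_clamped_process[OF t0 that(2) refl]) (simp add: case_prod_beta')
    from measurable_compose[OF measurable_Pair1'[OF that(1)] this] show ?thesis by simp
  qed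
  have fin: "(\<integral>\<^sup>+\<omega>. \<integral>\<^sup>+q. ennreal \<bar>g (\<omega> (max t (min T q)))\<bar> \<partial>return borel T \<partial>P r y) < \<infinity>" if r: "r \<in> {0..T}" for r y
  proof -
    have "(\<integral>\<^sup>+\<omega>. \<integral>\<^sup>+q. ennreal \<bar>g (\<omega> (max t (min T q)))\<bar> \<partial>return borel T \<partial>P r y) = (\<integral>\<^sup>+\<omega>. ennreal \<bar>g (\<omega> T)\<bar> \<partial>P r y)"
      by (intro nn_integral_cong, subst nn_integral_return)
         (use c measurable_compose[OF cm[OF _ r] g] in auto)
    also have "\<dots> < \<infinity>" using int[OF r, of y] by (simp add: integrable_iff_bounded)
    finally show ?thesis .
  qed
  have I: "(\<integral>q. g (\<omega> (max t (min T q))) \<partial>return borel T) = g (\<omega> T)" if "\<omega> \<in> space (P r y)" "r \<in> {0..T}" for \<omega> r y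
    by (subst integral_return) (use c measurable_compose[OF cm[OF that] g] in auto)
  have J: "(\<integral>\<omega>. (\<integral>q. g (\<omega> (max t (min T q))) \<partial>return borel T) \<partial>P t y) = transition_op P t T g y" for y
    unfolding transition_op_def by (intro Bochner_Integration.integral_cong refl I[OF _ t0])
  note * = markov_additive[OF s t R.sigma_finite_measure_axioms _ h fin[OF t0] fin[OF s, of x]]
  show "transition_op P t T g \<in> borel_measurable borel" "integrable (P s x) (\<lambda>\<omega>. transition_op P t T g (\<omega> t))"
    using *(1,3) unfolding J by simp_all
  assume A: "A \<in> sets (path_filtration T t)"
  have "(\<integral>\<omega>\<in>A. (\<integral>q. g (\<omega> (max t (min T q))) \<partial>return borel T) \<partial>P s x) = (\<integral>\<omega>\<in>A. g (\<omega> T) \<partial>P s x)"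
    unfolding set_lebesgue_integral_def by (intro Bochner_Integration.integral_cong refl) (simp add: I[OF _ s])
  then show "(\<integral>\<omega>\<in>A. g (\<omega> T) \<partial>P s x) = (\<integral>\<omega>\<in>A. transition_op P t T g (\<omega> t) \<partial>P s x)"
    using *(4)[OF _ A] unfolding J by simp
qed

end

section \<open>The identification problem\<close>

lemma square_integrable_bound_AE:
  assumes "square_integrable M f" "h \<in> borel_measurable M" "AE x in M. \<bar>h x\<bar> \<le> \<bar>f x\<bar>"
  shows "square_integrable M h"
proof -
  have "integrable M (\<lambda>x. (h x)\<^sup>2)"
  proof (rule Bochner_Integration.integrable_bound)
    show "integrable M (\<lambda>x. (f x)\<^sup>2)" using assms(1) by (simp add: square_integrable_def)
    show "AE x in M. norm ((h x)\<^sup>2) \<le> norm ((f x)\<^sup>2)"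
      using assms(3) by eventually_elim (simp add: abs_le_square_iff)
  qed (use assms(2) in measurable)
  with assms(2) show ?thesis by (simp add: square_integrable_def)
qed

text \<open>The square \<open>{t..T} \<times> {t..T}\<close> is cut along the diagonal. The two
  triangles carry equal integrals by symmetry of \<open>k q * k r\<close>, and the diagonal is
  negligible in each section.\<close>

lemma square_integral_triangle:
  fixes h :: "real \<Rightarrow> real"
  assumes h: "set_integrable lborel {t..T} h"
  shows "(LBINT q:{t..T}. h q)\<^sup>2 = 2 * (LBINT q:{t..T}. h q * (LBINT r:{q..T}. h r))"
proof -
  define k where "k q = indicator {t..T} q * h q" for q
  have k: "integrable lborel k" using h by (simp add: set_integrable_def k_def[abs_def])
  have [measurable]: "k \<in> borel_measurable borel" using k by auto
  have int: "integrable (lborel \<Otimes>\<^sub>M lborel) (\<lambda>(q, r). e q r * (k q * k r))"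
    if e: "(\<lambda>(q, r). e q r) \<in> borel_measurable (lborel \<Otimes>\<^sub>M lborel)" "\<And>q r. \<bar>e q r\<bar> \<le> 1" for e :: "real \<Rightarrow> real \<Rightarrow> real"
  proof (rule Bochner_Integration.integrable_bound)
    show "integrable (lborel \<Otimes>\<^sub>M lborel) (\<lambda>(q, r). k q * k r)"
      by (rule lborel_pair.Fubini_integrable) (use k in \<open>auto simp: abs_mult\<close>)
    show "(\<lambda>(q, r). e q r * (k q * k r)) \<in> borel_measurable (lborel \<Otimes>\<^sub>M lborel)"
      using e(1) by (auto simp: case_prod_beta')
    show "AE x in lborel \<Otimes>\<^sub>M lborel. norm (case x of (q, r) \<Rightarrow> e q r * (k q * k r)) \<le> norm (case x of (q, r) \<Rightarrow> k q * k r)"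
      using mult_right_mono[OF e(2), of "\<bar>k _ * k _\<bar>"] by (intro AE_I2) (auto simp: abs_mult)
  qed
  let ?le = "\<lambda>q r :: real. if q \<le> r then 1 else 0 :: real" and ?gt = "\<lambda>q r :: real. if r < q then 1 else 0 :: real"
  have le: "integrable (lborel \<Otimes>\<^sub>M lborel) (\<lambda>(q, r). ?le q r * (k q * k r))" by (rule int) auto
  have gt: "integrable (lborel \<Otimes>\<^sub>M lborel) (\<lambda>(q, r). ?gt q r * (k q * k r))" by (rule int) auto
  define X where "X = (\<integral>q. k q * (\<integral>r. ?le q r * k r \<partial>lborel) \<partial>lborel)"
  have le': "(\<integral>z. (case z of (q, r) \<Rightarrow> ?le q r * (k q * k r)) \<partial>(lborel \<Otimes>\<^sub>M lborel)) = X"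
    using lborel_pair.integral_fst'[OF le] unfolding X_def by (simp add: mult.left_commute[of _ "k _"] mult.assoc)
  have gt': "(\<integral>z. (case z of (q, r) \<Rightarrow> ?gt q r * (k q * k r)) \<partial>(lborel \<Otimes>\<^sub>M lborel)) = X"
  proof -
    have "(\<integral>z. (case z of (q, r) \<Rightarrow> ?gt q r * (k q * k r)) \<partial>(lborel \<Otimes>\<^sub>M lborel))
      = (\<integral>r. (\<integral>q. ?gt q r * (k q * k r) \<partial>lborel) \<partial>lborel)"
      by (rule lborel_pair.integral_snd[OF gt, symmetric])
    also have "\<dots> = (\<integral>r. k r * (\<integral>q. ?gt q r * k q \<partial>lborel) \<partial>lborel)"
      by (subst integral_mult_right_zero[symmetric]) (simp add: ac_simps)
    also have "\<dots> = (\<integral>r. k r * (\<integral>q. ?le r q * k q \<partial>lborel) \<partial>lborel)"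
    proof (intro Bochner_Integration.integral_cong refl)
      fix r :: real
      have "(\<integral>q. ?gt q r * k q \<partial>lborel) = (\<integral>q. ?le r q * k q \<partial>lborel)"
      proof (rule integral_cong_AE)
        show "AE q in lborel. ?gt q r * k q = ?le r q * k q"
          by (rule AE_mp[OF AE_lborel_singleton[of r]]) auto
      qed auto
      then show "k r * (\<integral>q. ?gt q r * k q \<partial>lborel) = k r * (\<integral>q. ?le r q * k q \<partial>lborel)" by simp
    qed
    also have "\<dots> = X" unfolding X_def ..
    finally show ?thesis .
  qed
  have "(LBINT q:{t..T}. h q)\<^sup>2 = (\<integral>q. k q \<partial>lborel) * (\<integral>r. k r \<partial>lborel)"
    unfolding set_lebesgue_integral_def k_def power2_eq_square by simp
  also have "\<dots> = (\<integral>q. (\<integral>r. k q * k r \<partial>lborel) \<partial>lborel)" by simp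
  also have "\<dots> = (\<integral>z. (case z of (q, r) \<Rightarrow> k q * k r) \<partial>(lborel \<Otimes>\<^sub>M lborel))"
    using lborel_pair.integral_fst'[OF int[of "\<lambda>_ _. 1"]] by simp
  also have "\<dots> = (\<integral>z. (case z of (q, r) \<Rightarrow> ?le q r * (k q * k r)) + (case z of (q, r) \<Rightarrow> ?gt q r * (k q * k r)) \<partial>(lborel \<Otimes>\<^sub>M lborel))"
    by (intro Bochner_Integration.integral_cong) auto
  also have "\<dots> = 2 * X" using le gt le' gt' by simp
  also have "X = (LBINT q:{t..T}. h q * (LBINT r:{q..T}. h r))"
    unfolding X_def set_lebesgue_integral_def
  proof (intro Bochner_Integration.integral_cong refl)
    fix q
    have "k q * (\<integral>r. ?le q r * k r \<partial>lborel) = k q * (\<integral>r. indicator {q..T} r *\<^sub>R h r \<partial>lborel)"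
    proof (cases "q \<in> {t..T}")
      case True
      then have "?le q r * k r = indicator {q..T} r *\<^sub>R h r" for r by (auto simp: k_def indicator_def)
      then show ?thesis by simp
    qed (simp add: k_def)
    then show "k q * (\<integral>r. ?le q r * k r \<partial>lborel) = indicator {t..T} q *\<^sub>R (h q * (\<integral>r. indicator {q..T} r *\<^sub>R h r \<partial>lborel))"
      by (simp add: k_def)
  qed
  finally show ?thesis .
qed

text \<open>\<open>F\<close> stands for the composite of \<open>f\<close> with \<open>u\<close> and
  \<open>v\<close>, which turns both equations into identities between fixed functions; the growth
  of \<open>f\<close> is condensed into \<open>F2\<close>.\<close>

locale identification = markov_class T p P
  for T :: real and p :: "real \<Rightarrow> 'e::polish_space \<Rightarrow> real \<Rightarrow> 'e measure" and P +
  fixes F u v :: "real \<Rightarrow> 'e \<Rightarrow> real" and g :: "'e \<Rightarrow> real"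
  assumes F_borel: "F \<in> borel_funs T" and u_borel: "u \<in> borel_funs T" and v_borel: "v \<in> borel_funs T"
    and F2: "path_integrable (\<lambda>r y. (F r y)\<^sup>2)"
    and u2: "path_integrable (\<lambda>r y. (u r y)\<^sup>2)"
    and v2: "path_integrable (\<lambda>r y. (v r y)\<^sup>2)"
    and g_borel: "g \<in> borel_measurable borel"
    and g2: "\<And>s x. s \<in> {0..T} \<Longrightarrow> integrable (P s x) (\<lambda>\<omega>. (g (\<omega> T))\<^sup>2)"
    and IP1: "\<And>s x. s \<in> {0..T} \<Longrightarrow>
      u s x = transition_op P s T g x + (LBINT r:{s..T}. transition_op P s r (F r) x)"
    and IP2: "\<And>s x. s \<in> {0..T} \<Longrightarrow>
      (u s x)\<^sup>2 = transition_op P s T (\<lambda>y. (g y)\<^sup>2) x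
        - (LBINT r:{s..T}. transition_op P s r (\<lambda>y. (v r y)\<^sup>2 - 2 * u r y * F r y) x)"
begin

lemma F1: "path_integrable F"
proof (rule path_integrable_bound[OF F2 path_integrable_one F_borel])
  fix r y
  have "0 \<le> (\<bar>F r y\<bar> - 1)\<^sup>2" by simp
  then have "2 * \<bar>F r y\<bar> \<le> 1 + (F r y)\<^sup>2" by (simp add: power2_diff)
  then show "\<bar>F r y\<bar> \<le> \<bar>(F r y)\<^sup>2\<bar> + \<bar>1\<bar>" by simp
qed

lemma uF: "path_integrable (\<lambda>r y. u r y * F r y)"
proof (rule path_integrable_bound[OF u2 F2])
  show "(\<lambda>r y. u r y * F r y) \<in> borel_funs T" by (intro borel_funs_mult u_borel F_borel)
  fix r y
  have "2 * (\<bar>u r y\<bar> * \<bar>F r y\<bar>) \<le> (u r y)\<^sup>2 + (F r y)\<^sup>2"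
    using sum_squares_bound[of "\<bar>u r y\<bar>" "\<bar>F r y\<bar>"] by (simp add: mult.assoc)
  moreover have "0 \<le> \<bar>u r y\<bar> * \<bar>F r y\<bar>" by simp
  ultimately show "\<bar>u r y * F r y\<bar> \<le> \<bar>(u r y)\<^sup>2\<bar> + \<bar>(F r y)\<^sup>2\<bar>" unfolding abs_mult abs_power2 by linarith
qed

lemma v2uF: "path_integrable (\<lambda>r y. (v r y)\<^sup>2 - 2 * u r y * F r y)"
proof (rule path_integrable_bound[OF v2])
  show "path_integrable (\<lambda>r y. (u r y)\<^sup>2 + (F r y)\<^sup>2)"
    by (rule path_integrable_bound[OF u2 F2]) (auto intro!: borel_funs_add borel_funs_power u_borel F_borel)
  show "(\<lambda>r y. (v r y)\<^sup>2 - 2 * u r y * F r y) \<in> borel_funs T"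
    by (intro borel_funs_diff borel_funs_mult borel_funs_cmult borel_funs_power u_borel F_borel v_borel)
  fix r y
  have "\<bar>2 * u r y * F r y\<bar> \<le> (u r y)\<^sup>2 + (F r y)\<^sup>2"
    using sum_squares_bound[of "\<bar>u r y\<bar>" "\<bar>F r y\<bar>"] by (simp add: abs_mult)
  then show "\<bar>(v r y)\<^sup>2 - 2 * u r y * F r y\<bar> \<le> \<bar>(v r y)\<^sup>2\<bar> + \<bar>(u r y)\<^sup>2 + (F r y)\<^sup>2\<bar>"
    using abs_triangle_ineq4[of "(v r y)\<^sup>2" "2 * u r y * F r y"] by simp
qed

lemma g1: "s \<in> {0..T} \<Longrightarrow> integrable (P s x) (\<lambda>\<omega>. g (\<omega> T))"
proof -
  assume s: "s \<in> {0..T}"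
  interpret Q: prob_space "P s x" by (rule prob_P[OF s])
  show ?thesis
    by (rule Q.square_integrable_integrable)
       (use g2[OF s] measurable_compose[OF eval_P[OF s] g_borel] T_pos in \<open>auto simp: square_integrable_def\<close>)
qed

end

section \<open>The two equations under a fixed starting point\<close>

locale identification_at = identification T p P F u v g
  for T :: real and p :: "real \<Rightarrow> 'e::polish_space \<Rightarrow> real \<Rightarrow> 'e measure" and P F u v g +
  fixes s :: real and x :: 'e
  assumes s: "s \<in> {0..T}"
begin

sublocale B: filtered_prob_space "P s x" "path_filtration T" T by (rule filtered_P[OF s])

abbreviation "Q \<equiv> P s x"

definition U where "U t \<omega> = u t (\<omega> t)"
definition I where "I a b \<omega> = (LBINT r:{a..b}. F r (\<omega> r))"
definition V where "V a b \<omega> = (LBINT r:{a..b}. (v r (\<omega> r))\<^sup>2)"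
definition G where "G \<omega> = g (\<omega> T)"
text \<open>A quantity depending on the future of the path, with conditional expectation
  \<open>U t\<close> at time \<open>t\<close>.\<close>

definition \<eta> where "\<eta> t \<omega> = G \<omega> + I t T \<omega>"
definition W where "W \<omega> = (LBINT r:{s..T}. \<bar>F r (\<omega> r)\<bar>)"

lemma st0: "t \<in> {s..T} \<Longrightarrow> t \<in> {0..T}" using s by auto

lemma U_F: "t \<in> {0..T} \<Longrightarrow> U t \<in> borel_measurable (path_filtration T t)"
  unfolding U_def[abs_def]
  by (intro measurable_path_filtration measurable_compose[OF measurable_eval borel_funs_section[OF u_borel]]) auto

lemma U_m: "t \<in> {0..T} \<Longrightarrow> U t \<in> borel_measurable Q"
  using B.measurable_F_M U_F by blast

lemma I_F: "0 \<le> a \<Longrightarrow> 0 \<le> b \<Longrightarrow> b \<le> T \<Longrightarrow> I a b \<in> borel_measurable (path_filtration T b)"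
  unfolding I_def[abs_def] by (intro measurable_path_filtration measurable_path_integral F_borel) auto

lemma V_F: "0 \<le> a \<Longrightarrow> 0 \<le> b \<Longrightarrow> b \<le> T \<Longrightarrow> V a b \<in> borel_measurable (path_filtration T b)"
  unfolding V_def[abs_def] by (intro measurable_path_filtration measurable_path_integral borel_funs_power v_borel) auto

lemma I_m: "0 \<le> a \<Longrightarrow> b \<le> T \<Longrightarrow> I a b \<in> borel_measurable Q"
  unfolding I_def[abs_def] by (rule path_integral_P[OF F_borel s])

lemma V_m: "0 \<le> a \<Longrightarrow> b \<le> T \<Longrightarrow> V a b \<in> borel_measurable Q"
  unfolding V_def[abs_def] by (rule path_integral_P[OF borel_funs_power[OF v_borel] s])

lemma G_m: "G \<in> borel_measurable Q"
  unfolding G_def[abs_def] using measurable_compose[OF eval_P[OF s] g_borel] T_pos by simp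

text \<open>The first equation at the random point \<open>(t, \<omega> t)\<close>: the terminal and
  the running term are conditional expectations by the Markov property, and so is their sum.\<close>

lemma U_eq:
  assumes t: "t \<in> {s..T}"
  shows "integrable Q (\<eta> t)" "integrable Q (U t)"
    and "A \<in> sets (path_filtration T t) \<Longrightarrow> (\<integral>\<omega>\<in>A. \<eta> t \<omega> \<partial>Q) = (\<integral>\<omega>\<in>A. U t \<omega> \<partial>Q)"
proof -
  note t0 = st0[OF t]
  note f = markov_time_integral[OF F1 s t]
  note gg = markov_terminal[OF g_borel g1 s t]
  have U: "U t = (\<lambda>\<omega>. transition_op P t T g (\<omega> t) + (LBINT q:{t..T}. transition_op P t q (F q) (\<omega> t)))"
    unfolding U_def using IP1[OF t0] by auto
  show "integrable Q (\<eta> t)" unfolding \<eta>_def G_def I_def using f(2) g1[OF s] by auto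
  show "integrable Q (U t)" unfolding U using f(3) gg(2) by auto
  assume A: "A \<in> sets (path_filtration T t)"
  have AQ: "A \<in> sets Q" using B.sets_F_M[OF t0 A] .
  have si: "set_integrable Q A k" if "integrable Q k" for k :: "_ \<Rightarrow> real"
    using that AQ unfolding set_integrable_def by (rule integrable_mult_indicator[rotated])
  show "(\<integral>\<omega>\<in>A. \<eta> t \<omega> \<partial>Q) = (\<integral>\<omega>\<in>A. U t \<omega> \<partial>Q)"
    unfolding U \<eta>_def G_def I_def using f(2,3,4) gg(2,3) g1[OF s] A
    by (subst (1 2) set_integral_add) (auto intro!: si)
qed

lemma U2_eq:
  assumes t: "t \<in> {s..T}"
  shows "integrable Q (\<lambda>\<omega>. (U t \<omega>)\<^sup>2)" "integrable Q (\<lambda>\<omega>. LBINT q:{t..T}. (v q (\<omega> q))\<^sup>2 - 2 * u q (\<omega> q) * F q (\<omega> q))"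
    and "A \<in> sets (path_filtration T t) \<Longrightarrow>
      (\<integral>\<omega>\<in>A. (G \<omega>)\<^sup>2 - (LBINT q:{t..T}. (v q (\<omega> q))\<^sup>2 - 2 * u q (\<omega> q) * F q (\<omega> q)) \<partial>Q) = (\<integral>\<omega>\<in>A. (U t \<omega>)\<^sup>2 \<partial>Q)"
proof -
  note t0 = st0[OF t]
  note f = markov_time_integral[OF v2uF s t]
  have g2b: "(\<lambda>y. (g y)\<^sup>2) \<in> borel_measurable borel" using g_borel by simp
  note gg = markov_terminal[OF g2b g2 s t]
  have U: "(U t \<omega>)\<^sup>2 = transition_op P t T (\<lambda>y. (g y)\<^sup>2) (\<omega> t) - (LBINT q:{t..T}. transition_op P t q (\<lambda>y. (v q y)\<^sup>2 - 2 * u q y * F q y) (\<omega> t))" for \<omega>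
    unfolding U_def using IP2[OF t0] by auto
  show "integrable Q (\<lambda>\<omega>. (U t \<omega>)\<^sup>2)" unfolding U using f(3) gg(2) by auto
  show "integrable Q (\<lambda>\<omega>. LBINT q:{t..T}. (v q (\<omega> q))\<^sup>2 - 2 * u q (\<omega> q) * F q (\<omega> q))" by (rule f(2))
  assume A: "A \<in> sets (path_filtration T t)"
  have AQ: "A \<in> sets Q" using B.sets_F_M[OF t0 A] .
  have si: "set_integrable Q A k" if "integrable Q k" for k :: "_ \<Rightarrow> real"
    using that AQ unfolding set_integrable_def by (rule integrable_mult_indicator[rotated])
  show "(\<integral>\<omega>\<in>A. (G \<omega>)\<^sup>2 - (LBINT q:{t..T}. (v q (\<omega> q))\<^sup>2 - 2 * u q (\<omega> q) * F q (\<omega> q)) \<partial>Q) = (\<integral>\<omega>\<in>A. (U t \<omega>)\<^sup>2 \<partial>Q)"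
    unfolding U G_def using f(2,3,4) gg(2,3) g2[OF s] A
    by (subst (1 2) set_integral_diff) (auto intro!: si)
qed

lemma U_L2: "t \<in> {s..T} \<Longrightarrow> square_integrable Q (U t)"
  using U2_eq(1) U_m[OF st0] by (simp add: square_integrable_def)

lemma G_L2: "square_integrable Q G"
  using g2[OF s] G_m by (simp add: square_integrable_def G_def)

lemma F_path: "AE \<omega> in Q. set_integrable lborel {s..T} (\<lambda>r. F r (\<omega> r))"
  by (rule path_set_integrable[OF F1 s])

lemma v_path: "AE \<omega> in Q. set_integrable lborel {s..T} (\<lambda>r. (v r (\<omega> r))\<^sup>2)"
  by (rule path_set_integrable[OF v2 s])

lemma uF_path: "AE \<omega> in Q. set_integrable lborel {s..T} (\<lambda>r. u r (\<omega> r) * F r (\<omega> r))"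
  by (rule path_set_integrable[OF uF s])

lemma W_m: "W \<in> borel_measurable Q"
  unfolding W_def[abs_def] by (rule path_integral_P[OF borel_funs_abs[OF F_borel] s]) (use s in auto)

text \<open>Cauchy-Schwarz in time, at the cost of the factor \<open>T - s\<close>. Square
  integrability of this one variable dominates all partial integrals \<open>I a b\<close> at
  once.\<close>

lemma W_L2: "square_integrable Q W"
proof -
  have "AE \<omega> in Q. ennreal ((W \<omega>)\<^sup>2) \<le> (\<integral>\<^sup>+r\<in>{s..T}. ennreal ((F r (\<omega> r))\<^sup>2) \<partial>lborel) * ennreal (T - s)"
    using F_path
  proof eventually_elim
    case (elim \<omega>)
    let ?h = "\<lambda>r. indicator {s..T} r * \<bar>F r (\<omega> r)\<bar>"
    have h: "integrable lborel ?h"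
      using set_integrable_abs[OF elim] by (simp add: set_integrable_def)
    have W: "ennreal (W \<omega>) = (\<integral>\<^sup>+r. ennreal (?h r) \<partial>lborel)"
      unfolding W_def set_lebesgue_integral_def using nn_integral_eq_integral[OF h] by simp
    have "ennreal ((W \<omega>)\<^sup>2) = (ennreal (W \<omega>))\<^sup>2"
      unfolding W_def set_lebesgue_integral_def by (simp add: ennreal_power Bochner_Integration.integral_nonneg)
    also have "\<dots> = (\<integral>\<^sup>+r. ennreal (?h r) * indicator {s..T} r \<partial>lborel)\<^sup>2"
      unfolding W by (intro arg_cong[where f="\<lambda>x. x\<^sup>2"] nn_integral_cong) (auto simp: indicator_def)
    also have "\<dots> \<le> (\<integral>\<^sup>+r. (ennreal (?h r))\<^sup>2 \<partial>lborel) * (\<integral>\<^sup>+r. (indicator {s..T} r)\<^sup>2 \<partial>lborel)"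
      by (rule Cauchy_Schwarz_nn_integral) (use h in auto)
    also have "(\<integral>\<^sup>+r. (ennreal (?h r))\<^sup>2 \<partial>lborel) = (\<integral>\<^sup>+r\<in>{s..T}. ennreal ((F r (\<omega> r))\<^sup>2) \<partial>lborel)"
      by (intro nn_integral_cong) (auto simp: indicator_def ennreal_power)
    also have "(\<integral>\<^sup>+r. (indicator {s..T} r)\<^sup>2 \<partial>lborel) = (\<integral>\<^sup>+r. indicator {s..T} r \<partial>lborel)"
      by (intro nn_integral_cong) (auto simp: indicator_def)
    also have "\<dots> = ennreal (T - s)" using s by simp
    finally show ?case .
  qed
  then have "(\<integral>\<^sup>+\<omega>. ennreal ((W \<omega>)\<^sup>2) \<partial>Q) \<le> (\<integral>\<^sup>+\<omega>. (\<integral>\<^sup>+r\<in>{s..T}. ennreal ((F r (\<omega> r))\<^sup>2) \<partial>lborel) * ennreal (T - s) \<partial>Q)"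
    by (rule nn_integral_mono_AE)
  also have "\<dots> = (\<integral>\<^sup>+\<omega>. (\<integral>\<^sup>+r\<in>{s..T}. ennreal ((F r (\<omega> r))\<^sup>2) \<partial>lborel) \<partial>Q) * ennreal (T - s)"
    by (rule nn_integral_multc, rule path_nn_integral_P[OF borel_funs_power[OF F_borel] s]) (use s in auto)
  also have "\<dots> < \<infinity>"
    using path_integrable_fin[OF F2 s, of x] by (simp add: ennreal_mult_less_top)
  finally have "integrable Q (\<lambda>\<omega>. (W \<omega>)\<^sup>2)"
    by (intro integrableI_nonneg) (use W_m in auto)
  then show ?thesis using W_m by (simp add: square_integrable_def)
qed

lemma I_le_W:
  assumes "set_integrable lborel {s..T} (\<lambda>r. F r (\<omega> r))" "s \<le> a" "b \<le> T"
  shows "\<bar>I a b \<omega>\<bar> \<le> W \<omega>"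
proof -
  have i: "set_integrable lborel {a..b} (\<lambda>r. F r (\<omega> r))"
    by (rule set_integrable_subset[OF assms(1)]) (use assms in auto)
  have "\<bar>I a b \<omega>\<bar> \<le> (LBINT r:{a..b}. \<bar>F r (\<omega> r)\<bar>)"
    using set_integral_norm_bound[OF i] by (simp add: I_def)
  also have "\<dots> \<le> W \<omega>"
    unfolding W_def set_lebesgue_integral_def
    by (rule integral_mono)
       (use set_integrable_abs[OF i] set_integrable_abs[OF assms(1)] assms in \<open>auto simp: set_integrable_def indicator_def\<close>)
  finally show ?thesis .
qed

lemma I_L2: "s \<le> a \<Longrightarrow> b \<le> T \<Longrightarrow> square_integrable Q (I a b)"
  by (rule square_integrable_bound_AE[OF W_L2 I_m])
     (use s F_path in \<open>auto elim!: eventually_mono intro: order_trans[OF I_le_W abs_ge_self]\<close>)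

lemma \<eta>_L2: "s \<le> t \<Longrightarrow> square_integrable Q (\<eta> t)"
  unfolding \<eta>_def[abs_def] by (intro square_integrable_add G_L2 I_L2) auto

end

section \<open>Conditioning the square of the candidate martingale\<close>

lemma LBINT_split_at:
  fixes h :: "real \<Rightarrow> real"
  assumes h: "set_integrable lborel {s..T} h" and t: "s \<le> t" "t \<le> T"
  shows "(LBINT r:{s..T}. h r) = (LBINT r:{s..t}. h r) + (LBINT r:{t..T}. h r)"
proof -
  have h': "set_integrable lborel {t..T} h" by (rule set_integrable_subset[OF h]) (use t in auto)
  show ?thesis
    using indefinite_integral_increment[OF h t(1) t(2) order_refl]
      indefinite_integral_increment[OF h' order_refl t(2) order_refl] LBINT_singleton_eq_0[of t h] by simp
qed

context identification_at
begin

lemma set_integrable_Q: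
  "t \<in> {0..T} \<Longrightarrow> A \<in> sets (path_filtration T t) \<Longrightarrow> integrable Q k \<Longrightarrow> set_integrable Q A (k :: _ \<Rightarrow> real)"
  unfolding set_integrable_def using B.sets_F_M by (intro integrable_mult_indicator) auto

text \<open>Integrating the absolute value over time gives at most
  \<open>(\<bar>G\<bar> + W) * W\<close>, a product of two square integrable variables.\<close>

lemma F_eta_product_integrable:
  assumes t: "t \<in> {s..T}" and A: "A \<in> sets (path_filtration T t)"
  shows "integrable (Q \<Otimes>\<^sub>M lborel) (\<lambda>(\<omega>, q). indicator A \<omega> * (indicator {t..T} q * F q (\<omega> q) * \<eta> q \<omega>))"
proof -
  note t0 = st0[OF t]
  have AQ: "A \<in> sets Q" using B.sets_F_M[OF t0 A] .
  interpret pair_sigma_finite Q lborel ..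
  let ?f = "\<lambda>\<omega> q. indicator {t..T} q * F q (\<omega> q) :: real"
  let ?z = "\<lambda>(\<omega>, q). indicat_real A \<omega> * (?f \<omega> q * \<eta> q \<omega>)"
  have fm: "(\<lambda>(\<omega>, q). ?f \<omega> q) \<in> borel_measurable (Q \<Otimes>\<^sub>M lborel)"
    by (rule path_process_P[OF F_borel s]) (use t0 in auto)
  \<comment> \<open>Moving the lower limit \<open>q\<close> into the integrand makes
    \<open>I q T \<omega>\<close> visibly measurable in \<open>(\<omega>, q)\<close> jointly. The
    formula is valid for \<open>q\<close> in \<open>{t..T}\<close>, which the indicator in
    \<open>?z\<close> ensures.\<close>
  have I_eq: "(\<integral>r. (if q \<le> r then 1 else 0) * ?f \<omega> r \<partial>lborel) = I q T \<omega>" if "q \<in> {t..T}" for \<omega> q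
    unfolding I_def set_lebesgue_integral_def
    by (intro Bochner_Integration.integral_cong) (use that in \<open>auto simp: indicator_def\<close>)
  have "(\<lambda>(z, r). (if snd z \<le> r then 1 else 0) * ?f (fst z) r) \<in> borel_measurable ((Q \<Otimes>\<^sub>M lborel) \<Otimes>\<^sub>M lborel)"
  proof -
    have "(\<lambda>y. (fst (fst y), snd y)) \<in> measurable ((Q \<Otimes>\<^sub>M (lborel :: real measure)) \<Otimes>\<^sub>M lborel) (Q \<Otimes>\<^sub>M lborel)"
      by measurable
    from measurable_compose[OF this fm]
    have "(\<lambda>y. ?f (fst (fst y)) (snd y)) \<in> borel_measurable ((Q \<Otimes>\<^sub>M (lborel :: real measure)) \<Otimes>\<^sub>M lborel)" by simp
    then show ?thesis by (auto simp: case_prod_beta')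
  qed
  from lborel.borel_measurable_lebesgue_integral[OF this]
  have Im: "(\<lambda>z. \<integral>r. (if snd z \<le> r then 1 else 0) * ?f (fst z) r \<partial>lborel) \<in> borel_measurable (Q \<Otimes>\<^sub>M lborel)" .
  have zm: "?z \<in> borel_measurable (Q \<Otimes>\<^sub>M lborel)"
  proof -
    have "(\<lambda>z. indicat_real A (fst z) * (?f (fst z) (snd z) * (G (fst z) + (\<integral>r. (if snd z \<le> r then 1 else 0) * ?f (fst z) r \<partial>lborel))))
        \<in> borel_measurable (Q \<Otimes>\<^sub>M lborel)"
    proof (rule borel_measurable_times[OF _ borel_measurable_times[OF _ borel_measurable_add[OF _ Im]]])
      show "(\<lambda>z. indicat_real A (fst z)) \<in> borel_measurable (Q \<Otimes>\<^sub>M lborel)"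
        by (rule measurable_compose[OF measurable_fst]) (use AQ in simp)
      show "(\<lambda>z. G (fst z)) \<in> borel_measurable (Q \<Otimes>\<^sub>M lborel)"
        by (rule measurable_compose[OF measurable_fst G_m])
    qed (use fm in \<open>simp add: case_prod_beta'\<close>)
    also have "(\<lambda>z. indicat_real A (fst z) * (?f (fst z) (snd z) * (G (fst z) + (\<integral>r. (if snd z \<le> r then 1 else 0) * ?f (fst z) r \<partial>lborel)))) = ?z"
    proof
      fix z show "indicat_real A (fst z) * (?f (fst z) (snd z) * (G (fst z) + (\<integral>r. (if snd z \<le> r then 1 else 0) * ?f (fst z) r \<partial>lborel))) = ?z z"
        by (cases "snd z \<in> {t..T}") (simp_all add: I_eq \<eta>_def case_prod_beta')
    qed
    finally show ?thesis .
  qed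
  have sec: "integrable lborel (\<lambda>q. ?z (\<omega>, q)) \<and> (\<integral>q. norm (?z (\<omega>, q)) \<partial>lborel) \<le> (\<bar>G \<omega>\<bar> + W \<omega>) * W \<omega>"
    if \<omega>: "\<omega> \<in> space Q" and i: "set_integrable lborel {s..T} (\<lambda>r. F r (\<omega> r))" for \<omega>
  proof -
    have "set_integrable lborel {t..T} (\<lambda>r. \<bar>F r (\<omega> r)\<bar>)"
      by (rule set_integrable_abs, rule set_integrable_subset[OF i]) (use t in auto)
    then have b: "integrable lborel (\<lambda>q. (\<bar>G \<omega>\<bar> + W \<omega>) * (indicator {t..T} q * \<bar>F q (\<omega> q)\<bar>))"
      by (simp add: set_integrable_def)
    have le: "norm (?z (\<omega>, q)) \<le> (\<bar>G \<omega>\<bar> + W \<omega>) * (indicator {t..T} q * \<bar>F q (\<omega> q)\<bar>)" for q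
    proof (cases "q \<in> {t..T}")
      case True
      then have "\<bar>\<eta> q \<omega>\<bar> \<le> \<bar>G \<omega>\<bar> + W \<omega>"
        unfolding \<eta>_def using I_le_W[OF i, of q T] t by auto
      then have "\<bar>F q (\<omega> q)\<bar> * \<bar>\<eta> q \<omega>\<bar> \<le> (\<bar>G \<omega>\<bar> + W \<omega>) * \<bar>F q (\<omega> q)\<bar>"
        by (subst mult.commute) (rule mult_right_mono, auto)
      moreover have "0 \<le> (\<bar>G \<omega>\<bar> + W \<omega>) * \<bar>F q (\<omega> q)\<bar>"
        using I_le_W[OF i, of T T] t by (intro mult_nonneg_nonneg) auto
      ultimately show ?thesis using True by (auto simp: indicator_def abs_mult)
    qed simp
    have int: "integrable lborel (\<lambda>q. ?z (\<omega>, q))"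
      by (rule Bochner_Integration.integrable_bound[OF b])
         (use measurable_compose[OF measurable_Pair1'[OF \<omega>] zm] order_trans[OF le abs_ge_self] in \<open>auto simp del: abs_mult\<close>)
    have "(\<integral>q. norm (?z (\<omega>, q)) \<partial>lborel) \<le> (\<integral>q. (\<bar>G \<omega>\<bar> + W \<omega>) * (indicator {t..T} q * \<bar>F q (\<omega> q)\<bar>) \<partial>lborel)"
      by (intro integral_mono integrable_norm int b le)
    also have "\<dots> \<le> (\<integral>q. (\<bar>G \<omega>\<bar> + W \<omega>) * (indicator {s..T} q * \<bar>F q (\<omega> q)\<bar>) \<partial>lborel)"
    proof (rule integral_mono[OF b])
      show "integrable lborel (\<lambda>q. (\<bar>G \<omega>\<bar> + W \<omega>) * (indicator {s..T} q * \<bar>F q (\<omega> q)\<bar>))"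
        using set_integrable_abs[OF i] by (simp add: set_integrable_def)
      show "(\<bar>G \<omega>\<bar> + W \<omega>) * (indicator {t..T} q * \<bar>F q (\<omega> q)\<bar>) \<le> (\<bar>G \<omega>\<bar> + W \<omega>) * (indicator {s..T} q * \<bar>F q (\<omega> q)\<bar>)" for q
        using I_le_W[OF i, of T T] t by (intro mult_left_mono) (auto simp: indicator_def)
    qed
    also have "\<dots> = (\<bar>G \<omega>\<bar> + W \<omega>) * W \<omega>" by (simp add: W_def set_lebesgue_integral_def)
    finally show ?thesis using int by blast
  qed
  have ae: "AE \<omega> in Q. integrable lborel (\<lambda>q. ?z (\<omega>, q)) \<and> (\<integral>q. norm (?z (\<omega>, q)) \<partial>lborel) \<le> (\<bar>G \<omega>\<bar> + W \<omega>) * W \<omega>"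
    using F_path by (rule AE_mp) (intro AE_I2 impI sec)
  have "integrable Q (\<lambda>\<omega>. \<integral>q. norm (?z (\<omega>, q)) \<partial>lborel)"
  proof (rule Bochner_Integration.integrable_bound)
    show "integrable Q (\<lambda>\<omega>. (\<bar>G \<omega>\<bar> + W \<omega>) * W \<omega>)"
      by (intro square_integrable_mult_integrable square_integrable_add W_L2)
         (use G_L2 in \<open>auto simp: square_integrable_def\<close>)
    have "(\<lambda>(\<omega>, q). norm (?z (\<omega>, q))) \<in> borel_measurable (Q \<Otimes>\<^sub>M lborel)"
      using measurable_compose[OF zm borel_measurable_norm] by (simp add: case_prod_beta')
    from lborel.borel_measurable_lebesgue_integral[OF this]
    show "(\<lambda>\<omega>. \<integral>q. norm (?z (\<omega>, q)) \<partial>lborel) \<in> borel_measurable Q" .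
    show "AE \<omega> in Q. norm (\<integral>q. norm (?z (\<omega>, q)) \<partial>lborel) \<le> norm ((\<bar>G \<omega>\<bar> + W \<omega>) * W \<omega>)"
      using ae
    proof eventually_elim
      case (elim \<omega>)
      have "0 \<le> (\<integral>q. norm (?z (\<omega>, q)) \<partial>lborel)" by simp
      then show ?case using elim by (smt (verit) real_norm_def)
    qed
  qed
  moreover have "AE \<omega> in Q. integrable lborel (\<lambda>q. ?z (\<omega>, q))" using ae by eventually_elim blast
  ultimately show ?thesis by (intro Fubini_integrable zm)
qed

text \<open>After Fubini the time \<open>q\<close> is fixed. Since \<open>A\<close> is known at
  \<open>t \<le> q\<close>, the factor \<open>1_A F_q\<close> is measurable at time
  \<open>q\<close>, and \<open>\<eta> q\<close> may be replaced by its conditional expectation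
  \<open>U q\<close>.\<close>

lemma integral_F_eta:
  assumes t: "t \<in> {s..T}" and A: "A \<in> sets (path_filtration T t)"
  shows "(\<integral>\<omega>\<in>A. (LBINT q:{t..T}. F q (\<omega> q) * \<eta> q \<omega>) \<partial>Q) = (\<integral>\<omega>\<in>A. (LBINT q:{t..T}. u q (\<omega> q) * F q (\<omega> q)) \<partial>Q)"
proof -
  note t0 = st0[OF t]
  have AQ: "A \<in> sets Q" using B.sets_F_M[OF t0 A] .
  interpret pair_sigma_finite Q lborel ..
  let ?z1 = "\<lambda>\<omega> q. indicat_real A \<omega> * (indicator {t..T} q * F q (\<omega> q) * \<eta> q \<omega>)"
  let ?z2 = "\<lambda>\<omega> q. indicat_real A \<omega> * (indicator {t..T} q * (u q (\<omega> q) * F q (\<omega> q)))"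
  note z1 = F_eta_product_integrable[OF t A]
  have z2: "integrable (Q \<Otimes>\<^sub>M lborel) (\<lambda>(\<omega>, q). ?z2 \<omega> q)"
  proof (rule Bochner_Integration.integrable_bound[OF path_integrable_product[OF uF s t]])
    have "(\<lambda>z. indicat_real A (fst z)) \<in> borel_measurable (Q \<Otimes>\<^sub>M lborel)"
      by (rule measurable_compose[OF measurable_fst]) (use AQ in simp)
    then show "(\<lambda>(\<omega>, q). ?z2 \<omega> q) \<in> borel_measurable (Q \<Otimes>\<^sub>M lborel)"
      using borel_measurable_integrable[OF path_integrable_product[OF uF s t, of x]]
      by (auto simp: case_prod_beta' intro!: borel_measurable_times)
  qed (auto simp: indicator_def)
  \<comment> \<open>Square integrability of \<open>F q\<close> holds for almost every
    \<open>q\<close> only, which is enough under the time integral.\<close>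
  have F2q: "AE q in lborel. integrable Q (\<lambda>\<omega>. indicator {t..T} q * (F q (\<omega> q))\<^sup>2)"
    using AE_integrable_snd[OF path_integrable_product[OF F2 s t, of x]] by simp
  have "(\<integral>\<omega>\<in>A. (LBINT q:{t..T}. F q (\<omega> q) * \<eta> q \<omega>) \<partial>Q) = (\<integral>\<omega>. (\<integral>q. ?z1 \<omega> q \<partial>lborel) \<partial>Q)"
    unfolding set_lebesgue_integral_def by (simp add: mult.assoc)
  also have "\<dots> = (\<integral>q. (\<integral>\<omega>. ?z1 \<omega> q \<partial>Q) \<partial>lborel)"
    using Fubini_integral[OF z1] by simp
  also have "\<dots> = (\<integral>q. (\<integral>\<omega>. ?z2 \<omega> q \<partial>Q) \<partial>lborel)"
  proof (rule integral_cong_AE)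
    show "(\<lambda>q. \<integral>\<omega>. ?z1 \<omega> q \<partial>Q) \<in> borel_measurable lborel" using integrable_snd[OF z1] by auto
    show "(\<lambda>q. \<integral>\<omega>. ?z2 \<omega> q \<partial>Q) \<in> borel_measurable lborel" using integrable_snd[OF z2] by auto
    show "AE q in lborel. (\<integral>\<omega>. ?z1 \<omega> q \<partial>Q) = (\<integral>\<omega>. ?z2 \<omega> q \<partial>Q)"
      using F2q
    proof eventually_elim
      case (elim q)
      show ?case
      proof (cases "q \<in> {t..T}")
        case True
        then have q: "q \<in> {s..T}" and q0: "q \<in> {0..T}" using t s by auto
        have Aq: "A \<in> sets (path_filtration T q)" using B.filtration_mono[of t q] True t0 A by auto
        have FqF: "(\<lambda>\<omega>. F q (\<omega> q)) \<in> borel_measurable (path_filtration T q)"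
          using q0 by (intro measurable_path_filtration measurable_compose[OF measurable_eval borel_funs_section[OF F_borel]]) auto
        then have ZF: "(\<lambda>\<omega>. indicat_real A \<omega> * F q (\<omega> q)) \<in> borel_measurable (path_filtration T q)"
          using Aq by auto
        have ZL2: "square_integrable Q (\<lambda>\<omega>. indicat_real A \<omega> * F q (\<omega> q))"
        proof (rule square_integrable_bound_AE[of _ "\<lambda>\<omega>. F q (\<omega> q)"])
          show "square_integrable Q (\<lambda>\<omega>. F q (\<omega> q))"
            using elim True B.measurable_F_M[OF q0 FqF] by (simp add: square_integrable_def)
        qed (use B.measurable_F_M[OF q0 ZF] in \<open>auto simp: indicator_def\<close>)
        have "(\<integral>\<omega>. (indicat_real A \<omega> * F q (\<omega> q)) * \<eta> q \<omega> \<partial>Q) = (\<integral>\<omega>. (indicat_real A \<omega> * F q (\<omega> q)) * U q \<omega> \<partial>Q)"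
          by (rule B.integral_mult_closed(2)[OF q0 U_eq(1,2)[OF q] U_F[OF q0] U_eq(3)[OF q] ZF])
             (use q square_integrable_mult_integrable[OF ZL2 \<eta>_L2] in auto)
        then show ?thesis using True by (simp add: U_def ac_simps)
      qed simp
    qed
  qed
  also have "\<dots> = (\<integral>\<omega>. (\<integral>q. ?z2 \<omega> q \<partial>lborel) \<partial>Q)"
    using Fubini_integral[OF z2] by simp
  also have "\<dots> = (\<integral>\<omega>\<in>A. (LBINT q:{t..T}. u q (\<omega> q) * F q (\<omega> q)) \<partial>Q)"
    unfolding set_lebesgue_integral_def by (simp add: mult.assoc)
  finally show ?thesis .
qed

text \<open>In the expansion of \<open>(G + I)\<^sup>2\<close> the triangle identity turns the
  square of \<open>I\<close> into twice the integral of \<open>F * I\<close>, and the mixed term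
  \<open>2 * G * I\<close> completes \<open>F * I\<close> to \<open>F * \<eta>\<close>.\<close>

lemma eta_square:
  assumes t: "t \<in> {s..T}"
  shows "AE \<omega> in Q. (\<eta> t \<omega>)\<^sup>2 = (G \<omega>)\<^sup>2 + 2 * (LBINT q:{t..T}. F q (\<omega> q) * \<eta> q \<omega>)"
proof -
  note t0 = st0[OF t]
  interpret pair_sigma_finite Q lborel ..
  have "space Q \<in> sets (path_filtration T t)"
    using B.space_F[OF t0] by (metis sets.top)
  from AE_integrable_fst'[OF F_eta_product_integrable[OF t this]]
  have "AE \<omega> in Q. integrable lborel (\<lambda>q. indicator (space Q) \<omega> * (indicator {t..T} q * F q (\<omega> q) * \<eta> q \<omega>))" by simp
  then have "AE \<omega> in Q. set_integrable lborel {t..T} (\<lambda>q. F q (\<omega> q) * \<eta> q \<omega>)"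
    by (rule AE_mp) (auto simp: set_integrable_def mult.assoc intro!: AE_I2)
  then show ?thesis using F_path
  proof eventually_elim
    case (elim \<omega>)
    have F: "set_integrable lborel {t..T} (\<lambda>q. F q (\<omega> q))"
      by (rule set_integrable_subset[OF elim(2)]) (use t in auto)
    have "(LBINT q:{t..T}. F q (\<omega> q) * I q T \<omega>) = (LBINT q:{t..T}. F q (\<omega> q) * \<eta> q \<omega> - G \<omega> * F q (\<omega> q))"
      by (simp add: \<eta>_def algebra_simps)
    also have "\<dots> = (LBINT q:{t..T}. F q (\<omega> q) * \<eta> q \<omega>) - G \<omega> * I t T \<omega>"
      unfolding I_def using elim(1) F by (subst set_integral_diff) auto
    finally have *: "(LBINT q:{t..T}. F q (\<omega> q) * I q T \<omega>) = (LBINT q:{t..T}. F q (\<omega> q) * \<eta> q \<omega>) - G \<omega> * I t T \<omega>" .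
    have "(I t T \<omega>)\<^sup>2 = 2 * (LBINT q:{t..T}. F q (\<omega> q) * I q T \<omega>)"
      using square_integral_triangle[OF F] unfolding I_def .
    then show ?case unfolding * \<eta>_def[of t] by (simp add: power2_sum algebra_simps)
  qed
qed

lemma V_int: "t \<in> {s..T} \<Longrightarrow> integrable Q (V t T)"
  using markov_time_integral(2)[OF v2 s] by (simp add: V_def[abs_def])

text \<open>
  With \<open>\<eta> t = g (X\<^sub>T) + \<integral>\<^sub>t\<^sup>T F\<close>, the identity \<open>(\<eta> t)\<^sup>2 = g (X\<^sub>T)\<^sup>2 + 2 \<integral>\<^sub>t\<^sup>T F\<^sub>q \<eta> q dq\<close> holds pathwise and
  \<open>\<eta> q\<close> may be replaced by its conditional expectation \<open>u q X\<^sub>q\<close>; the second equation of the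
  identification problem then turns the right-hand side into \<open>u t X\<^sub>t\<^sup>2 + \<integral>\<^sub>t\<^sup>T v\<^sup>2\<close>.
\<close>

lemma eta_square_closed:
  assumes t: "t \<in> {s..T}" and A: "A \<in> sets (path_filtration T t)"
  shows "(\<integral>\<omega>\<in>A. (\<eta> t \<omega>)\<^sup>2 - V t T \<omega> \<partial>Q) = (\<integral>\<omega>\<in>A. (U t \<omega>)\<^sup>2 \<partial>Q)"
proof -
  note t0 = st0[OF t]
  have AQ: "A \<in> sets Q" using B.sets_F_M[OF t0 A] .
  note si = set_integrable_Q[OF t0 A]
  define L where "L \<omega> = (LBINT q:{t..T}. u q (\<omega> q) * F q (\<omega> q))" for \<omega>
  define H where "H \<omega> = (LBINT q:{t..T}. F q (\<omega> q) * \<eta> q \<omega>)" for \<omega>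
  have L: "integrable Q L" unfolding L_def using markov_time_integral(2)[OF uF s t] .
  have eta: "integrable Q (\<lambda>\<omega>. (\<eta> t \<omega>)\<^sup>2)" "\<eta> t \<in> borel_measurable Q" and G2: "integrable Q (\<lambda>\<omega>. (G \<omega>)\<^sup>2)"
    using \<eta>_L2[of t] t G_L2 by (auto simp: square_integrable_def)
  have Hint: "integrable Q H"
  proof -
    interpret pair_sigma_finite Q lborel ..
    have "space Q \<in> sets (path_filtration T t)"
      using B.space_F[OF t0] by (metis sets.top)
    from integrable_fst'[OF F_eta_product_integrable[OF t this]]
    have "integrable Q (\<lambda>\<omega>. \<integral>q. indicator (space Q) \<omega> * (indicator {t..T} q * F q (\<omega> q) * \<eta> q \<omega>) \<partial>lborel)" by simp
    then show ?thesis
      by (rule Bochner_Integration.integrable_cong[OF refl, THEN iffD1, rotated])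
         (auto simp: H_def set_lebesgue_integral_def mult.assoc)
  qed
  have "(\<integral>\<omega>\<in>A. (\<eta> t \<omega>)\<^sup>2 - V t T \<omega> \<partial>Q) = (\<integral>\<omega>\<in>A. (\<eta> t \<omega>)\<^sup>2 \<partial>Q) - (\<integral>\<omega>\<in>A. V t T \<omega> \<partial>Q)"
    by (rule set_integral_diff; rule si) (use eta V_int[OF t] in auto)
  also have "(\<integral>\<omega>\<in>A. (\<eta> t \<omega>)\<^sup>2 \<partial>Q) = (\<integral>\<omega>\<in>A. (G \<omega>)\<^sup>2 + 2 * H \<omega> \<partial>Q)"
  proof (rule set_lebesgue_integral_cong_AE[OF AQ])
    show "AE \<omega>\<in>A in Q. (\<eta> t \<omega>)\<^sup>2 = (G \<omega>)\<^sup>2 + 2 * H \<omega>"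
      using eta_square[OF t] by eventually_elim (simp add: H_def)
  qed (use eta G2 Hint in auto)
  also have "\<dots> = (\<integral>\<omega>\<in>A. (G \<omega>)\<^sup>2 \<partial>Q) + 2 * (\<integral>\<omega>\<in>A. H \<omega> \<partial>Q)"
    using si[OF G2] si[OF Hint] by (subst set_integral_add) auto
  also have "(\<integral>\<omega>\<in>A. H \<omega> \<partial>Q) = (\<integral>\<omega>\<in>A. L \<omega> \<partial>Q)"
    unfolding H_def L_def by (rule integral_F_eta[OF t A])
  also have "(\<integral>\<omega>\<in>A. (G \<omega>)\<^sup>2 \<partial>Q) + 2 * (\<integral>\<omega>\<in>A. L \<omega> \<partial>Q) - (\<integral>\<omega>\<in>A. V t T \<omega> \<partial>Q)
      = (\<integral>\<omega>\<in>A. (G \<omega>)\<^sup>2 - (V t T \<omega> - 2 * L \<omega>) \<partial>Q)"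
    using si[OF G2] si[OF L] si[OF V_int[OF t]] by simp
  also have "\<dots> = (\<integral>\<omega>\<in>A. (G \<omega>)\<^sup>2 - (LBINT q:{t..T}. (v q (\<omega> q))\<^sup>2 - 2 * u q (\<omega> q) * F q (\<omega> q)) \<partial>Q)"
  proof (rule set_lebesgue_integral_cong_AE[OF AQ])
    show "AE \<omega>\<in>A in Q. (G \<omega>)\<^sup>2 - (V t T \<omega> - 2 * L \<omega>)
        = (G \<omega>)\<^sup>2 - (LBINT q:{t..T}. (v q (\<omega> q))\<^sup>2 - 2 * u q (\<omega> q) * F q (\<omega> q))"
      using v_path uF_path
    proof eventually_elim
      case (elim \<omega>)
      have "set_integrable lborel {t..T} (\<lambda>r. (v r (\<omega> r))\<^sup>2)" "set_integrable lborel {t..T} (\<lambda>r. u r (\<omega> r) * F r (\<omega> r))"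
        by (rule set_integrable_subset[OF elim(1)] set_integrable_subset[OF elim(2)]; use t in auto)+
      then have "(LBINT q:{t..T}. (v q (\<omega> q))\<^sup>2 - 2 * (u q (\<omega> q) * F q (\<omega> q))) = V t T \<omega> - 2 * L \<omega>"
        unfolding V_def L_def by (subst set_integral_diff) auto
      then show ?case by (simp add: mult.assoc)
    qed
  qed (use G2 L V_int[OF t] U2_eq(2)[OF t] in auto)
  also have "\<dots> = (\<integral>\<omega>\<in>A. (U t \<omega>)\<^sup>2 \<partial>Q)" by (rule U2_eq(3)[OF t A])
  finally show ?thesis .
qed

text \<open>The martingale of the overview before subtraction of its initial value
  \<open>u s x\<close>.\<close>

definition K where "K t \<omega> = U t \<omega> + I s t \<omega>"

lemma u_T: "u T y = g y"
proof -
  have T0: "T \<in> {0..T}" using T_pos by simp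
  interpret R: prob_space "P T y" by (rule prob_P[OF T0])
  have "transition_op P T T g y = (\<integral>\<omega>. g y \<partial>P T y)"
    unfolding transition_op_def
  proof (rule integral_cong_AE)
    show "AE \<omega> in P T y. g (\<omega> T) = g y" using AE_start[OF T0, of y] by eventually_elim simp
  qed (use measurable_compose[OF eval_P[OF T0 T0] g_borel] in auto)
  then show ?thesis using IP1[OF T0, of y] LBINT_singleton_eq_0[of T] by (simp add: R.prob_space)
qed

lemma K_F: "t \<in> {s..T} \<Longrightarrow> K t \<in> borel_measurable (path_filtration T t)"
  unfolding K_def[abs_def] using U_F I_F s by (intro borel_measurable_add) auto

lemma K_L2: "t \<in> {s..T} \<Longrightarrow> square_integrable Q (K t)"
  unfolding K_def[abs_def] using s by (intro square_integrable_add U_L2 I_L2) auto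

lemma V_int': "t \<in> {s..T} \<Longrightarrow> integrable Q (V s t)"
proof -
  assume t: "t \<in> {s..T}"
  have ae: "AE \<omega> in Q. V s T \<omega> - V t T \<omega> = V s t \<omega>"
    using v_path by eventually_elim (use t LBINT_split_at in \<open>auto simp: V_def\<close>)
  show ?thesis
    by (rule integrable_cong_AE_imp[of _ "\<lambda>\<omega>. V s T \<omega> - V t T \<omega>"])
       (use V_int[of s] V_int[OF t] t s V_m[of s t] ae in \<open>auto elim: eventually_mono\<close>)
qed

lemma K_T_eq: "t \<in> {s..T} \<Longrightarrow> AE \<omega> in Q. K T \<omega> = \<eta> t \<omega> + I s t \<omega>"
  using F_path by (rule AE_mp) (auto intro!: AE_I2 simp: K_def U_def u_T \<eta>_def G_def I_def dest: LBINT_split_at)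

lemma K_closed:
  assumes t: "t \<in> {s..T}" and A: "A \<in> sets (path_filtration T t)"
  shows "(\<integral>\<omega>\<in>A. K T \<omega> \<partial>Q) = (\<integral>\<omega>\<in>A. K t \<omega> \<partial>Q)"
proof -
  note t0 = st0[OF t]
  have AQ: "A \<in> sets Q" using B.sets_F_M[OF t0 A] .
  note si = set_integrable_Q[OF t0 A]
  have I: "integrable Q (I s t)" by (rule B.square_integrable_integrable[OF I_L2]) (use t in auto)
  have KT: "K T \<in> borel_measurable Q" using K_L2[of T] t by (auto simp: square_integrable_def)
  have "(\<integral>\<omega>\<in>A. K T \<omega> \<partial>Q) = (\<integral>\<omega>\<in>A. \<eta> t \<omega> + I s t \<omega> \<partial>Q)"
    by (rule set_lebesgue_integral_cong_AE[OF AQ KT])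
       (use K_T_eq[OF t] I U_eq(1)[OF t] in \<open>auto elim: eventually_mono\<close>)
  also have "\<dots> = (\<integral>\<omega>\<in>A. U t \<omega> \<partial>Q) + (\<integral>\<omega>\<in>A. I s t \<omega> \<partial>Q)"
    using si[OF I] si[OF U_eq(1)[OF t]] U_eq(3)[OF t A] by simp
  also have "\<dots> = (\<integral>\<omega>\<in>A. K t \<omega> \<partial>Q)"
    unfolding K_def using si[OF I] si[OF U_eq(2)[OF t]] by simp
  finally show ?thesis .
qed

text \<open>Since \<open>K T\<close> is \<open>\<eta> t + I s t\<close>, its square splits into a
  future part, treated by \<open>eta_square_closed\<close>, a past part that stays as it is, and a
  cross term in which \<open>I s t\<close> is known at \<open>t\<close>, so that
  \<open>\<eta> t\<close> becomes \<open>U t\<close>.\<close>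

lemma K_square_closed:
  assumes t: "t \<in> {s..T}" and A: "A \<in> sets (path_filtration T t)"
  shows "(\<integral>\<omega>\<in>A. (K T \<omega>)\<^sup>2 - V s T \<omega> \<partial>Q) = (\<integral>\<omega>\<in>A. (K t \<omega>)\<^sup>2 - V s t \<omega> \<partial>Q)"
proof -
  note t0 = st0[OF t]
  have AQ: "A \<in> sets Q" using B.sets_F_M[OF t0 A] .
  note si = set_integrable_Q[OF t0 A]
  have L2: "square_integrable Q (I s t)" "square_integrable Q (\<eta> t)" "square_integrable Q (U t)" "square_integrable Q (K T)" "square_integrable Q (K t)"
    using t s by (auto intro: I_L2 \<eta>_L2 U_L2 K_L2)
  have ints: "integrable Q (\<lambda>\<omega>. (\<eta> t \<omega>)\<^sup>2)" "integrable Q (\<lambda>\<omega>. (U t \<omega>)\<^sup>2)" "integrable Q (\<lambda>\<omega>. (I s t \<omega>)\<^sup>2)"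
      "integrable Q (\<lambda>\<omega>. (K T \<omega>)\<^sup>2)" "integrable Q (\<lambda>\<omega>. I s t \<omega> * \<eta> t \<omega>)" "integrable Q (\<lambda>\<omega>. I s t \<omega> * U t \<omega>)"
    using L2 by (auto simp: square_integrable_def intro: square_integrable_mult_integrable)
  have V: "integrable Q (V s T)" "integrable Q (V t T)" "integrable Q (V s t)" using V_int[of s] V_int[OF t] V_int'[OF t] t s by auto
  have cross: "(\<integral>\<omega>\<in>A. I s t \<omega> * \<eta> t \<omega> \<partial>Q) = (\<integral>\<omega>\<in>A. I s t \<omega> * U t \<omega> \<partial>Q)"
  proof -
    have ZF: "(\<lambda>\<omega>. indicat_real A \<omega> * I s t \<omega>) \<in> borel_measurable (path_filtration T t)"
      using I_F[of s t] A t s by auto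
    have "(\<integral>\<omega>. (indicat_real A \<omega> * I s t \<omega>) * \<eta> t \<omega> \<partial>Q) = (\<integral>\<omega>. (indicat_real A \<omega> * I s t \<omega>) * U t \<omega> \<partial>Q)"
      by (rule B.integral_mult_closed(2)[OF t0 U_eq(1,2)[OF t] U_F[OF t0] U_eq(3)[OF t] ZF])
         (use si[OF ints(5)] in \<open>auto simp: set_integrable_def mult.assoc\<close>)
    then show ?thesis by (simp add: set_lebesgue_integral_def mult.assoc)
  qed
  have "(\<integral>\<omega>\<in>A. (K T \<omega>)\<^sup>2 - V s T \<omega> \<partial>Q)
      = (\<integral>\<omega>\<in>A. ((\<eta> t \<omega>)\<^sup>2 - V t T \<omega>) + (2 * (I s t \<omega> * \<eta> t \<omega>) + ((I s t \<omega>)\<^sup>2 - V s t \<omega>)) \<partial>Q)"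
  proof (rule set_lebesgue_integral_cong_AE[OF AQ])
    show "AE \<omega>\<in>A in Q. (K T \<omega>)\<^sup>2 - V s T \<omega> = ((\<eta> t \<omega>)\<^sup>2 - V t T \<omega>) + (2 * (I s t \<omega> * \<eta> t \<omega>) + ((I s t \<omega>)\<^sup>2 - V s t \<omega>))"
      using K_T_eq[OF t] v_path
    proof eventually_elim
      case (elim \<omega>)
      have "V s T \<omega> = V s t \<omega> + V t T \<omega>" unfolding V_def using LBINT_split_at[OF elim(2)] t by auto
      then show ?case unfolding elim(1) by (simp add: power2_sum)
    qed
  qed (use ints V in auto)
  also have "\<dots> = (\<integral>\<omega>\<in>A. (\<eta> t \<omega>)\<^sup>2 - V t T \<omega> \<partial>Q) + (\<integral>\<omega>\<in>A. 2 * (I s t \<omega> * \<eta> t \<omega>) + ((I s t \<omega>)\<^sup>2 - V s t \<omega>) \<partial>Q)"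
    by (rule set_integral_add(2); rule si) (use ints V in auto)
  also have "(\<integral>\<omega>\<in>A. 2 * (I s t \<omega> * \<eta> t \<omega>) + ((I s t \<omega>)\<^sup>2 - V s t \<omega>) \<partial>Q)
      = 2 * (\<integral>\<omega>\<in>A. I s t \<omega> * \<eta> t \<omega> \<partial>Q) + (\<integral>\<omega>\<in>A. (I s t \<omega>)\<^sup>2 - V s t \<omega> \<partial>Q)"
    by (subst set_integral_add(2)) (auto intro!: si simp: ints V)
  also have "(\<integral>\<omega>\<in>A. (\<eta> t \<omega>)\<^sup>2 - V t T \<omega> \<partial>Q) = (\<integral>\<omega>\<in>A. (U t \<omega>)\<^sup>2 \<partial>Q)"
    by (rule eta_square_closed[OF t A])
  also have "2 * (\<integral>\<omega>\<in>A. I s t \<omega> * \<eta> t \<omega> \<partial>Q) + (\<integral>\<omega>\<in>A. (I s t \<omega>)\<^sup>2 - V s t \<omega> \<partial>Q)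
      = (\<integral>\<omega>\<in>A. 2 * (I s t \<omega> * U t \<omega>) + ((I s t \<omega>)\<^sup>2 - V s t \<omega>) \<partial>Q)"
    unfolding cross by (subst set_integral_add(2)) (auto intro!: si simp: ints V)
  also have "(\<integral>\<omega>\<in>A. (U t \<omega>)\<^sup>2 \<partial>Q) + \<dots> = (\<integral>\<omega>\<in>A. (U t \<omega>)\<^sup>2 + (2 * (I s t \<omega> * U t \<omega>) + ((I s t \<omega>)\<^sup>2 - V s t \<omega>)) \<partial>Q)"
    by (rule set_integral_add(2)[symmetric]; rule si) (use ints V in auto)
  also have "\<dots> = (\<integral>\<omega>\<in>A. (K t \<omega>)\<^sup>2 - V s t \<omega> \<partial>Q)"
    by (intro arg_cong[where f="set_lebesgue_integral Q A"]) (auto simp: K_def power2_sum fun_eq_iff)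
  finally show ?thesis .
qed

end

section \<open>The angular bracket\<close>

lemma continuous_imp_cadlag_on:
  fixes h :: "real \<Rightarrow> 'a::topological_space"
  assumes h: "continuous_on {a..b} h"
  shows "cadlag_on a b h"
  unfolding cadlag_on_def
proof (intro conjI ballI)
  fix t assume t: "t \<in> {a..<b}"
  have "continuous_on {t..b} h" by (rule continuous_on_subset[OF h]) (use t in auto)
  then show "(h \<longlongrightarrow> h t) (at_right t)" using t by (intro continuous_on_Icc_at_rightD[of t b]) auto
next
  fix t assume t: "t \<in> {a<..b}"
  have "continuous_on {a..t} h" by (rule continuous_on_subset[OF h]) (use t in auto)
  then show "\<exists>l. (h \<longlongrightarrow> l) (at_left t)" using t by (intro exI[of _ "h t"] continuous_on_Icc_at_leftD[of a t]) auto
qed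

text \<open>Before \<open>s\<close> the interval \<open>{s..t}\<close> is empty and the integral is
  0, its value at \<open>s\<close>; replacing \<open>t\<close> by \<open>max s t\<close> therefore
  changes nothing.\<close>

lemma continuous_on_left_extension:
  fixes h :: "real \<Rightarrow> real"
  assumes h: "set_integrable lborel {s..T} h" and s: "0 \<le> s" "s \<le> T"
  shows "continuous_on {0..T} (\<lambda>t. LBINT r:{s..t}. h r)"
proof -
  have "continuous_on {0..T} (\<lambda>t. (\<lambda>t. LBINT r:{s..t}. h r) (max s t))"
    by (rule continuous_on_compose2[OF indefinite_integral_continuous[OF h]]) (use s in \<open>auto intro!: continuous_intros\<close>)
  moreover have "(LBINT r:{s..max s t}. h r) = (LBINT r:{s..t}. h r)" for t
  proof (cases "s \<le> t")
    case False
    then show ?thesis using LBINT_singleton_eq_0[of s h] by (simp add: max_def set_lebesgue_integral_def[of _ "{}"])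
  qed (simp add: max_def)
  ultimately show ?thesis by simp
qed

text \<open>Index of the cell containing \<open>t\<close> when \<open>{0<..T}\<close> is cut into
  \<open>Suc n\<close> equal cells. Cells are open on the left, hence the ceiling less one rather
  than the floor.\<close>

definition lower_grid :: "real \<Rightarrow> nat \<Rightarrow> real \<Rightarrow> nat" where
  "lower_grid T n t = nat (\<lceil>t * real (Suc n) / T\<rceil> - 1)"

lemma lower_grid:
  assumes t: "0 < t" "t \<le> T"
  shows "lower_grid T n t < Suc n" "T * real (lower_grid T n t) / real (Suc n) < t"
    "t \<le> T * real (Suc (lower_grid T n t)) / real (Suc n)"
    and "k < Suc n \<Longrightarrow> t \<in> {T * real k / real (Suc n)<..T * real (Suc k) / real (Suc n)} \<longleftrightarrow> k = lower_grid T n t"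
proof -
  have T: "0 < T" using t by linarith
  define z where "z = t * real (Suc n) / T"
  have z: "0 < z" "z \<le> real (Suc n)"
    using t T by (auto simp: z_def divide_le_eq mult_right_mono mult.commute del: of_nat_Suc)
  have iff: "t \<in> {T * real k / real (Suc n)<..T * real (Suc k) / real (Suc n)} \<longleftrightarrow> real k < z \<and> z \<le> real (Suc k)" for k
    using T by (auto simp: z_def divide_less_eq less_divide_eq le_divide_eq divide_le_eq mult.commute simp del: of_nat_Suc)
  have ceil: "1 \<le> \<lceil>z\<rceil>" "\<lceil>z\<rceil> \<le> int (Suc n)" using z by (auto simp: ceiling_le_iff simp del: of_nat_Suc)
  have real_lg: "real (lower_grid T n t) = of_int \<lceil>z\<rceil> - 1"
    using ceil(1) by (simp add: lower_grid_def z_def[symmetric] del: of_nat_Suc)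
  show lt: "lower_grid T n t < Suc n"
    using ceil by (simp add: lower_grid_def z_def[symmetric] nat_less_iff del: of_nat_Suc)
  have "t \<in> {T * real (lower_grid T n t) / real (Suc n)<..T * real (Suc (lower_grid T n t)) / real (Suc n)}"
    unfolding iff using real_lg ceiling_correct[of z] by auto
  then show "T * real (lower_grid T n t) / real (Suc n) < t" "t \<le> T * real (Suc (lower_grid T n t)) / real (Suc n)" by auto
  have "k = lower_grid T n t" if "real k < z" "z \<le> real (Suc k)"
  proof -
    have "\<lceil>z\<rceil> = int k + 1" using that by (intro ceiling_unique) auto
    then show ?thesis by (simp add: lower_grid_def z_def[symmetric] del: of_nat_Suc)
  qed
  then show "k < Suc n \<Longrightarrow> t \<in> {T * real k / real (Suc n)<..T * real (Suc k) / real (Suc n)} \<longleftrightarrow> k = lower_grid T n t"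
    using iff \<open>t \<in> _\<close> by blast
qed

context filtered_prob_space
begin

lemma space_predictable: "space (predictable_sigma (space M) F T) = {0..T} \<times> space M"
  unfolding predictable_sigma_def by (simp add: space_measure_of_conv)

lemma predictable_rectangle:
  assumes "0 \<le> a" "a < b" "b \<le> T" "A \<in> sets (F a)"
  shows "{a<..b} \<times> A \<in> sets (predictable_sigma (space M) F T)"
proof -
  have sub: "A \<subseteq> space M" if "A \<in> sets (F r)" "r \<in> {0..T}" for A r
    using sets.sets_into_space[OF that(1)] space_F[OF that(2)] by simp
  have "{{0} \<times> A | A. A \<in> sets (F 0)} \<subseteq> Pow ({0..T} \<times> space M)"
    using sub[of _ 0] T_pos by auto
  moreover have "{{s<..t} \<times> A | s t A. 0 \<le> s \<and> s < t \<and> t \<le> T \<and> A \<in> sets (F s)} \<subseteq> Pow ({0..T} \<times> space M)"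
  proof
    fix X assume "X \<in> {{s<..t} \<times> A | s t A. 0 \<le> s \<and> s < t \<and> t \<le> T \<and> A \<in> sets (F s)}"
    then obtain s t A where X: "X = {s<..t} \<times> A" "0 \<le> s" "s < t" "t \<le> T" "A \<in> sets (F s)" by auto
    show "X \<in> Pow ({0..T} \<times> space M)" using sub[OF X(5)] X(2-4) unfolding X(1) by auto
  qed
  ultimately have 0: "{{0} \<times> A | A. A \<in> sets (F 0)} \<union> {{s<..t} \<times> A | s t A. 0 \<le> s \<and> s < t \<and> t \<le> T \<and> A \<in> sets (F s)}
      \<subseteq> Pow ({0..T} \<times> space M)" by (rule Un_least)
  show ?thesis
    unfolding predictable_sigma_def sets_measure_of[OF 0] by (intro sigma_sets.Basic UnI2) (use assms in blast)
qed

lemma predictable_step: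
  assumes ab: "0 \<le> a" "a < b" "b \<le> T" and Z: "Z \<in> borel_measurable (F a)"
  shows "(\<lambda>(t, \<omega>). indicator {a<..b} t * Z \<omega> :: real) \<in> borel_measurable (predictable_sigma (space M) F T)"
proof -
  let ?P = "predictable_sigma (space M) F T"
  have a: "a \<in> {0..T}" using ab by auto
  show ?thesis
  proof (rule borel_measurable_iff_greater[THEN iffD2], rule allI)
    fix c :: real
    have S: "{\<omega> \<in> space M. c < Z \<omega>} \<in> sets (F a)" "{\<omega> \<in> space M. Z \<omega> \<le> c} \<in> sets (F a)"
      using Z unfolding space_F[OF a, symmetric] by measurable
    show "{z \<in> space ?P. c < (case z of (t, \<omega>) \<Rightarrow> indicator {a<..b} t * Z \<omega>)} \<in> sets ?P"
    \<comment> \<open>Outside the rectangle the process is 0, so for negative \<open>c\<close> the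
      superlevel set also contains the exterior and is described by its complement.\<close>
    proof (cases "0 \<le> c")
      case True
      have "{z \<in> space ?P. c < (case z of (t, \<omega>) \<Rightarrow> indicator {a<..b} t * Z \<omega>)} = {a<..b} \<times> {\<omega> \<in> space M. c < Z \<omega>}"
        using True ab by (auto simp: space_predictable split: split_indicator_asm split_indicator)
      then show ?thesis using predictable_rectangle[OF ab S(1)] by simp
    next
      case False
      have "{z \<in> space ?P. c < (case z of (t, \<omega>) \<Rightarrow> indicator {a<..b} t * Z \<omega>)} = space ?P - {a<..b} \<times> {\<omega> \<in> space M. Z \<omega> \<le> c}"
        using False ab by (auto simp: space_predictable split: split_indicator_asm split_indicator)
      then show ?thesis using predictable_rectangle[OF ab S(2)] by auto
    qed
  qed
qed

text \<open>Left-endpoint step processes are predictable, and by continuity of the paths they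
  converge to \<open>A\<close>. Their cells do not cover time 0, where they vanish; the starting
  value 0 makes this the right limit.\<close>

lemma continuous_adapted_predictable:
  assumes adapted: "\<And>t. t \<in> {0..T} \<Longrightarrow> A t \<in> borel_measurable (F t)"
    and cont: "\<And>\<omega>. \<omega> \<in> space M \<Longrightarrow> continuous_on {0..T} (\<lambda>t. A t \<omega>)" and zero: "\<And>\<omega>. \<omega> \<in> space M \<Longrightarrow> A 0 \<omega> = (0 :: real)"
  shows "(\<lambda>(t, \<omega>). A t \<omega>) \<in> borel_measurable (predictable_sigma (space M) F T)"
proof (rule borel_measurable_LIMSEQ_real)
  let ?P = "predictable_sigma (space M) F T"
  define g where "g n k = T * real k / real (Suc n)" for n k
  define B where "B n z = (\<Sum>k<Suc n. (\<lambda>(t, \<omega>). indicator {g n k<..g n (Suc k)} t * A (g n k) \<omega>) z)" for n z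
  have g: "0 \<le> g n k" "g n k < g n (Suc k)" "g n (Suc k) \<le> T" if "k < Suc n" for n k
  proof -
    show "0 \<le> g n k" using T_pos by (simp add: g_def)
    show "g n k < g n (Suc k)" using T_pos by (simp add: g_def divide_strict_right_mono)
    have "T * real (Suc k) \<le> T * real (Suc n)" using that T_pos by (intro mult_left_mono) auto
    then show "g n (Suc k) \<le> T" by (simp add: g_def divide_le_eq del: of_nat_Suc)
  qed
  show "B n \<in> borel_measurable ?P" for n
    unfolding B_def[abs_def]
  proof (rule borel_measurable_sum)
    fix k assume "k \<in> {..<Suc n}"
    then have k: "k < Suc n" by simp
    have "A (g n k) \<in> borel_measurable (F (g n k))" using g[OF k] by (intro adapted) auto
    then show "(\<lambda>z. case z of (t, \<omega>) \<Rightarrow> indicator {g n k<..g n (Suc k)} t * A (g n k) \<omega>) \<in> borel_measurable ?P"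
      by (rule predictable_step[OF g[OF k]])
  qed
  fix z assume "z \<in> space ?P"
  then obtain t \<omega> where z: "z = (t, \<omega>)" "t \<in> {0..T}" "\<omega> \<in> space M" by (auto simp: space_predictable)
  show "(\<lambda>n. B n z) \<longlonglongrightarrow> (case z of (t, \<omega>) \<Rightarrow> A t \<omega>)"
  proof (cases "t = 0")
    case True
    have "B n z = 0" for n
      unfolding B_def z(1) True using g(1) by (intro sum.neutral) (auto simp: indicator_def not_less)
    then show ?thesis using z True zero by simp
  next
    case False
    then have t: "0 < t" "t \<le> T" using z by auto
    have B: "B n z = A (g n (lower_grid T n t)) \<omega>" for n
    proof -
      have "B n z = (\<Sum>k<Suc n. if k = lower_grid T n t then A (g n k) \<omega> else 0)"
        unfolding B_def z(1) using lower_grid(4)[OF t] by (intro sum.cong refl) (auto simp: indicator_def g_def)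
      also have "\<dots> = A (g n (lower_grid T n t)) \<omega>" using lower_grid(1)[OF t, of n] by simp
      finally show ?thesis .
    qed
    have gl: "(\<lambda>n. g n (lower_grid T n t)) \<longlonglongrightarrow> t"
    proof (rule real_tendsto_sandwich[of "\<lambda>n. t - T / real (Suc n)" _ _ "\<lambda>_. t"])
      show "\<forall>\<^sub>F n in sequentially. t - T / real (Suc n) \<le> g n (lower_grid T n t)"
      proof (rule always_eventually, rule allI)
        fix n show "t - T / real (Suc n) \<le> g n (lower_grid T n t)"
          using lower_grid(3)[OF t, of n] by (simp add: g_def add_divide_distrib distrib_left)
      qed
      show "\<forall>\<^sub>F n in sequentially. g n (lower_grid T n t) \<le> t"
        using lower_grid(2)[OF t] by (auto simp: g_def intro!: always_eventually less_imp_le)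
      have "(\<lambda>n. t - T * (1 / real (Suc n))) \<longlonglongrightarrow> t - T * 0"
        by (intro tendsto_intros LIMSEQ_Suc lim_1_over_n)
      then show "(\<lambda>n. t - T / real (Suc n)) \<longlonglongrightarrow> t" by simp
    qed simp
    have "(\<lambda>n. A (g n (lower_grid T n t)) \<omega>) \<longlonglongrightarrow> A t \<omega>"
    proof (rule continuous_on_tendsto_compose[OF cont[OF z(3)] gl z(2)])
      show "\<forall>\<^sub>F n in sequentially. g n (lower_grid T n t) \<in> {0..T}"
      proof (rule always_eventually, rule allI)
        fix n show "g n (lower_grid T n t) \<in> {0..T}"
          using g[OF lower_grid(1)[OF t, of n]] by auto
      qed
    qed
    then show ?thesis unfolding z(1) prod.case B[unfolded z(1)] .
  qed
qed

end

section \<open>The martingale version and its bracket\<close>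

context identification_at
begin

sublocale C: filtered_prob_space "completion (P s x)" "completed_filtration (path_filtration T) (P s x)" T
  by (rule B.filtered_completion)

abbreviation "Qc \<equiv> completion (P s x)"
abbreviation "Fc \<equiv> completed_filtration (path_filtration T) (P s x)"

text \<open>Spelled with \<open>- F\<close> under the integral so as to coincide with the expression
  in \<open>extended_martingale\<close> for the generator candidate \<open>- F\<close>.\<close>

definition N where
  "N t \<omega> = indicator {s..T} t * (u t (\<omega> t) - u s x - (LBINT r:{s..t}. - F r (\<omega> r)))"

lemma N_eq: "t \<in> {s..T} \<Longrightarrow> N t \<omega> = K t \<omega> - u s x" "t < s \<Longrightarrow> N t \<omega> = 0"
  by (auto simp: N_def K_def U_def I_def set_lebesgue_integral_def)

lemma V_before: "t \<le> s \<Longrightarrow> V s t \<omega> = 0"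
  using LBINT_singleton_eq_0[of s "\<lambda>r. (v r (\<omega> r))\<^sup>2"]
  by (cases "t = s") (auto simp: V_def set_lebesgue_integral_def[of _ "{}"])

lemma N_s: "AE \<omega> in Q. N s \<omega> = 0"
proof -
  have "I s s \<omega> = 0" for \<omega> using LBINT_singleton_eq_0[of s "\<lambda>r. F r (\<omega> r)"] by (simp add: I_def)
  then show ?thesis using AE_start[OF s, of x] s
    by (auto elim!: eventually_mono simp: N_eq K_def U_def)
qed

lemma N_F: "t \<in> {0..T} \<Longrightarrow> N t \<in> borel_measurable (path_filtration T t)"
proof (cases "t < s")
  case True
  then have "N t = (\<lambda>_. 0)" using N_eq(2) by auto
  then show ?thesis by simp
next
  case False
  assume "t \<in> {0..T}"
  then have t: "t \<in> {s..T}" using False by auto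
  then have "N t = (\<lambda>\<omega>. K t \<omega> - u s x)" using N_eq(1) by auto
  then show ?thesis using K_F[OF t] by simp
qed

lemma N_L2: "t \<in> {0..T} \<Longrightarrow> square_integrable Q (N t)"
proof (cases "t < s")
  case True
  then have "N t = (\<lambda>_. 0)" using N_eq(2) by auto
  then show ?thesis by (simp add: B.square_integrable_const)
next
  case False
  assume "t \<in> {0..T}"
  then have t: "t \<in> {s..T}" using False by auto
  then have "N t = (\<lambda>\<omega>. K t \<omega> - u s x)" using N_eq(1) by auto
  then show ?thesis using square_integrable_diff[OF K_L2[OF t] B.square_integrable_const] by simp
qed

text \<open>A set known at \<open>t < s\<close> is also known at \<open>s\<close>, where the process
  is still 0 almost surely. Closedness on \<open>{s..T}\<close> thus extends to the whole
  interval.\<close>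

lemma closed_from_start:
  assumes Z: "\<And>t A. t \<in> {s..T} \<Longrightarrow> A \<in> sets (path_filtration T t) \<Longrightarrow> (\<integral>\<omega>\<in>A. Z T \<omega> \<partial>Q) = (\<integral>\<omega>\<in>A. Z t \<omega> \<partial>Q)"
    and before: "\<And>t \<omega>. t < s \<Longrightarrow> Z t \<omega> = (0 :: real)" and Z_s: "AE \<omega> in Q. Z s \<omega> = 0" and m: "Z s \<in> borel_measurable Q"
    and t: "t \<in> {0..T}" and A: "A \<in> sets (path_filtration T t)"
  shows "(\<integral>\<omega>\<in>A. Z T \<omega> \<partial>Q) = (\<integral>\<omega>\<in>A. Z t \<omega> \<partial>Q)"
proof (cases "t < s")
  case True
  have AQ: "A \<in> sets Q" using B.sets_F_M[OF t A] .
  have "A \<in> sets (path_filtration T s)" using B.filtration_mono[of t s] A t s True by auto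
  then have "(\<integral>\<omega>\<in>A. Z T \<omega> \<partial>Q) = (\<integral>\<omega>\<in>A. Z s \<omega> \<partial>Q)" using Z[of s] s by auto
  also have "\<dots> = (\<integral>\<omega>\<in>A. 0 \<partial>Q)"
    by (rule set_lebesgue_integral_cong_AE[OF AQ m]) (use Z_s in \<open>auto elim: eventually_mono\<close>)
  finally show ?thesis using before[OF True] by simp
qed (use Z t A in auto)

lemma N_closed:
  assumes t: "t \<in> {0..T}" and A: "A \<in> sets (path_filtration T t)"
  shows "(\<integral>\<omega>\<in>A. N T \<omega> \<partial>Q) = (\<integral>\<omega>\<in>A. N t \<omega> \<partial>Q)"
proof (rule closed_from_start[where Z=N, OF _ N_eq(2) N_s _ t A])
  fix t and A :: "(real \<Rightarrow> 'e) set" assume t: "t \<in> {s..T}" and A: "A \<in> sets (path_filtration T t)"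
  note si = set_integrable_Q[OF st0[OF t] A]
  have "integrable Q (K T)" "integrable Q (K t)" using K_L2[of T] K_L2[OF t] t B.square_integrable_integrable by auto
  then show "(\<integral>\<omega>\<in>A. N T \<omega> \<partial>Q) = (\<integral>\<omega>\<in>A. N t \<omega> \<partial>Q)"
    using K_closed[OF t A] t by (simp add: N_eq set_integral_diff si)
qed (use B.measurable_F_M[OF s N_F[OF s]] in auto)

lemma N2V_closed:
  assumes t: "t \<in> {0..T}" and A: "A \<in> sets (path_filtration T t)"
  shows "(\<integral>\<omega>\<in>A. (N T \<omega>)\<^sup>2 - V s T \<omega> \<partial>Q) = (\<integral>\<omega>\<in>A. (N t \<omega>)\<^sup>2 - V s t \<omega> \<partial>Q)"
proof (rule closed_from_start[where Z="\<lambda>t \<omega>. (N t \<omega>)\<^sup>2 - V s t \<omega>", OF _ _ _ _ t A])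
  fix t and A :: "(real \<Rightarrow> 'e) set" assume t: "t \<in> {s..T}" and A: "A \<in> sets (path_filtration T t)"
  note si = set_integrable_Q[OF st0[OF t] A]
  \<comment> \<open>Expands \<open>(K - c)\<^sup>2\<close> with the constant
    \<open>c = u s x\<close>; closedness of \<open>K\<close> and of its compensated square then
    settles each term.\<close>
  have *: "(\<integral>\<omega>\<in>A. (N q \<omega>)\<^sup>2 - V s q \<omega> \<partial>Q)
      = (\<integral>\<omega>\<in>A. (K q \<omega>)\<^sup>2 - V s q \<omega> \<partial>Q) - 2 * u s x * (\<integral>\<omega>\<in>A. K q \<omega> \<partial>Q) + (\<integral>\<omega>\<in>A. (u s x)\<^sup>2 \<partial>Q)"
    if q: "q \<in> {s..T}" for q
  proof -
    have K: "integrable Q (K q)" "integrable Q (\<lambda>\<omega>. (K q \<omega>)\<^sup>2)" "integrable Q (V s q)"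
      using B.square_integrable_integrable[OF K_L2[OF q]] K_L2[OF q, unfolded square_integrable_def] V_int'[OF q]
      by blast+
    have "(\<integral>\<omega>\<in>A. (N q \<omega>)\<^sup>2 - V s q \<omega> \<partial>Q)
        = (\<integral>\<omega>\<in>A. ((K q \<omega>)\<^sup>2 - V s q \<omega>) - 2 * u s x * K q \<omega> + (u s x)\<^sup>2 \<partial>Q)"
      by (intro arg_cong[where f="set_lebesgue_integral Q A"]) (auto simp: N_eq(1)[OF q] power2_diff fun_eq_iff)
    also have "\<dots> = (\<integral>\<omega>\<in>A. ((K q \<omega>)\<^sup>2 - V s q \<omega>) - 2 * u s x * K q \<omega> \<partial>Q) + (\<integral>\<omega>\<in>A. (u s x)\<^sup>2 \<partial>Q)"
      by (rule set_integral_add(2); rule si) (use K in auto)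
    also have "(\<integral>\<omega>\<in>A. ((K q \<omega>)\<^sup>2 - V s q \<omega>) - 2 * u s x * K q \<omega> \<partial>Q)
        = (\<integral>\<omega>\<in>A. (K q \<omega>)\<^sup>2 - V s q \<omega> \<partial>Q) - (\<integral>\<omega>\<in>A. 2 * u s x * K q \<omega> \<partial>Q)"
      by (rule set_integral_diff(2); rule si) (use K in auto)
    finally show ?thesis by simp
  qed
  have "T \<in> {s..T}" using t by auto
  then show "(\<integral>\<omega>\<in>A. (N T \<omega>)\<^sup>2 - V s T \<omega> \<partial>Q) = (\<integral>\<omega>\<in>A. (N t \<omega>)\<^sup>2 - V s t \<omega> \<partial>Q)"
    using *[OF t] *[of T] K_closed[OF t A] K_square_closed[OF t A] by simp
next
  show "AE \<omega> in Q. (N s \<omega>)\<^sup>2 - V s s \<omega> = 0" using N_s by eventually_elim (simp add: V_before)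
  show "(\<lambda>\<omega>. (N s \<omega>)\<^sup>2 - V s s \<omega>) \<in> borel_measurable Q"
    using B.measurable_F_M[OF s N_F[OF s]] by (simp add: V_before)
qed (simp add: N_eq V_before)

lemma V_adapted: "t \<in> {0..T} \<Longrightarrow> V s t \<in> borel_measurable (path_filtration T t)"
  using V_F[of s t] s by auto

lemma V_integrable: "t \<in> {0..T} \<Longrightarrow> integrable Q (V s t)"
proof (cases "t < s")
  case True
  then have "V s t = (\<lambda>_. 0)" using V_before[of t] by auto
  then show ?thesis by simp
qed (use V_int' in auto)

lemma N_martingale: "closed_L2_martingale Q (path_filtration T) T N"
  by unfold_locales (use N_F N_L2 N_closed in \<open>auto simp: square_integrable_def\<close>)

lemma extended_martingale_exists: "\<exists>M. extended_martingale T P u (\<lambda>r y. - F r y) s x M"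
proof -
  interpret Y: closed_L2_martingale Q "path_filtration T" T N by (rule N_martingale)
  obtain M where M: "AE \<omega> in Q. cadlag_on 0 T (\<lambda>t. M t \<omega>)" "\<And>t. t \<in> {0..T} \<Longrightarrow> AE \<omega> in Q. M t \<omega> = N t \<omega>"
    "(\<integral>\<^sup>+\<omega>. (SUP t\<in>{0..T}. ennreal ((M t \<omega>)\<^sup>2)) \<partial>Q) < \<infinity>"
    using Y.cadlag_modification[OF path_filtration_right_continuous] by blast
  have "martingale Qc Fc {0..T} M"
    by (rule B.martingale_completionI[OF N_F _ N_closed M(2)])
       (use N_L2 B.square_integrable_integrable in auto)
  moreover have "AE \<omega> in Q. M 0 \<omega> = 0"
  proof -
    have "AE \<omega> in Q. N 0 \<omega> = 0" using N_s N_eq(2)[of 0] s by (cases "s = 0") auto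
    then show ?thesis using M(2)[of 0] T_pos by (auto elim: eventually_elim2)
  qed
  ultimately have "M \<in> H2_0 Qc Fc T"
    using M(1,3) by (auto simp: H2_0_def AE_completion nn_integral_completion)
  then show ?thesis
    using M(2) unfolding extended_martingale_def N_def by blast
qed

lemma extended_martingale_AE:
  "extended_martingale T P u (\<lambda>r y. - F r y) s x M \<Longrightarrow> t \<in> {0..T} \<Longrightarrow> AE \<omega> in Q. M t \<omega> = N t \<omega>"
  unfolding extended_martingale_def N_def by blast

lemma angular_bracket_exists:
  assumes M: "extended_martingale T P u (\<lambda>r y. - F r y) s x M"
  shows "\<exists>A. angular_bracket Qc Fc T M A \<and>
    (AE \<omega> in Q. set_integrable lborel {s..T} (\<lambda>r. (v r (\<omega> r))\<^sup>2) \<and> (\<forall>t\<in>{s..T}. A t \<omega> = (LBINT r:{s..t}. (v r (\<omega> r))\<^sup>2)))"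
proof -
  \<comment> \<open>Set to 0 on the negligible paths where \<open>v\<^sup>2\<close> is not
    integrable, so that every path is continuous as predictability requires. The correction depends
    on the whole path and leaves \<open>A\<close> adapted to the completed filtration.\<close>
  define A where "A t \<omega> = (if set_integrable lborel {s..T} (\<lambda>r. (v r (\<omega> r))\<^sup>2) then V s t \<omega> else 0)" for t \<omega>
  have AV: "AE \<omega> in Q. A t \<omega> = V s t \<omega>" for t
    using v_path by eventually_elim (simp add: A_def)
  have pred: "(\<lambda>(t, \<omega>). A t \<omega>) \<in> borel_measurable (predictable_sigma (space Qc) Fc T)"
  proof (rule C.continuous_adapted_predictable)
    show "A t \<in> borel_measurable (Fc t)" if "t \<in> {0..T}" for t
      by (rule B.measurable_Fc_AE[OF that V_adapted[OF that] AV])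
    show "continuous_on {0..T} (\<lambda>t. A t \<omega>)" for \<omega>
      using s by (cases "set_integrable lborel {s..T} (\<lambda>r. (v r (\<omega> r))\<^sup>2)")
        (auto simp: A_def V_def intro: continuous_on_left_extension)
    show "A 0 \<omega> = 0" for \<omega> using V_before[of 0 \<omega>] s by (simp add: A_def)
  qed
  have path: "AE \<omega> in Q. A 0 \<omega> = 0 \<and> mono_on {0..T} (\<lambda>t. A t \<omega>) \<and> cadlag_on 0 T (\<lambda>t. A t \<omega>)"
    using v_path
  proof eventually_elim
    case (elim \<omega>)
    have A: "A t \<omega> = V s t \<omega>" for t using elim by (simp add: A_def)
    have "V s a \<omega> \<le> V s b \<omega>" if "a \<le> b" "b \<le> T" for a b
      unfolding V_def set_lebesgue_integral_def
    proof (rule integral_mono)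
      have "set_integrable lborel {s..c} (\<lambda>r. (v r (\<omega> r))\<^sup>2)" if "c \<le> T" for c
        by (rule set_integrable_subset[OF elim]) (use that in auto)
      then show "integrable lborel (\<lambda>r. indicat_real {s..a} r *\<^sub>R (v r (\<omega> r))\<^sup>2)"
         "integrable lborel (\<lambda>r. indicat_real {s..b} r *\<^sub>R (v r (\<omega> r))\<^sup>2)"
        using that by (auto simp: set_integrable_def)
    qed (use that in \<open>auto simp: indicator_def\<close>)
    then show ?case
      unfolding A using V_before[of 0 \<omega>] s continuous_imp_cadlag_on[OF continuous_on_left_extension[OF elim]]
      by (auto simp: mono_on_def V_def)
  qed
  have "martingale Qc Fc {0..T} (\<lambda>t \<omega>. (M t \<omega>)\<^sup>2 - A t \<omega>)"
  proof (rule B.martingale_completionI[where Z="\<lambda>t \<omega>. (N t \<omega>)\<^sup>2 - V s t \<omega>", OF _ _ N2V_closed])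
    fix t assume t: "t \<in> {0..T}"
    show "(\<lambda>\<omega>. (N t \<omega>)\<^sup>2 - V s t \<omega>) \<in> borel_measurable (path_filtration T t)"
      using N_F[OF t] V_adapted[OF t] by measurable
    show "integrable Q (\<lambda>\<omega>. (N t \<omega>)\<^sup>2 - V s t \<omega>)"
      using N_L2[OF t] V_integrable[OF t] by (auto simp: square_integrable_def)
    show "AE \<omega> in Q. (M t \<omega>)\<^sup>2 - A t \<omega> = (N t \<omega>)\<^sup>2 - V s t \<omega>"
      using extended_martingale_AE[OF M t] AV[of t] by eventually_elim simp
  qed auto
  then have "angular_bracket Qc Fc T M A"
    unfolding angular_bracket_def using pred AE_completion[OF path] by blast
  moreover have "AE \<omega> in Q. set_integrable lborel {s..T} (\<lambda>r. (v r (\<omega> r))\<^sup>2) \<and> (\<forall>t\<in>{s..T}. A t \<omega> = (LBINT r:{s..t}. (v r (\<omega> r))\<^sup>2))"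
    using v_path by eventually_elim (simp add: A_def V_def)
  ultimately show ?thesis by blast
qed

end

section \<open>Uniqueness of the carre du champ\<close>

text \<open>Vanishing tails say that the measures with densities the positive and the negative part
  of \<open>k\<close> agree on all half-lines, hence everywhere; densities are unique almost
  everywhere.\<close>

lemma AE_eq_0_if_tail_integrals_eq_0:
  fixes k :: "real \<Rightarrow> real"
  assumes k: "integrable lborel k" and zero: "\<And>x. (LBINT q:{x<..}. k q) = 0"
  shows "AE q in lborel. k q = 0"
proof -
  have [measurable]: "k \<in> borel_measurable borel" using k by auto
  have fin: "(\<integral>\<^sup>+q. ennreal (e * k q) * indicator B q \<partial>lborel) < \<infinity>" if "e = 1 \<or> e = -1" for e and B :: "real set"
  proof -
    have "(\<integral>\<^sup>+q. ennreal (e * k q) * indicator B q \<partial>lborel) \<le> (\<integral>\<^sup>+q. ennreal (norm (k q)) \<partial>lborel)"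
      using that by (intro nn_integral_mono) (auto simp: indicator_def intro!: ennreal_leI)
    also have "\<dots> < \<infinity>" using k by (simp add: integrable_iff_bounded)
    finally show ?thesis .
  qed
  have "density lborel (\<lambda>q. ennreal (k q)) = density lborel (\<lambda>q. ennreal (- k q))"
  proof (rule measure_eqI_lessThan)
    fix x :: real
    show "emeasure (density lborel (\<lambda>q. ennreal (k q))) {x<..} < \<infinity>"
      using fin[of 1 "{x<..}"] by (simp add: emeasure_density)
    have i: "integrable lborel (\<lambda>q. indicator {x<..} q * k q)"
      using integrable_mult_indicator[of "{x<..}" lborel k] k by simp
    have "0 = (LBINT q. indicator {x<..} q * k q)"
      using zero[of x] by (simp add: set_lebesgue_integral_def)
    also have "\<dots> = enn2real (\<integral>\<^sup>+q. ennreal (indicator {x<..} q * k q) \<partial>lborel) - enn2real (\<integral>\<^sup>+q. ennreal (- (indicator {x<..} q * k q)) \<partial>lborel)"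
      by (rule real_lebesgue_integral_def[OF i])
    also have "(\<lambda>q. ennreal (indicator {x<..} q * k q)) = (\<lambda>q. ennreal (1 * k q) * indicator {x<..} q)"
      by (auto simp: indicator_def)
    also have "(\<lambda>q. ennreal (- (indicator {x<..} q * k q))) = (\<lambda>q. ennreal (-1 * k q) * indicator {x<..} q)"
      by (auto simp: indicator_def)
    finally have "(\<integral>\<^sup>+q. ennreal (1 * k q) * indicator {x<..} q \<partial>lborel) = (\<integral>\<^sup>+q. ennreal (-1 * k q) * indicator {x<..} q \<partial>lborel)"
      using ennreal_enn2real[of "\<integral>\<^sup>+q. ennreal (1 * k q) * indicator {x<..} q \<partial>lborel"]
        ennreal_enn2real[of "\<integral>\<^sup>+q. ennreal (-1 * k q) * indicator {x<..} q \<partial>lborel"]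
        fin[of 1 "{x<..}"] fin[of "-1" "{x<..}"] by simp
    then show "emeasure (density lborel (\<lambda>q. ennreal (k q))) {x<..} = emeasure (density lborel (\<lambda>q. ennreal (- k q))) {x<..}"
      by (simp add: emeasure_density)
  qed auto
  then have "AE q in lborel. ennreal (k q) = ennreal (- k q)"
    by (subst (asm) sigma_finite_measure.density_unique_iff[OF lborel.sigma_finite_measure_axioms]) auto
  then show ?thesis
  proof eventually_elim
    case (elim q)
    \<comment> \<open>One of \<open>ennreal (k q)\<close> and \<open>ennreal (- k q)\<close> is
      truncated to 0, so equality forces \<open>k q = 0\<close>.\<close>
    then show ?case by (cases "0 \<le> k q") (auto simp: ennreal_eq_0_iff ennreal_neg)
  qed
qed

text \<open>Only rational times are assumed, so that in the application countably many almost sure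
  events can be intersected; continuity of the indefinite integral supplies the other times.\<close>

lemma AE_eq_0_if_indefinite_integral_eq_0:
  fixes h :: "real \<Rightarrow> real"
  assumes h: "set_integrable lborel {s..T} h" and zero: "\<And>t. t \<in> {s<..<T} \<inter> \<rat> \<Longrightarrow> (LBINT q:{s..t}. h q) = 0"
  shows "AE q in lborel. q \<in> {s..T} \<longrightarrow> h q = 0"
proof (cases "s < T")
  case True
  have "x \<in> closure \<rat>" for x :: real
    unfolding closure_approachable
  proof (intro allI impI)
    fix e :: real assume "0 < e"
    then obtain q where "q \<in> \<rat>" "x < q" "q < x + e" using Rats_dense_in_real[of x "x + e"] by auto
    then show "\<exists>y\<in>\<rat>. dist y x < e" by (intro bexI[of _ q]) (auto simp: dist_real_def)
  qed
  then have "closure (\<rat> :: real set) = UNIV" by blast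
  then have cl: "closure ({s<..<T} \<inter> \<rat>) = {s..T}"
    using True closure_open_Int_superset[of "{s<..<T}" \<rat>] by (simp add: closure_greaterThanLessThan)
  have all: "(LBINT q:{s..t}. h q) = 0" if "t \<in> {s..T}" for t
    by (rule continuous_constant_on_closure[of "{s<..<T} \<inter> \<rat>"])
       (use indefinite_integral_continuous[OF h] zero that in \<open>auto simp: cl\<close>)
  let ?k = "\<lambda>q. indicator {s..T} q * h q"
  have k: "integrable lborel ?k" using h by (simp add: set_integrable_def)
  have "AE q in lborel. ?k q = 0"
  proof (rule AE_eq_0_if_tail_integrals_eq_0[OF k])
    fix x
    consider "x < s" | "x \<in> {s..T}" | "T < x" by fastforce
    then show "(LBINT q:{x<..}. ?k q) = 0"
    proof cases
      case 1
      then have "(LBINT q:{x<..}. ?k q) = (LBINT q:{s..T}. h q)"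
        unfolding set_lebesgue_integral_def by (intro Bochner_Integration.integral_cong) (auto simp: indicator_def)
      then show ?thesis using all[of T] True by simp
    next
      case 2
      then have "(LBINT q:{x<..}. ?k q) = (LBINT q:{x<..T}. h q)"
        unfolding set_lebesgue_integral_def by (intro Bochner_Integration.integral_cong) (auto simp: indicator_def)
      also have "\<dots> = 0"
        using indefinite_integral_increment[OF h, of x T] all[of T] all[of x] 2 by simp
      finally show ?thesis .
    next
      case 3
      then have "(\<lambda>q. indicator {x<..} q *\<^sub>R (indicator {s..T} q * h q)) = (\<lambda>_. 0)"
        by (auto simp: fun_eq_iff indicator_def)
      then show ?thesis unfolding set_lebesgue_integral_def by simp
    qed
  qed
  then show ?thesis by eventually_elim (auto simp: indicator_def)
next
  case False
  then show ?thesis using AE_lborel_singleton[of s] by (auto elim!: eventually_mono)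
qed

section \<open>Differences of martingales and integrable majorants\<close>

context filtered_prob_space
begin

lemma martingale_diff:
  assumes "martingale M F {0..T} X" "martingale M F {0..T} Y"
  shows "martingale M F {0..T} (\<lambda>t \<omega>. X t \<omega> - Y t \<omega>)"
  unfolding martingale_def
proof (intro conjI ballI impI)
  fix r t assume r: "r \<in> {0..T}" and t: "t \<in> {0..T}" and "r \<le> t"
  interpret S: finite_measure_subalgebra M "F r" by (rule fin_subalg[OF r])
  have "AE \<omega> in M. real_cond_exp M (F r) (X t) \<omega> = X r \<omega>" "AE \<omega> in M. real_cond_exp M (F r) (Y t) \<omega> = Y r \<omega>"
    "integrable M (X t)" "integrable M (Y t)"
    using assms r t \<open>r \<le> t\<close> by (auto simp: martingale_def)
  moreover have "AE \<omega> in M. real_cond_exp M (F r) (\<lambda>\<omega>. X t \<omega> - Y t \<omega>) \<omega> = real_cond_exp M (F r) (X t) \<omega> - real_cond_exp M (F r) (Y t) \<omega>"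
    by (rule S.real_cond_exp_diff) fact+
  ultimately show "AE \<omega> in M. real_cond_exp M (F r) (\<lambda>\<omega>. X t \<omega> - Y t \<omega>) \<omega> = X r \<omega> - Y r \<omega>"
    by (elim AE_mp) (auto intro!: AE_I2)
qed (use assms in \<open>auto simp: martingale_def intro!: borel_measurable_diff\<close>)

lemma martingale_eq_0:
  assumes N: "martingale M F {0..T} N" and zero: "AE \<omega> in M. N T \<omega> = 0" and t: "t \<in> {0..T}"
  shows "AE \<omega> in M. N t \<omega> = 0"
proof -
  interpret S: finite_measure_subalgebra M "F t" by (rule fin_subalg[OF t])
  have NT: "integrable M (N T)" "AE \<omega> in M. real_cond_exp M (F t) (N T) \<omega> = N t \<omega>"
    using N t T_pos by (auto simp: martingale_def)
  have "AE \<omega> in M. real_cond_exp M (F t) (N T) \<omega> = 0"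
  proof (rule S.real_cond_exp_charact)
    fix A assume "A \<in> sets (F t)"
    then have A: "A \<in> sets M" by (rule sets_F_M[OF t])
    show "(\<integral>\<omega>\<in>A. N T \<omega> \<partial>M) = (\<integral>\<omega>\<in>A. 0 \<partial>M)"
      by (rule set_lebesgue_integral_cong_AE[OF A]) (use NT zero in \<open>auto elim: eventually_mono\<close>)
  qed (use NT in auto)
  with NT(2) show ?thesis by eventually_elim simp
qed

lemma H2_0_dominated:
  assumes X: "X \<in> H2_0 M F T" and Q: "countable Q" "Q \<subseteq> {0..T}"
  shows "\<exists>S. integrable M S \<and> (AE \<omega> in M. \<forall>q\<in>Q. \<bar>X q \<omega>\<bar> \<le> S \<omega>)"
proof (rule dominated_by_square_sup[OF Q(1)])
  show "X q \<in> borel_measurable M" if "q \<in> Q" for q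
    using X Q(2) that measurable_F_M[of q "X q"] by (auto simp: H2_0_def martingale_def)
  have "(\<integral>\<^sup>+\<omega>. (SUP q\<in>Q. ennreal ((X q \<omega>)\<^sup>2)) \<partial>M) \<le> (\<integral>\<^sup>+\<omega>. (SUP t\<in>{0..T}. ennreal ((X t \<omega>)\<^sup>2)) \<partial>M)"
    by (intro nn_integral_mono SUP_subset_mono Q(2)) auto
  also have "\<dots> < \<infinity>" using X by (simp add: H2_0_def)
  finally show "(\<integral>\<^sup>+\<omega>. (SUP q\<in>Q. ennreal ((X q \<omega>)\<^sup>2)) \<partial>M) < \<infinity>" .
qed

lemma H2_0_square_integrable:
  assumes X: "X \<in> H2_0 M F T" and t: "t \<in> {0..T}"
  shows "integrable M (\<lambda>\<omega>. (X t \<omega>)\<^sup>2)"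
proof (rule integrableI_nonneg)
  have "X t \<in> borel_measurable (F t)" using X t by (auto simp: H2_0_def martingale_def)
  from measurable_F_M[OF t this] show "(\<lambda>\<omega>. (X t \<omega>)\<^sup>2) \<in> borel_measurable M" by simp
  have "(\<integral>\<^sup>+\<omega>. ennreal ((X t \<omega>)\<^sup>2) \<partial>M) \<le> (\<integral>\<^sup>+\<omega>. (SUP t\<in>{0..T}. ennreal ((X t \<omega>)\<^sup>2)) \<partial>M)"
    by (intro nn_integral_mono SUP_upper t)
  also have "\<dots> < \<infinity>" using X by (simp add: H2_0_def)
  finally show "(\<integral>\<^sup>+\<omega>. ennreal ((X t \<omega>)\<^sup>2) \<partial>M) < \<infinity>" .
qed auto

lemma angular_bracket_integrable:
  assumes X: "X \<in> H2_0 M F T" and A: "angular_bracket M F T X A"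
  shows "integrable M (A T)"
proof -
  have T: "T \<in> {0..T}" using T_pos by simp
  have "integrable M (\<lambda>\<omega>. (X T \<omega>)\<^sup>2 - A T \<omega>)"
    using A T unfolding angular_bracket_def martingale_def by blast
  from Bochner_Integration.integrable_diff[OF H2_0_square_integrable[OF X T] this] show ?thesis by simp
qed

end

context identification_at
begin

lemma carre_du_champ_unique:
  assumes \<psi>: "AE \<omega> in Q. set_integrable lborel {s..T} (\<lambda>r. \<psi> r (\<omega> r))"
    and M': "extended_martingale T P u \<psi> s x M'"
    and A': "angular_bracket Qc Fc T M' A'"
    and G': "AE \<omega> in Q. set_integrable lborel {s..T} (\<lambda>r. G' r (\<omega> r)) \<and> (\<forall>t\<in>{s..T}. A' t \<omega> = (LBINT r:{s..t}. G' r (\<omega> r)))"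
  shows "AE \<omega> in Q. AE r in lborel. r \<in> {s..T} \<longrightarrow> (v r (\<omega> r))\<^sup>2 = G' r (\<omega> r)"
proof -
  obtain M where M: "extended_martingale T P u (\<lambda>r y. - F r y) s x M" using extended_martingale_exists by blast
  obtain A where A: "angular_bracket Qc Fc T M A"
    and AV: "AE \<omega> in Q. set_integrable lborel {s..T} (\<lambda>r. (v r (\<omega> r))\<^sup>2) \<and> (\<forall>t\<in>{s..T}. A t \<omega> = (LBINT r:{s..t}. (v r (\<omega> r))\<^sup>2))"
    using angular_bracket_exists[OF M] by blast
  have H2: "M \<in> H2_0 Qc Fc T" "M' \<in> H2_0 Qc Fc T" using M M' by (auto simp: extended_martingale_def)
  have mart: "martingale Qc Fc {0..T} M" "martingale Qc Fc {0..T} M'" using H2 by (auto simp: H2_0_def)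
  have s_le: "t \<in> {0..T}" if "t \<in> {s..T}" for t using that s by auto
  have MM': "AE \<omega> in Qc. M t \<omega> - M' t \<omega> = 0" if t: "t \<in> {0..T}" for t
  proof (rule C.martingale_eq_0[OF C.martingale_diff[OF mart] _ t])
    show "AE \<omega> in Qc. M T \<omega> - M' T \<omega> = 0"
    \<comment> \<open>Both martingales contain \<open>u t (\<omega> t) - u s x\<close>, which
      cancels. As the generator behind \<open>M\<close> is \<open>- F\<close>, the integral of
      \<open>F + \<psi>\<close> remains.\<close>
    proof (rule C.absolutely_continuous_martingale_eq_0[OF C.martingale_diff[OF mart] s, where \<theta>="\<lambda>\<omega> r. F r (\<omega> r) + \<psi> r (\<omega> r)"])
      fix D assume D: "countable D" "D \<subseteq> {s..T}"
      then have D': "D \<subseteq> {0..T}" using s by auto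
      obtain S S' where S: "integrable Qc S" "AE \<omega> in Qc. \<forall>q\<in>D. \<bar>M q \<omega>\<bar> \<le> S \<omega>"
        "integrable Qc S'" "AE \<omega> in Qc. \<forall>q\<in>D. \<bar>M' q \<omega>\<bar> \<le> S' \<omega>"
        using C.H2_0_dominated[OF H2(1) D(1) D'] C.H2_0_dominated[OF H2(2) D(1) D'] by blast
      have "AE \<omega> in Qc. \<forall>q\<in>D. \<bar>M q \<omega> - M' q \<omega>\<bar> \<le> S \<omega> + S' \<omega>"
        using S(2,4) by eventually_elim fastforce
      with S(1,3) show "\<exists>S. integrable Qc S \<and> (AE \<omega> in Qc. \<forall>q\<in>D. \<bar>M q \<omega> - M' q \<omega>\<bar> \<le> S \<omega>)"
        by (intro exI[of _ "\<lambda>\<omega>. S \<omega> + S' \<omega>"]) auto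
    next
      show "AE \<omega> in Qc. set_integrable lborel {s..T} (\<lambda>r. F r (\<omega> r) + \<psi> r (\<omega> r))"
        using AE_completion[OF F_path] AE_completion[OF \<psi>] by eventually_elim (rule set_integral_add(1))
    next
      fix t assume t: "t \<in> {s..T}"
      have "AE \<omega> in Q. M' t \<omega> = indicator {s..T} t * (u t (\<omega> t) - u s x - (LBINT r:{s..t}. \<psi> r (\<omega> r)))"
        using M' s_le[OF t] by (auto simp: extended_martingale_def)
      then have "AE \<omega> in Q. M t \<omega> - M' t \<omega> = (LBINT r:{s..t}. F r (\<omega> r) + \<psi> r (\<omega> r))"
        using extended_martingale_AE[OF M s_le[OF t]] F_path \<psi>
      proof eventually_elim
        case (elim \<omega>)
        have "set_integrable lborel {s..t} (\<lambda>r. F r (\<omega> r))" "set_integrable lborel {s..t} (\<lambda>r. \<psi> r (\<omega> r))"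
          by (rule set_integrable_subset[OF elim(3)] set_integrable_subset[OF elim(4)]; use t in auto)+
        then show ?case using elim(1,2) t by (simp add: N_eq(1)[OF t] K_def U_def I_def)
      qed
      then show "AE \<omega> in Qc. M t \<omega> - M' t \<omega> = (LBINT r:{s..t}. F r (\<omega> r) + \<psi> r (\<omega> r))" by (rule AE_completion)
    qed
  qed
  \<comment> \<open>As \<open>M\<close> and \<open>M'\<close> agree almost surely at each time, the
    squares cancel and \<open>D\<close> is the difference of the brackets, an integral in
    time.\<close>
  define D where "D t \<omega> = ((M' t \<omega>)\<^sup>2 - A' t \<omega>) - ((M t \<omega>)\<^sup>2 - A t \<omega>)" for t \<omega>
  have Dmart: "martingale Qc Fc {0..T} D"
    unfolding D_def[abs_def] by (rule C.martingale_diff) (use A A' in \<open>auto simp: angular_bracket_def\<close>)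
  have D_eq: "AE \<omega> in Qc. D t \<omega> = A t \<omega> - A' t \<omega>" if t: "t \<in> {0..T}" for t
    using MM'[OF t] by eventually_elim (simp add: D_def)
  have D_int: "AE \<omega> in Qc. D t \<omega> = (LBINT r:{s..t}. (v r (\<omega> r))\<^sup>2 - G' r (\<omega> r))" if t: "t \<in> {s..T}" for t
    using D_eq[OF s_le[OF t]] AE_completion[OF AV] AE_completion[OF G']
  proof eventually_elim
    case (elim \<omega>)
    have "set_integrable lborel {s..t} (\<lambda>r. (v r (\<omega> r))\<^sup>2)" "set_integrable lborel {s..t} (\<lambda>r. G' r (\<omega> r))"
      by (rule set_integrable_subset[OF conjunct1[OF elim(2)]] set_integrable_subset[OF conjunct1[OF elim(3)]]; use t in auto)+
    then show ?case using elim t by simp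
  qed
  have D0: "AE \<omega> in Qc. D t \<omega> = 0" if t: "t \<in> {0..T}" for t
  proof (rule C.martingale_eq_0[OF Dmart _ t])
    show "AE \<omega> in Qc. D T \<omega> = 0"
    proof (rule C.absolutely_continuous_martingale_eq_0[OF Dmart s _ _ D_int])
      show "AE \<omega> in Qc. set_integrable lborel {s..T} (\<lambda>r. (v r (\<omega> r))\<^sup>2 - G' r (\<omega> r))"
        using AE_completion[OF AV] AE_completion[OF G'] by eventually_elim (auto intro: set_integral_diff(1))
    next
      fix E assume E: "countable E" "E \<subseteq> {s..T}"
      have int: "integrable Qc (\<lambda>\<omega>. A T \<omega> + A' T \<omega>)"
        by (intro Bochner_Integration.integrable_add C.angular_bracket_integrable[OF H2(1) A] C.angular_bracket_integrable[OF H2(2) A'])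
      have "AE \<omega> in Qc. \<forall>q\<in>E. D q \<omega> = A q \<omega> - A' q \<omega>"
        using E D_eq s by (subst AE_ball_countable) auto
      moreover have "AE \<omega> in Qc. A 0 \<omega> = 0 \<and> mono_on {0..T} (\<lambda>t. A t \<omega>)" "AE \<omega> in Qc. A' 0 \<omega> = 0 \<and> mono_on {0..T} (\<lambda>t. A' t \<omega>)"
        using A A' by (auto simp: angular_bracket_def)
      \<comment> \<open>Brackets increase from 0, so their terminal values bound them; these are
        integrable because the squared martingales are.\<close>
      ultimately have "AE \<omega> in Qc. \<forall>q\<in>E. \<bar>D q \<omega>\<bar> \<le> A T \<omega> + A' T \<omega>"
      proof eventually_elim
        case (elim \<omega>)
        show ?case
        proof
          fix q assume q: "q \<in> E"
          then have q': "0 \<le> q" "q \<le> T" using E(2) s by auto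
          have "0 \<le> A q \<omega>" "A q \<omega> \<le> A T \<omega>" "0 \<le> A' q \<omega>" "A' q \<omega> \<le> A' T \<omega>"
            using elim(2,3) q' mono_onD[of "{0..T}" "\<lambda>t. A t \<omega>" 0 q] mono_onD[of "{0..T}" "\<lambda>t. A t \<omega>" q T]
              mono_onD[of "{0..T}" "\<lambda>t. A' t \<omega>" 0 q] mono_onD[of "{0..T}" "\<lambda>t. A' t \<omega>" q T] by auto
          then show "\<bar>D q \<omega>\<bar> \<le> A T \<omega> + A' T \<omega>" using elim(1) q by auto
        qed
      qed
      with int show "\<exists>S. integrable Qc S \<and> (AE \<omega> in Qc. \<forall>q\<in>E. \<bar>D q \<omega>\<bar> \<le> S \<omega>)" by blast
    qed
  qed
  have "countable ({s<..<T} \<inter> \<rat>)" using countable_rat by (rule countable_subset[rotated]) auto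
  then have "AE \<omega> in Qc. \<forall>t\<in>{s<..<T} \<inter> \<rat>. (LBINT r:{s..t}. (v r (\<omega> r))\<^sup>2 - G' r (\<omega> r)) = 0"
  proof (subst AE_ball_countable, safe)
    fix t assume "t \<in> {s<..<T}"
    then have t: "t \<in> {s..T}" by auto
    show "AE \<omega> in Qc. (LBINT r:{s..t}. (v r (\<omega> r))\<^sup>2 - G' r (\<omega> r)) = 0"
      using D_int[OF t] D0[OF s_le[OF t]] by eventually_elim simp
  qed
  then have "AE \<omega> in Q. \<forall>t\<in>{s<..<T} \<inter> \<rat>. (LBINT r:{s..t}. (v r (\<omega> r))\<^sup>2 - G' r (\<omega> r)) = 0"
    by (simp only: AE_completion_iff)
  then show ?thesis using AV G'
  proof eventually_elim
    case (elim \<omega>)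
    have "set_integrable lborel {s..T} (\<lambda>r. (v r (\<omega> r))\<^sup>2 - G' r (\<omega> r))"
      using elim(2,3) by (intro set_integral_diff(1)) auto
    from AE_eq_0_if_indefinite_integral_eq_0[OF this] elim(1)
    show ?case by simp
  qed
qed

end

section \<open>Decoupled mild solutions are martingale solutions\<close>

context markov_class
begin

lemma LX_borel: "\<phi> \<in> LX T P q \<Longrightarrow> \<phi> \<in> borel_funs T"
  by (simp add: LX_def)

lemma LX_square_path_integrable:
  assumes "\<phi> \<in> LX T P 2"
  shows "path_integrable (\<lambda>r y. (\<phi> r y)\<^sup>2)"
  using assms unfolding LX_def path_integrable_def by (auto intro: borel_funs_power)

lemma zero_potential_empty: "zero_potential T P {}"
  by (simp add: zero_potential_def)

lemma eq_up_to_zero_potentialI: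
  assumes \<phi>: "\<phi> \<in> borel_funs T" and \<psi>: "\<psi> \<in> borel_funs T"
    and eq: "\<And>s x. s \<in> {0..T} \<Longrightarrow> AE \<omega> in P s x. AE r in lborel. r \<in> {s..T} \<longrightarrow> \<phi> r (\<omega> r) = \<psi> r (\<omega> r)"
  shows "eq_up_to_zero_potential T P \<phi> \<psi>"
  unfolding eq_up_to_zero_potential_def zero_potential_def
proof (intro conjI ballI allI)
  let ?A = "{(t, x). t \<in> {0..T} \<and> \<phi> t x \<noteq> \<psi> t x}"
  show "?A \<subseteq> {0..T} \<times> UNIV" by auto
  let ?d = "\<lambda>(t, x). indicator {0..T} t * (\<phi> t x - \<psi> t x)"
  have "?d -` (- {0}) \<inter> space (borel \<Otimes>\<^sub>M borel) \<in> sets (borel \<Otimes>\<^sub>M borel)"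
    by (rule measurable_sets[OF borel_funs_measurable[OF borel_funs_diff[OF \<phi> \<psi>]]]) simp
  also have "?d -` (- {0}) \<inter> space (borel \<Otimes>\<^sub>M borel) = ?A"
    by (auto simp: space_pair_measure indicator_def)
  finally show "?A \<in> sets borel" unfolding borel_prod .
  fix s x assume s: "s \<in> {0..T}"
  have "(\<integral>\<^sup>+\<omega>. (\<integral>\<^sup>+t\<in>{s..T}. indicator ?A (t, \<omega> t) \<partial>lborel) \<partial>P s x) = (\<integral>\<^sup>+\<omega>. 0 \<partial>P s x)"
  proof (rule nn_integral_cong_AE, use eq[OF s, of x] in eventually_elim)
    fix \<omega> assume ae: "AE r in lborel. r \<in> {s..T} \<longrightarrow> \<phi> r (\<omega> r) = \<psi> r (\<omega> r)"
    have "(\<integral>\<^sup>+t\<in>{s..T}. indicator ?A (t, \<omega> t) \<partial>lborel) = (\<integral>\<^sup>+t. 0 \<partial>(lborel :: real measure))"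
      by (rule nn_integral_cong_AE, use ae in eventually_elim) (auto simp: indicator_def)
    then show "(\<integral>\<^sup>+t\<in>{s..T}. indicator ?A (t, \<omega> t) \<partial>lborel) = 0" by simp
  qed
  then show "(\<integral>\<^sup>+\<omega>. (\<integral>\<^sup>+t\<in>{s..T}. indicator ?A (t, \<omega> t) \<partial>lborel) \<partial>P s x) = 0" by simp
qed

end

section \<open>From the growth condition to the identification locale\<close>

lemma borel_funs_compose:
  assumes f: "(\<lambda>(t, x, y, z). f t x y z) \<in> borel_measurable (restrict_space borel ({0..T} \<times> UNIV))"
    and u: "u \<in> borel_funs T" and v: "v \<in> borel_funs T"
  shows "(\<lambda>t x. f t x (u t x) (v t x)) \<in> borel_funs T"
proof -
  let ?R = "restrict_space borel ({0..T} \<times> UNIV) :: (real \<times> 'a) measure"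
  have "(\<lambda>w. (fst w, snd w, u (fst w) (snd w), v (fst w) (snd w))) \<in> measurable ?R (restrict_space borel ({0..T} \<times> UNIV))"
  proof (rule measurable_restrict_space2)
    show "(\<lambda>w. (fst w, snd w, u (fst w) (snd w), v (fst w) (snd w))) \<in> space ?R \<rightarrow> {0..T} \<times> UNIV"
      by (auto simp: space_restrict_space)
    have "fst \<in> borel_measurable ?R" "snd \<in> borel_measurable ?R"
      by (intro measurable_restrict_space1; simp add: borel_prod[symmetric])+
    then show "(\<lambda>w. (fst w, snd w, u (fst w) (snd w), v (fst w) (snd w))) \<in> borel_measurable ?R"
      using u v unfolding borel_funs_def by (intro borel_measurable_Pair) (auto simp: case_prod_beta')
  qed
  from measurable_compose[OF this f] show ?thesis
    unfolding borel_funs_def by (simp add: case_prod_beta')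
qed

text \<open>The growth bound makes the composite square integrable along paths: \<open>u\<close>,
  \<open>v\<close> and \<open>f\<close> at \<open>(0, 0)\<close> all lie in
  \<open>LX T P 2\<close>.\<close>

lemma identificationI:
  fixes f :: "real \<Rightarrow> 'e::polish_space \<Rightarrow> real \<Rightarrow> real \<Rightarrow> real"
  assumes "markov_class T p P"
    and f: "(\<lambda>(t, x, y, z). f t x y z) \<in> borel_measurable (restrict_space borel ({0..T} \<times> UNIV))"
    and g: "g \<in> borel_measurable borel" "\<forall>s\<in>{0..T}. \<forall>x. integrable (P s x) (\<lambda>\<omega>. (g (\<omega> T))\<^sup>2)"
    and f0: "(\<lambda>t x. f t x 0 0) \<in> LX T P 2"
    and lip: "\<forall>t\<in>{0..T}. \<forall>x y z. \<bar>f t x y z\<bar> \<le> \<bar>f t x 0 0\<bar> + C * (\<bar>y\<bar> + \<bar>z\<bar>)"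
    and IP: "solves_IP T P f g u v"
  shows "identification T p P (\<lambda>t x. f t x (u t x) (v t x)) u v g"
proof -
  interpret markov_class T p P by fact
  let ?F = "\<lambda>t x. f t x (u t x) (v t x)"
  have uv: "u \<in> LX T P 2" "v \<in> LX T P 2" using IP by (auto simp: solves_IP_def)
  have F: "?F \<in> borel_funs T" by (rule borel_funs_compose[OF f LX_borel[OF uv(1)] LX_borel[OF uv(2)]])
  note sq = LX_square_path_integrable[OF f0] LX_square_path_integrable[OF uv(1)] LX_square_path_integrable[OF uv(2)]
  have scaled: "path_integrable (\<lambda>t x. c * (\<phi> t x)\<^sup>2)" if \<phi>: "path_integrable (\<lambda>t x. (\<phi> t x)\<^sup>2)" for c \<phi>
  proof -
    have b: "(\<lambda>t x. c * (\<phi> t x)\<^sup>2) \<in> borel_funs T" by (rule borel_funs_cmult[OF path_integrable_borel[OF \<phi>]])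
    have "(\<integral>\<^sup>+\<omega>. (\<integral>\<^sup>+r\<in>{s..T}. ennreal \<bar>c * (\<phi> r (\<omega> r))\<^sup>2\<bar> \<partial>lborel) \<partial>P s x) < \<infinity>" if s: "s \<in> {0..T}" for s x
    proof -
      have eq: "(\<integral>\<^sup>+r\<in>{s..T}. ennreal \<bar>c * (\<phi> r (\<omega> r))\<^sup>2\<bar> \<partial>lborel) = ennreal \<bar>c\<bar> * (\<integral>\<^sup>+r\<in>{s..T}. ennreal ((\<phi> r (\<omega> r))\<^sup>2) \<partial>lborel)"
        if "\<omega> \<in> space (P s x)" for \<omega>
      proof -
        have m: "(\<lambda>r. ennreal ((\<phi> r (\<omega> r))\<^sup>2) * indicator {s..T} r) \<in> borel_measurable lborel"
        proof -
          have "(\<lambda>r. ennreal (indicator {s..T} r * (\<phi> r (\<omega> r))\<^sup>2)) \<in> borel_measurable lborel"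
            by (rule measurable_compose[OF path_process_section[OF path_integrable_borel[OF \<phi>] s _ _ that] measurable_ennreal])
               (use s in auto)
          also have "(\<lambda>r. ennreal (indicator {s..T} r * (\<phi> r (\<omega> r))\<^sup>2)) = (\<lambda>r. ennreal ((\<phi> r (\<omega> r))\<^sup>2) * indicator {s..T} r)"
            by (auto simp: fun_eq_iff indicator_def)
          finally show ?thesis .
        qed
        show ?thesis
          by (subst nn_integral_cmult[OF m, symmetric]) (simp add: abs_mult ennreal_mult mult.assoc)
      qed
      have "(\<integral>\<^sup>+\<omega>. (\<integral>\<^sup>+r\<in>{s..T}. ennreal \<bar>c * (\<phi> r (\<omega> r))\<^sup>2\<bar> \<partial>lborel) \<partial>P s x)
          = ennreal \<bar>c\<bar> * (\<integral>\<^sup>+\<omega>. (\<integral>\<^sup>+r\<in>{s..T}. ennreal ((\<phi> r (\<omega> r))\<^sup>2) \<partial>lborel) \<partial>P s x)"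
        by (subst nn_integral_cmult[symmetric])
           (use path_nn_integral_P[OF path_integrable_borel[OF \<phi>] s, of s T x] s in \<open>auto intro!: nn_integral_cong eq\<close>)
      also have "\<dots> < \<infinity>"
        using path_integrable_fin[OF \<phi> s, of x] by (simp add: ennreal_mult_less_top)
      finally show ?thesis .
    qed
    with b show ?thesis by (auto simp: path_integrable_def)
  qed
  have bs: "(\<lambda>t x. (f t x 0 0)\<^sup>2) \<in> borel_funs T" "(\<lambda>t x. (u t x)\<^sup>2) \<in> borel_funs T" "(\<lambda>t x. (v t x)\<^sup>2) \<in> borel_funs T"
    using sq path_integrable_borel by auto
  have sum: "path_integrable (\<lambda>t x. 3 * C\<^sup>2 * (u t x)\<^sup>2 + 3 * C\<^sup>2 * (v t x)\<^sup>2)"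
    by (rule path_integrable_bound[OF scaled[OF sq(2), of "3 * C\<^sup>2"] scaled[OF sq(3), of "3 * C\<^sup>2"]])
       (auto intro!: borel_funs_add borel_funs_cmult bs)
  have F2: "path_integrable (\<lambda>t x. (?F t x)\<^sup>2)"
  proof (rule path_integrable_bound[OF scaled[OF sq(1), of 3] sum borel_funs_power[OF F]])
    fix t x assume "t \<in> {0..T}"
    then have "\<bar>?F t x\<bar> \<le> \<bar>f t x 0 0\<bar> + C * (\<bar>u t x\<bar> + \<bar>v t x\<bar>)" using lip by blast
    then have "\<bar>?F t x\<bar>\<^sup>2 \<le> (\<bar>f t x 0 0\<bar> + C * (\<bar>u t x\<bar> + \<bar>v t x\<bar>))\<^sup>2" by (intro power_mono) auto
    \<comment> \<open>The square of a sum of three terms is at most three times the sum of the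
      squares; this explains 3 and \<open>3 * C\<^sup>2\<close>.\<close>
    also have "\<dots> \<le> 3 * (f t x 0 0)\<^sup>2 + (3 * C\<^sup>2 * (u t x)\<^sup>2 + 3 * C\<^sup>2 * (v t x)\<^sup>2)"
    proof -
      have "(a + (b + c))\<^sup>2 \<le> 3 * a\<^sup>2 + (3 * b\<^sup>2 + 3 * c\<^sup>2)" for a b c :: real
      proof -
        have "0 \<le> (a - b)\<^sup>2 + (b - c)\<^sup>2 + (a - c)\<^sup>2" by simp
        then show ?thesis by (simp add: power2_eq_square algebra_simps)
      qed
      from this[of "\<bar>f t x 0 0\<bar>" "C * \<bar>u t x\<bar>" "C * \<bar>v t x\<bar>"] show ?thesis
        by (simp add: distrib_left power_mult_distrib mult.assoc)
    qed
    finally show "\<bar>(?F t x)\<^sup>2\<bar> \<le> \<bar>3 * (f t x 0 0)\<^sup>2\<bar> + \<bar>3 * C\<^sup>2 * (u t x)\<^sup>2 + 3 * C\<^sup>2 * (v t x)\<^sup>2\<bar>"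
      by simp
  qed
  have ip: "u s x = transition_op P s T g x + (LBINT r:{s..T}. transition_op P s r (?F r) x)"
    "(u s x)\<^sup>2 = transition_op P s T (\<lambda>y. (g y)\<^sup>2) x
        - (LBINT r:{s..T}. transition_op P s r (\<lambda>y. (v r y)\<^sup>2 - 2 * u r y * ?F r y) x)"
    if "s \<in> {0..T}" for s x
    using IP that unfolding solves_IP_def by blast+
  show ?thesis
    by unfold_locales ((rule F LX_borel[OF uv(1)] LX_borel[OF uv(2)] F2 sq(2) sq(3) g(1)) | (rule g(2)[rule_format] ip, assumption))+
qed

context identification
begin

lemma extended_generator_u: "extended_generator T P u (\<lambda>t x. - F t x)"
  unfolding extended_generator_def
proof (intro conjI ballI allI u_borel borel_funs_uminus F_borel)
  fix s x assume s: "s \<in> {0..T}"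
  interpret identification_at T p P F u v g s x by unfold_locales (rule s)
  show "AE \<omega> in P s x. set_integrable lborel {s..T} (\<lambda>r. - F r (\<omega> r))"
    using F_path by eventually_elim (simp add: set_integrable_def)
  show "\<exists>M. extended_martingale T P u (\<lambda>t x. - F t x) s x M" by (rule extended_martingale_exists)
qed

lemma extended_carre_du_champ_u: "extended_carre_du_champ T P u (\<lambda>t x. (v t x)\<^sup>2)"
  unfolding extended_carre_du_champ_def
proof (intro conjI exI[of _ "\<lambda>t x. - F t x"] extended_generator_u borel_funs_power v_borel ballI allI impI)
  fix s x M assume s: "s \<in> {0..T}" and M: "extended_martingale T P u (\<lambda>t x. - F t x) s x M"
  interpret identification_at T p P F u v g s x by unfold_locales (rule s)
  show "\<exists>A. angular_bracket (completion (P s x)) (completed_filtration (path_filtration T) (P s x)) T M A \<and>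
      (AE \<omega> in P s x. set_integrable lborel {s..T} (\<lambda>r. (v r (\<omega> r))\<^sup>2) \<and> (\<forall>t\<in>{s..T}. A t \<omega> = (LBINT r:{s..t}. (v r (\<omega> r))\<^sup>2)))"
    by (rule angular_bracket_exists[OF M])
qed simp

text \<open>A version \<open>G\<close> comes with its own generator \<open>\<psi>\<close>, which may
  differ from \<open>- F\<close>; the martingales built from the two generators must be identified
  before the brackets can be compared.\<close>

lemma extended_carre_du_champ_eq:
  assumes G: "extended_carre_du_champ T P u G"
  shows "eq_up_to_zero_potential T P (\<lambda>t x. (v t x)\<^sup>2) G"
proof (rule eq_up_to_zero_potentialI[OF borel_funs_power[OF v_borel]])
  show "G \<in> borel_funs T" using G by (simp add: extended_carre_du_champ_def)
  fix s x assume s: "s \<in> {0..T}"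
  interpret identification_at T p P F u v g s x by unfold_locales (rule s)
  obtain \<psi> where \<psi>: "extended_generator T P u \<psi>"
    and bracket: "\<forall>s\<in>{0..T}. \<forall>x. \<forall>M. extended_martingale T P u \<psi> s x M \<longrightarrow>
           (\<exists>A. angular_bracket (completion (P s x)) (completed_filtration (path_filtration T) (P s x)) T M A \<and>
                (AE \<omega> in P s x. set_integrable lborel {s..T} (\<lambda>r. G r (\<omega> r)) \<and>
                   (\<forall>t\<in>{s..T}. A t \<omega> = (LBINT r:{s..t}. G r (\<omega> r)))))"
    using G unfolding extended_carre_du_champ_def by blast
  obtain M where M: "extended_martingale T P u \<psi> s x M" and \<psi>_int: "AE \<omega> in P s x. set_integrable lborel {s..T} (\<lambda>r. \<psi> r (\<omega> r))"
    using \<psi> s unfolding extended_generator_def by blast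
  obtain A where A: "angular_bracket (completion (P s x)) (completed_filtration (path_filtration T) (P s x)) T M A"
    "AE \<omega> in P s x. set_integrable lborel {s..T} (\<lambda>r. G r (\<omega> r)) \<and> (\<forall>t\<in>{s..T}. A t \<omega> = (LBINT r:{s..t}. G r (\<omega> r)))"
    using bracket s M by blast
  show "AE \<omega> in P s x. AE r in lborel. r \<in> {s..T} \<longrightarrow> (v r (\<omega> r))\<^sup>2 = G r (\<omega> r)"
    by (rule carre_du_champ_unique[OF \<psi>_int M A])
qed

lemma u_terminal: "u T x = g x"
proof -
  have "T \<in> {0..T}" using T_pos by simp
  then interpret identification_at T p P F u v g T x by unfold_locales
  show ?thesis by (rule u_T)
qed

end

text \<open>The carre du champ is a relation, so the last claim has two halves: some version exists,
  and every version agrees with the square of \<open>v\<close> up to a set of zero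
  potential.\<close>

theorem proposition3p8:
  fixes T C :: real
    and p :: "real \<Rightarrow> 'e::polish_space \<Rightarrow> real \<Rightarrow> 'e measure"
    and P :: "real \<Rightarrow> 'e \<Rightarrow> (real \<Rightarrow> 'e) measure"
    and D :: "(real \<Rightarrow> 'e \<Rightarrow> real) set"
    and a :: "(real \<Rightarrow> 'e \<Rightarrow> real) \<Rightarrow> (real \<Rightarrow> 'e \<Rightarrow> real)"
    and f :: "real \<Rightarrow> 'e \<Rightarrow> real \<Rightarrow> real \<Rightarrow> real"
    and g :: "'e \<Rightarrow> real"
  assumes "0 < T"
    and "transition_function T p"
    and "measurable_in_time T p"
    and "markov_canonical_class T p P"
    and "linear_operator_on_algebra T D a"
    and "solves_well_posed_martingale_problem T D a P"
    and "(\<lambda>(t, x, y, z). f t x y z) \<in> borel_measurable (restrict_space borel ({0..T} \<times> UNIV))"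
    and "g \<in> borel_measurable borel"
    and "0 < C"
    and "\<forall>s\<in>{0..T}. \<forall>x. integrable (P s x) (\<lambda>\<omega>. (g (\<omega> T))\<^sup>2)"
    and "(\<lambda>t x. f t x 0 0) \<in> LX T P 2"
    and "\<forall>t\<in>{0..T}. \<forall>x y z. \<bar>f t x y z\<bar> \<le> \<bar>f t x 0 0\<bar> + C * (\<bar>y\<bar> + \<bar>z\<bar>)"
  shows "(\<forall>u. decoupled_mild_solution T P f g u \<longrightarrow> martingale_solution T P f g u) \<and>
         (\<forall>u v. solves_IP T P f g u v \<longrightarrow>
            (\<exists>G. extended_carre_du_champ T P u G) \<and>
            (\<forall>G. extended_carre_du_champ T P u G \<longrightarrow>
               eq_up_to_zero_potential T P (\<lambda>t x. (v t x)\<^sup>2) G))"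
proof -
  have "markov_class T p P" using assms(1,2,4) by unfold_locales
  note id = identificationI[OF this assms(7,8,10,11,12)]
  have solution: "martingale_solution T P f g u" if IP: "solves_IP T P f g u v" for u v
  proof -
    interpret identification T p P "\<lambda>t x. f t x (u t x) (v t x)" u v g by (rule id[OF IP])
    have "\<And>t x. t \<in> {0..T} \<Longrightarrow> 0 \<le> v t x" using IP by (auto simp: solves_IP_def)
    \<comment> \<open>As \<open>v\<close> is nonnegative, \<open>sqrt\<close> of its square is
      \<open>v\<close> itself, and the exceptional set is empty rather than merely of zero
      potential.\<close>
    then have empty: "{(t, x). t \<in> {0..T} \<and> - f t x (u t x) (v t x) \<noteq> - f t x (u t x) (sqrt ((v t x)\<^sup>2))} = {}"
      by auto
    have "eq_up_to_zero_potential T P (\<lambda>t x. - f t x (u t x) (v t x)) (\<lambda>t x. - f t x (u t x) (sqrt ((v t x)\<^sup>2)))"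
      unfolding eq_up_to_zero_potential_def empty by (rule zero_potential_empty)
    then show ?thesis
      unfolding martingale_solution_def extended_domain_def
      using extended_generator_u extended_carre_du_champ_u u_terminal by blast
  qed
  have "(\<exists>G. extended_carre_du_champ T P u G) \<and>
      (\<forall>G. extended_carre_du_champ T P u G \<longrightarrow> eq_up_to_zero_potential T P (\<lambda>t x. (v t x)\<^sup>2) G)"
    if IP: "solves_IP T P f g u v" for u v
  proof -
    interpret identification T p P "\<lambda>t x. f t x (u t x) (v t x)" u v g by (rule id[OF IP])
    show ?thesis using extended_carre_du_champ_u extended_carre_du_champ_eq by blast
  qed
  with solution show ?thesis unfolding decoupled_mild_solution_def by blast
qed

end
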